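(* Let $k_d\in(-\sqrt2,0)$, $h>0$, $k_f>0$, $l>0$, and let $\Omega=\Omega(k_d,h,k_f,l)$ be the billiard table described in the context, with dispersing boundary part $\Gamma_d$, focusing boundary part $\Gamma_f$ and flat boundary part $\Gamma_s$. Assume that (1) for all $s'\in\Gamma_d$ and all $s''\in\Gamma_f$, $I(s',s'')\subset D_4(s'')$; (2) $l\ge 1/k_f$. Let $\mathcal M=(\Gamma_f\cup\Gamma_d)\times[-\pi/2,\pi/2]$, let $\mathcal F:\mathcal M\to\mathcal M$ be the first-return map of the billiard flow to $\mathcal M$, let $\mu$ be its natural invariant measure, and let $C=\{C(x)\}_{x}$ be the measurable cone bundle defined in the context. Then $C$ is eventually strictly invariant relative to $\mathcal F$: for $\mu$-a.e. $x\in\mathcal M$ one has $(D\mathcal F)_xC(x)\subseteq C(\mathcal Fx)$, and for $\mu$-a.e. $x\in\mathcal M$ there exists an integer $n(x)\ge1$ such that $(D\mathcal F^{n(x)})_xC(x)$ is strictly contained in $C(\mathcal F^{n(x)}x)$, i.e. $(D\mathcal F^{n(x)})_x\big(C(x)\setminus\{0\}\big)\subset C^\circ(\mathcal F^{n(x)}x)$.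
   Context: **Table.** In the plane, take the unit square $[0,1]\times[h,1+h]$ and replace its left, upper and right sides by circular arcs of curvature $k_d\in(-\sqrt2,0)$ (i.e. of radius $1/|k_d|$, minor arcs) with the same endpoints (vertices of the square) and bulging towards the inside of the square; the union of these three dispersing arcs is $\Gamma_d$. Below, attach the rectangle $[0,1]\times[0,h]$ (the segment $[0,1]\times\{h\}$ is not a wall). Let $\Gamma_f$ be the focusing circular arc of curvature $k_f>0$ (radius $1/k_f$, minor arc) with endpoints $(0,0)$ and $(1,0)$, bulging downward (outward); the region between this arc and the segment $[0,1]\times\{0\}$ belongs to the table and the segment is not a wall. Finally attach the two strips $[-l,0]\times[0,h]$ and $[1,1+l]\times[0,h]$, open towards the rectangle. The resulting closed region is $\Omega$. Its boundary is $\Gamma=\Gamma_d\cup\Gamma_f\cup\Gamma_s$, where $\Gamma_s$ consists of the straight walls of the two strips (long horizontal sides and vertical end sides). **Billiard.** A point particle moves with unit speed in $\Omega$ and reflects at $\Gamma$ with angle of incidence equal to angle of reflection. Points of $\Gamma$ are identified with their arclength coordinate $s$ (oriented counterclockwise). The curvature $k(s)$ of $\Gamma$ is positive at focusing points ($k=k_f$ on $\Gamma_f$), negative at dispersing points ($k=k_d$ on $\Gamma_d$). A point $x=(s,\alpha)\in\mathcal M$ represents a particle leaving the boundary point $s\in\Gamma_f\cup\Gamma_d$ with inward velocity making angle $\alpha$ (oriented clockwise) with the inner normal. $\mathcal F$ is the first-return map to $\mathcal M$ (collisions with $\Gamma_s$ are not recorded); it is defined and differentiable $\mu$-almost everywhere,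 and preserves the probability measure $d\mu=c\cos\alpha\,ds\,d\alpha$. Write $x_n=(s_n,\alpha_n)=\mathcal F^nx$. **Discs.** For $s\in\Gamma_f\cup\Gamma_d$ and $\beta>0$ (resp. $\beta<0$), $D_\beta(s)$ is the closed disc of radius $1/|\beta k(s)|$ tangent to $\Gamma$ at $s$ on the internal (resp. external) side of $\Omega$. For $s'\in\Gamma_d$, $s''\in\Gamma_f$, $I(s',s'')$ is the intersection of the straight line through $s'$ and $s''$ with the disc $D_{-2}(s')$. (At endpoints of arcs, use the tangent line of the arc.) **Focal distance.** For $0\ne v=(ds,d\alpha)\in T_x\mathcal M$, $x=(s,\alpha)$, put $$f^+(v)=\frac{\cos\alpha}{k(s)-\frac{d\alpha}{ds}}\in\mathbb R\cup\{\infty\}\ \text{ if } ds\neq0,\qquad f^+(v)=0\ \text{ if } ds=0 .$$ This is the signed distance, along the outgoing oriented trajectory line, from the collision point to the point where the infinitesimal beam of outgoing trajectories determined by $v$ focuses. It is a projective coordinate on $T_x\mathcal M$, so a closed interval of values of $f^+$ in $\mathbb R\cup\{\infty\}$ determines a cone in $T_x\mathcal M$ (to which the vector $0$ is added), i.e. a set $\{av_1+bv_2: ab\ge0\}$ with $v_1,v_2$ linearly independent. $C^\circ$ denotes the interior of a cone $C$. **Cones.** With $k=k(s)$: - $C_0(x)=\{v: -\cos\alpha/|k|\le f^+(v)\le0\}$; - $C_1(x)=\{v: -\infty\le f^+(v)\le0\}$ (the value $f^+=\infty$, i.e. parallel outgoing beams, is included); - $C_2(x)=\{v: \cos\alpha/(2|k|)\le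 f^+(v)\le\cos\alpha/|k|\}$. The bundle $C$ is defined at $x=(s,\alpha)$, with $(s_{-1},\alpha_{-1})=\mathcal F^{-1}x$, by: - if $s\in\Gamma_d$, then $C(x)=C_0(x)$; - if $s\in\Gamma_f$ and $s_{-1}\in\Gamma_f$, then $C(x)=C_2(x)$; - if $s\in\Gamma_f$, $s_{-1}\in\Gamma_d$ and the trajectory has no collision with $\Gamma_s$ between $s_{-1}$ and $s$, then $C(x)=C_1(x)$; - if $s\in\Gamma_f$, $s_{-1}\in\Gamma_d$ and the trajectory has at least one collision with $\Gamma_s$ between $s_{-1}$ and $s$, then $C(x)=C_2(x)$. *)

theory Defs
  imports "HOL-Analysis.Analysis"
begin

text \<open>
  The plane is \<^typ>\<open>complex\<close>. A wall is a directed minor circular arc (or segment) from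
  \<open>src\<close> to \<open>dst\<close> of signed curvature \<open>curv\<close>: the arc turns left
  if \<open>curv > 0\<close>, right if \<open>curv < 0\<close>, and is straight if \<open>curv = 0\<close>.
  Such an arc exists iff \<open>\<bar>curv\<bar> * dist src dst \<le> 2\<close>. A boundary that is traversed
  counterclockwise has the table on its left, so it is focusing where \<open>curv > 0\<close> and dispersing
  where \<open>curv < 0\<close>.
\<close>

datatype wall = Wall (src: complex) (dst: complex) (curv: real)

text \<open>Half of the angle by which the tangent turns along the wall.\<close>

definition half_turn :: "wall \<Rightarrow> real" where
  "half_turn w = arcsin (curv w * dist (src w) (dst w) / 2)"

definition wall_length :: "wall \<Rightarrow> real" where
  "wall_length w =
     (if curv w = 0 then dist (src w) (dst w) else 2 * half_turn w / curv w)"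

definition wall_tangent :: "wall \<Rightarrow> real \<Rightarrow> complex" where
  "wall_tangent w t = sgn (dst w - src w) * cis (curv w * t - half_turn w)"

definition wall_normal :: "wall \<Rightarrow> real \<Rightarrow> complex" where
  "wall_normal w t = \<i> * wall_tangent w t"

text \<open>
  The arclength parametrization on \<open>{0..wall_length w}\<close>, i.e. the integral of
  \<^const>\<open>wall_tangent\<close> starting from \<open>src w\<close>.
\<close>

definition wall_point :: "wall \<Rightarrow> real \<Rightarrow> complex" where
  "wall_point w t = src w +
     (if curv w = 0 then t *\<^sub>R wall_tangent w 0
      else (wall_tangent w t - wall_tangent w 0) / (\<i> * of_real (curv w)))"

text \<open>
  The boundary of the table, counterclockwise from the origin: the focusing arc, the right strip,
  the right, upper and left dispersing arcs, the left strip.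
\<close>

definition table :: "real \<Rightarrow> real \<Rightarrow> real \<Rightarrow> real \<Rightarrow> wall list" where
  "table kd h kf l =
    [Wall (Complex 0 0) (Complex 1 0) kf,
     Wall (Complex 1 0) (Complex (1 + l) 0) 0,
     Wall (Complex (1 + l) 0) (Complex (1 + l) h) 0,
     Wall (Complex (1 + l) h) (Complex 1 h) 0,
     Wall (Complex 1 h) (Complex 1 (1 + h)) kd,
     Wall (Complex 1 (1 + h)) (Complex 0 (1 + h)) kd,
     Wall (Complex 0 (1 + h)) (Complex 0 h) kd,
     Wall (Complex 0 h) (Complex (- l) h) 0,
     Wall (Complex (- l) h) (Complex (- l) 0) 0,
     Wall (Complex (- l) 0) (Complex 0 0) 0]"

definition focusing_walls :: "wall list \<Rightarrow> wall set" where
  "focusing_walls W = {w \<in> set W. curv w > 0}"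

definition dispersing_walls :: "wall list \<Rightarrow> wall set" where
  "dispersing_walls W = {w \<in> set W. curv w < 0}"

definition boundary :: "wall list \<Rightarrow> complex set" where
  "boundary W = (\<Union>w\<in>set W. wall_point w ` {0..wall_length w})"

text \<open>
  The disc and the chord depend on a curved wall and a local arclength parameter on it rather than
  on a point of the plane, so that a common endpoint of two arcs is considered once with the tangent
  line of either arc.
\<close>

definition disc :: "real \<Rightarrow> wall \<Rightarrow> real \<Rightarrow> complex set" where
  "disc \<beta> w t =
     cball (wall_point w t + (1 / (\<beta> * \<bar>curv w\<bar>)) *\<^sub>R wall_normal w t) (1 / \<bar>\<beta> * curv w\<bar>)"

definition chord :: "wall \<Rightarrow> real \<Rightarrow> wall \<Rightarrow> real \<Rightarrow> complex set" where
  "chord w' t' w'' t'' =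
     affine hull {wall_point w' t', wall_point w'' t''} \<inter> disc (-2) w' t'"

text \<open>
  Global arclength: wall \<open>i\<close> of \<open>W\<close> occupies the interval from
  \<open>offset W i\<close> to \<open>offset W (Suc i)\<close>. Functions of the global coordinate are used only
  up to sets of measure zero or away from the corners, so their choice at the corners is immaterial.
\<close>

definition offset :: "wall list \<Rightarrow> nat \<Rightarrow> real" where
  "offset W i = (\<Sum>j<i. wall_length (W ! j))"

definition wall_index :: "wall list \<Rightarrow> real \<Rightarrow> nat" where
  "wall_index W s = (LEAST i. s < offset W (Suc i))"

definition wall_at :: "wall list \<Rightarrow> real \<Rightarrow> wall" where
  "wall_at W s = W ! wall_index W s"

definition point_at :: "wall list \<Rightarrow> real \<Rightarrow> complex" where
  "point_at W s = wall_point (wall_at W s) (s - offset W (wall_index W s))"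

definition normal_at :: "wall list \<Rightarrow> real \<Rightarrow> complex" where
  "normal_at W s = wall_normal (wall_at W s) (s - offset W (wall_index W s))"

definition curv_at :: "wall list \<Rightarrow> real \<Rightarrow> real" where
  "curv_at W s = curv (wall_at W s)"

definition non_corner :: "wall list \<Rightarrow> real \<Rightarrow> bool" where
  "non_corner W s \<longleftrightarrow> (\<exists>i<length W. offset W i < s \<and> s < offset W (Suc i))"

type_synonym state = "real \<times> real"

definition phase_space :: "wall list \<Rightarrow> state set" where
  "phase_space W =
     (\<Union>i\<in>{i. i < length W \<and> curv (W ! i) \<noteq> 0}. {offset W i..offset W (Suc i)})
       \<times> {- (pi/2)..pi/2}"

text \<open>The angle is oriented clockwise from the inner normal.\<close>

fun velocity :: "wall list \<Rightarrow> state \<Rightarrow> complex" where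
  "velocity W (s, \<alpha>) = normal_at W s * cis (- \<alpha>)"

text \<open>
  \<open>next_collision W x y\<close>: the particle leaving the boundary in state \<open>x\<close> next meets the
  boundary at the point of \<open>y\<close> and leaves it in state \<open>y\<close> after the elastic
  reflection. Corners and tangential collisions, where the motion is not defined or not
  differentiable, are excluded. As the outgoing velocity points into the table, the particle
  stays in the table until it meets the boundary again.
\<close>

definition next_collision :: "wall list \<Rightarrow> state \<Rightarrow> state \<Rightarrow> bool" where
  "next_collision W x y \<longleftrightarrow>
     non_corner W (fst x) \<and> \<bar>snd x\<bar> < pi/2 \<and> non_corner W (fst y) \<and> \<bar>snd y\<bar> < pi/2 \<and>
     (\<exists>t>0. point_at W (fst y) = point_at W (fst x) + t *\<^sub>R velocity W x \<and>
        (\<forall>u\<in>{0<..<t}. point_at W (fst x) + u *\<^sub>R velocity W x \<notin> boundary W)) \<and>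
     velocity W y = velocity W x -
       (2 * (velocity W x \<bullet> normal_at W (fst y))) *\<^sub>R normal_at W (fst y)"

text \<open>
  \<open>first_return W n x y\<close>: the trajectory of \<open>x\<close> returns to the phase space in
  \<open>y\<close>, after exactly \<open>n\<close> collisions with straight walls in between.
\<close>

definition first_return :: "wall list \<Rightarrow> nat \<Rightarrow> state \<Rightarrow> state \<Rightarrow> bool" where
  "first_return W n x y \<longleftrightarrow>
     x \<in> phase_space W \<and> y \<in> phase_space W \<and>
     (\<exists>z. z 0 = x \<and> z (Suc n) = y \<and>
        (\<forall>i\<le>n. next_collision W (z i) (z (Suc i))) \<and>
        (\<forall>i\<in>{1..n}. z i \<notin> phase_space W))"

definition return_dom :: "wall list \<Rightarrow> state set" where
  "return_dom W = {x. \<exists>n y. first_return W n x y}"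

definition return_map :: "wall list \<Rightarrow> state \<Rightarrow> state" where
  "return_map W x = (THE y. \<exists>n. first_return W n x y)"

definition flat_collisions :: "wall list \<Rightarrow> state \<Rightarrow> nat" where
  "flat_collisions W x = (THE n. \<exists>y. first_return W n x y)"

definition return_inv :: "wall list \<Rightarrow> state \<Rightarrow> state" where
  "return_inv W = inv_into (return_dom W) (return_map W)"

text \<open>The integral of \<open>cos\<close> over \<open>{-pi/2..pi/2}\<close> is 2.\<close>

definition invariant_measure :: "wall list \<Rightarrow> state measure" where
  "invariant_measure W =
     (let c = 1 / (2 * (\<Sum>i\<in>{i. i < length W \<and> curv (W ! i) \<noteq> 0}. wall_length (W ! i)))
      in density lborel
           (\<lambda>(s, \<alpha>). ennreal (c * cos \<alpha> * indicator (phase_space W) (s, \<alpha>))))"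

text \<open>
  Focal distances are elements of the real line with one point at infinity; this point is
  represented by \<open>-\<infinity>\<close>, and \<open>\<infinity>\<close> is not a value.
\<close>

definition focal :: "wall list \<Rightarrow> state \<Rightarrow> real \<times> real \<Rightarrow> ereal" where
  "focal W x v =
     (let (s, \<alpha>) = x; (ds, d\<alpha>) = v; q = curv_at W s - d\<alpha> / ds
      in if ds = 0 then 0 else if q = 0 then - \<infinity> else ereal (cos \<alpha> / q))"

definition focal_cone ::
    "wall list \<Rightarrow> state \<Rightarrow> ereal \<Rightarrow> ereal \<Rightarrow> (real \<times> real) set" where
  "focal_cone W x a b = insert 0 {v. v \<noteq> 0 \<and> a \<le> focal W x v \<and> focal W x v \<le> b}"

definition cone0 :: "wall list \<Rightarrow> state \<Rightarrow> (real \<times> real) set" where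
  "cone0 W x = focal_cone W x (ereal (- (cos (snd x) / \<bar>curv_at W (fst x)\<bar>))) 0"

definition cone1 :: "wall list \<Rightarrow> state \<Rightarrow> (real \<times> real) set" where
  "cone1 W x = focal_cone W x (- \<infinity>) 0"

definition cone2 :: "wall list \<Rightarrow> state \<Rightarrow> (real \<times> real) set" where
  "cone2 W x = focal_cone W x (ereal (cos (snd x) / (2 * \<bar>curv_at W (fst x)\<bar>)))
                              (ereal (cos (snd x) / \<bar>curv_at W (fst x)\<bar>))"

text \<open>
  The value is arbitrary outside the phase space and where the inverse of the first-return map is
  undefined. In the phase space, the curvature is negative or positive.
\<close>

definition cone_bundle :: "wall list \<Rightarrow> state \<Rightarrow> (real \<times> real) set" where
  "cone_bundle W x =
     (if curv_at W (fst x) < 0 then cone0 W x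
      else if curv_at W (fst (return_inv W x)) > 0 then cone2 W x
      else if flat_collisions W (return_inv W x) = 0 then cone1 W x
      else cone2 W x)"

end

theory Submission
  imports Defs
begin

text \<open>
  A beam of outgoing trajectories is described by its transversal displacement \<open>J\<close> and its
  rotation \<open>J'\<close>; a free flight of length \<open>\<tau>\<close> followed by a reflection
  maps \<open>(J, J')\<close> up to sign to \<open>(A, J' - 2 k A / cos \<alpha>)\<close> with
  \<open>A = J + \<tau> J'\<close>, and straight walls only contribute to the length. Every cone is the
  set where a product of two linear forms in \<open>J\<close> and \<open>J'\<close> is nonnegative, so
  invariance becomes a comparison of \<open>\<tau>\<close> with \<open>cos \<alpha> / k\<close>. An excursion
  into the strips is longer than \<open>2 l \<ge> 2 / k\<^sub>f\<close>; on a direct flight between the focusing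
  arc and a dispersing arc the chord condition bounds the projection of the centre of the dispersing
  arc to the trajectory, with equality on a null set only. Strictness can therefore fail
  only at consecutive collisions with the focusing arc, of which there are finitely many in a row.

  The exceptional states are null because the collision map is a local diffeomorphism conjugate to
  its inverse by time reversal, so that preimages of null sets are null, and because for each
  boundary point only finitely many directions hit a corner or a tangency.
\<close>

text \<open>The mirror equation is behind every choice. If an incoming beam had its focus at
  distance f0 in front of a collision and the outgoing beam focuses at distance f1, then 1/f0 + 1/f1
  = 2 k / cos \<alpha>. Read backwards through the collision, the cone with bounds cos \<alpha> / (2
  k) and cos \<alpha> / k consists of the beams that arrive parallel or with their last focus at
  least cos \<alpha> / k away. The cone at a dispersing point consists of those that do not arrive
  converging, or that would focus at least cos \<alpha> / |k| beyond the wall, that is, not before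
  the foot of the perpendicular from the centre of the arc to the trajectory. This foot is the point
  that the chord condition controls. The obstacle is the ray with focal distance cos \<alpha> / k.
  Between two consecutive collisions with the focusing arc it focuses at the midpoint of the chord,
  and the mirror sends this midpoint to the midpoint of the next chord. The ray is therefore
  preserved until the trajectory leaves the arc, and strictness has to come from an iterate whose
  order depends on the state.\<close>

section \<open>Walls\<close>

lemma norm_wall_tangent [simp]:
  assumes "src w \<noteq> dst w"
  shows "norm (wall_tangent w t) = 1"
  using assms by (simp add: wall_tangent_def norm_mult norm_sgn)

lemma norm_wall_normal [simp]:
  assumes "src w \<noteq> dst w"
  shows "norm (wall_normal w t) = 1"
  using assms by (simp add: wall_normal_def norm_mult)

lemma wall_tangent_cis: "wall_tangent w t = wall_tangent w 0 * cis (curv w * t)"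
  by (simp add: wall_tangent_def cis_mult mult.assoc)

lemma wall_tangent_deriv:
  "(wall_tangent w has_vector_derivative \<i> * of_real (curv w) * wall_tangent w t) (at t)"
proof -
  have "((\<lambda>t. cis (curv w * t - half_turn w)) has_derivative
      (\<lambda>h. (curv w * h) *\<^sub>R (\<i> * cis (curv w * t - half_turn w)))) (at t)"
    by (auto intro!: derivative_eq_intros)
  then have "((\<lambda>t. sgn (dst w - src w) * cis (curv w * t - half_turn w)) has_derivative
      (\<lambda>h. sgn (dst w - src w) * ((curv w * h) *\<^sub>R (\<i> * cis (curv w * t - half_turn w))))) (at t)"
    by (rule has_derivative_mult_right)
  then show ?thesis
    unfolding has_vector_derivative_def wall_tangent_def
    by (rule has_derivative_eq_rhs) (auto simp: scaleR_conv_of_real algebra_simps)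
qed

lemma wall_normal_deriv:
  "(wall_normal w has_vector_derivative - of_real (curv w) * wall_tangent w t) (at t)"
proof -
  have "((\<lambda>t. \<i> * wall_tangent w t) has_vector_derivative
      \<i> * (\<i> * of_real (curv w) * wall_tangent w t)) (at t)"
    by (intro has_vector_derivative_mult_right wall_tangent_deriv)
  moreover have "\<i> * (\<i> * of_real (curv w) * wall_tangent w t) = - of_real (curv w) * wall_tangent w t"
    by (simp flip: mult.assoc)
  ultimately show ?thesis
    unfolding wall_normal_def[abs_def] by simp
qed

lemma wall_point_deriv:
  "(wall_point w has_vector_derivative wall_tangent w t) (at t)"
proof (cases "curv w = 0")
  case True
  then have "wall_tangent w t = wall_tangent w 0"
    by (simp add: wall_tangent_def)
  then show ?thesis
    using True unfolding wall_point_def[abs_def]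
    by (auto intro!: derivative_eq_intros)
next
  case False
  have "((\<lambda>t. (wall_tangent w t - wall_tangent w 0) / (\<i> * of_real (curv w))) has_vector_derivative
      (\<i> * of_real (curv w) * wall_tangent w t) / (\<i> * of_real (curv w))) (at t)"
    unfolding divide_inverse
    by (intro has_vector_derivative_mult_left has_vector_derivative_diff_const[THEN iffD2] wall_tangent_deriv)
  then have "((\<lambda>t. src w + (wall_tangent w t - wall_tangent w 0) / (\<i> * of_real (curv w)))
      has_vector_derivative wall_tangent w t) (at t)"
    using False by (simp add: has_vector_derivative_add_const add.commute[of "src w"])
  then show ?thesis
    using False unfolding wall_point_def[abs_def] by simp
qed

lemma continuous_wall_point: "continuous_on S (wall_point w)"
  and continuous_wall_tangent: "continuous_on S (wall_tangent w)"
  and continuous_wall_normal: "continuous_on S (wall_normal w)"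
  by (auto intro!: continuous_at_imp_continuous_on
      has_vector_derivative_continuous wall_point_deriv wall_tangent_deriv wall_normal_deriv)

lemma wall_point_0 [simp]: "wall_point w 0 = src w"
  by (simp add: wall_point_def)

text \<open>The normal of a circle is the curvature times the vector from the point to the centre,
  hence an affine function of the point; on a straight wall it is constant.\<close>

lemma wall_normal_eq:
  "wall_normal w t = wall_normal w 0 - of_real (curv w) * (wall_point w t - src w)"
  by (simp add: wall_point_def wall_normal_def wall_tangent_def field_simps)

text \<open>The affine extension of the normal to the plane. Its component across a trajectory does
  not change along the trajectory; for a curved wall this is the curvature times the signed distance
  of the centre from the line. Tangency can thus be read off at the starting point.\<close>

definition normal_field :: "wall \<Rightarrow> complex \<Rightarrow> complex" where
  "normal_field w q = wall_normal w 0 - of_real (curv w) * (q - src w)"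

text \<open>
  The power of a point with respect to the circle carrying a wall, normalized so that straight walls
  are included; it is positive on the left of the wall.
\<close>

definition side :: "wall \<Rightarrow> complex \<Rightarrow> real" where
  "side w q = 2 * ((q - src w) \<bullet> wall_normal w 0) - curv w * (norm (q - src w))\<^sup>2"

lemma complex_norm1_eq: "norm (z::complex) = 1 \<longleftrightarrow> (Re z)\<^sup>2 + (Im z)\<^sup>2 = 1"
  by (simp add: norm_complex_def)

text \<open>For a curved wall the squared norms of two normals differ by \<open>curv w\<close> times
  the power, up to sign, and both are 1.\<close>

lemma side_wall_point_0:
  assumes "src w \<noteq> dst w"
  shows "side w (wall_point w t) = 0"
proof (cases "curv w = 0")
  case True
  then show ?thesis
    by (simp add: side_def wall_point_def wall_normal_def inner_complex_def)
next
  case False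
  let ?d = "wall_point w t - src w" and ?n = "wall_normal w 0" and ?k = "curv w"
  have "norm (?n - of_real ?k * ?d) = 1" "norm ?n = 1"
    using assms by (simp_all flip: wall_normal_eq)
  then have "?k * (2 * (?d \<bullet> ?n) - ?k * (norm ?d)\<^sup>2) = 0"
    unfolding complex_norm1_eq cmod_power2
    by (simp add: inner_complex_def power2_eq_square algebra_simps)
  then show ?thesis
    using False by (simp add: side_def)
qed

text \<open>The power belongs to the circle and not to the base point \<open>src w\<close>, so every
  point of the wall can replace it.\<close>

lemma side_eq:
  assumes "src w \<noteq> dst w"
  shows "side w q = 2 * ((q - wall_point w t) \<bullet> wall_normal w t)
    - curv w * (norm (q - wall_point w t))\<^sup>2"
  using side_wall_point_0[OF assms, of t] unfolding side_def wall_normal_eq[of w t] cmod_power2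
  by (simp add: inner_complex_def power2_eq_square algebra_simps)

lemma side_along:
  assumes "src w \<noteq> dst w" "norm v = 1"
  shows "side w (wall_point w t + u *\<^sub>R v) = u * (2 * (v \<bullet> wall_normal w t) - curv w * u)"
  using assms by (simp add: side_eq[of w _ t] power2_eq_square algebra_simps)

section \<open>Reflection\<close>

definition reflected :: "complex \<Rightarrow> complex \<Rightarrow> complex" where
  "reflected n v = v - (2 * (v \<bullet> n)) *\<^sub>R n"

lemma reflected_cis:
  assumes "norm n = 1" 
  shows "reflected n (n * cis \<alpha>) = - (n * cis (- \<alpha>))"
proof -
  have n: "(Re n)\<^sup>2 + (Im n)\<^sup>2 = 1" using assms by (simp add: complex_norm1_eq)
  have "(n * cis \<alpha>) \<bullet> n = ((Re n)\<^sup>2 + (Im n)\<^sup>2) * cos \<alpha>"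
    by (simp add: inner_complex_def power2_eq_square algebra_simps)
  then have "(n * cis \<alpha>) \<bullet> n = cos \<alpha>" by (simp only: n)
  then have "reflected n (n * cis \<alpha>) = n * (cis \<alpha> - of_real (2 * cos \<alpha>))"
    by (simp add: reflected_def scaleR_conv_of_real algebra_simps)
  also have "cis \<alpha> - of_real (2 * cos \<alpha>) = - cis (-\<alpha>)"
    by (simp add: complex_eq_iff)
  finally show ?thesis by simp
qed

lemma reflected_uminus [simp]: "reflected n (- v) = - reflected n v"
  by (simp add: reflected_def)

lemma reflected_reflected [simp]:
  assumes "norm n = 1" shows "reflected n (reflected n v) = v"
  using assms by (simp add: reflected_def algebra_simps dot_square_norm)

lemma orthonormal_expansion:
  assumes "norm v = 1" shows "z = (z \<bullet> v) *\<^sub>R v + (z \<bullet> (\<i> * v)) *\<^sub>R (\<i> * v)"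
proof -
  have v: "Re v * Re v + Im v * Im v = 1"
    using assms by (simp add: complex_norm1_eq power2_eq_square)
  have "Re z = Re z * (Re v * Re v + Im v * Im v)" "Im z = Im z * (Re v * Re v + Im v * Im v)"
    by (simp_all add: v)
  then show ?thesis
    by (simp add: complex_eq_iff inner_complex_def algebra_simps)
qed

text \<open>A reflection preserves the tangential component of the velocity, which is the sine of
  the outgoing angle; the sign of the normal component selects the branch of the arcsine.\<close>

lemma reflected_angle:
  assumes "norm T = 1" "norm v = 1" "v \<bullet> (\<i> * T) < 0"
  shows "\<bar>arcsin (v \<bullet> T)\<bar> < pi/2" 
    "\<i> * T * cis (- arcsin (v \<bullet> T)) = reflected (\<i> * T) v"
proof -
  have 1: "(v \<bullet> T)\<^sup>2 + (v \<bullet> (\<i> * T))\<^sup>2 = ((Re v)\<^sup>2 + (Im v)\<^sup>2) * ((Re T)\<^sup>2 + (Im T)\<^sup>2)"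
    by (simp add: inner_complex_def power2_eq_square algebra_simps)
  then have 2: "(v \<bullet> T)\<^sup>2 + (v \<bullet> (\<i> * T))\<^sup>2 = 1"
    using assms by (simp add: complex_norm1_eq)
  moreover have "(v \<bullet> (\<i> * T))\<^sup>2 > 0" using assms by simp
  ultimately have "(v \<bullet> T)\<^sup>2 < 1" by linarith
  then have lt: "-1 < v \<bullet> T" "v \<bullet> T < 1"
    using abs_square_less_1[of "v \<bullet> T"] by auto
  then show "\<bar>arcsin (v \<bullet> T)\<bar> < pi/2"
    using arcsin_lt_bounded[of "v \<bullet> T"] by linarith
  have "cos (arcsin (v \<bullet> T)) = sqrt (1 - (v \<bullet> T)\<^sup>2)"
    using lt by (simp add: cos_arcsin)
  also have "1 - (v \<bullet> T)\<^sup>2 = (v \<bullet> (\<i> * T))\<^sup>2" using 2 by linarith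
  also have "sqrt \<dots> = - (v \<bullet> (\<i> * T))" using assms by simp
  finally have c: "cos (arcsin (v \<bullet> T)) = - (v \<bullet> (\<i> * T))" .
  have s: "sin (arcsin (v \<bullet> T)) = v \<bullet> T" using lt by simp
  have "reflected (\<i> * T) v = (v \<bullet> T) *\<^sub>R T - (v \<bullet> (\<i> * T)) *\<^sub>R (\<i> * T)"
    using orthonormal_expansion[OF assms(1), of v]
    by (simp add: reflected_def scaleR_conv_of_real algebra_simps)
  moreover have "\<i> * T * cis (- arcsin (v \<bullet> T)) = (v \<bullet> T) *\<^sub>R T - (v \<bullet> (\<i> * T)) *\<^sub>R (\<i> * T)"
  proof -
    have "cis (- arcsin (v \<bullet> T)) = of_real (- (v \<bullet> (\<i> * T))) - \<i> * of_real (v \<bullet> T)"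
      using c s by (simp add: complex_eq_iff)
    then show ?thesis
      by (simp only:) (simp add: scaleR_conv_of_real algebra_simps)
  qed
  ultimately show "\<i> * T * cis (- arcsin (v \<bullet> T)) = reflected (\<i> * T) v" by simp
qed

lemma reflected_angle_unique:
  assumes "norm n = 1" "\<bar>\<alpha>\<bar> < pi/2" "\<bar>\<beta>\<bar> < pi/2" "n * cis (- \<alpha>) = n * cis (- \<beta>)"
  shows "\<alpha> = \<beta>"
proof -
  have "cis (- \<alpha>) = cis (- \<beta>)" using assms by auto
  then have "sin (- \<alpha>) = sin (- \<beta>)" by (metis cis.sel(2))
  then show ?thesis
    using assms sin_inj_pi[of \<alpha> \<beta>] by (simp add: abs_less_iff)
qed

section \<open>An implicit function\<close>

text \<open>A pointwise implicit function theorem: differentiability is assumed at one point only. A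
  zero is found by the intermediate value theorem, without uniqueness, and the linear bound on its
  distance from \<open>y0\<close> is what makes any such choice differentiable at \<open>x0\<close>.
  Uniqueness of the next collision later identifies the chosen zero.\<close>

lemma implicit_scalar:
  fixes g :: "'a::real_normed_vector \<Rightarrow> real \<Rightarrow> real"
  assumes der: "((\<lambda>z. g (fst z) (snd z)) has_derivative (\<lambda>z. A (fst z) + b * snd z)) (at (x0, y0))"
    and b: "b \<noteq> 0" and g0: "g x0 y0 = 0" and \<delta>: "\<delta> > 0"
    and cont: "eventually (\<lambda>x. continuous_on {y0-\<delta>..y0+\<delta>} (g x)) (nhds x0)"
  obtains r where "r x0 = y0" "eventually (\<lambda>x. g x (r x) = 0) (nhds x0)"
    "(r has_derivative (\<lambda>h. - A h / b)) (at x0)"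
proof -
  have blin: "bounded_linear (\<lambda>z::'a\<times>real. A (fst z) + b * snd z)"
    using der by (rule has_derivative_bounded_linear)
  have "bounded_linear (\<lambda>h::'a. (h, 0::real))"
    by (intro bounded_linear_intros)
  from bounded_linear_compose[OF blin this] have Alin: "bounded_linear A" by simp
  define A' where "A' h = A h / b" for h
  define f where "f x y = g x y / b" for x y
  have A'lin: "bounded_linear A'"
    unfolding A'_def[abs_def] by (rule bounded_linear_compose[OF bounded_linear_divide Alin])
  have derf: "((\<lambda>z. f (fst z) (snd z)) has_derivative (\<lambda>z. A' (fst z) + snd z)) (at (x0, y0))"
    unfolding f_def using bounded_linear.has_derivative[OF bounded_linear_divide der, of b] b
    by (simp add: A'_def add_divide_distrib)
  obtain M where M: "M > 0" "\<And>h. norm (A' h) \<le> norm h * M"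
    using bounded_linear.pos_bounded[OF A'lin] by blast
  \<comment> \<open>At the ends of the interval of radius \<open>C * norm (x - x0)\<close> the
    linear part \<open>A'\<close> contributes at most \<open>M * norm (x - x0)\<close> and the
    remainder at most \<open>norm (x - x0)\<close>; twice their sum fixes the sign at both
    ends.\<close>
  define C where "C = 2 * M + 2"
  have C: "C > 0" using M by (simp add: C_def)
  have est: "\<exists>d>0. \<forall>x y. norm (x - x0) < d \<longrightarrow> \<bar>y - y0\<bar> \<le> C * norm (x - x0) \<longrightarrow>
      \<bar>f x y - A' (x - x0) - (y - y0)\<bar> \<le> e * norm (x - x0)" if "e > 0" for e
  proof -
    have "e / (1 + C) > 0" using that C by simp
    then obtain d where d: "d > 0" "\<And>z. norm (z - (x0,y0)) < d \<Longrightarrow>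
      \<bar>f (fst z) (snd z) - f x0 y0 - (A' (fst (z - (x0,y0))) + snd (z - (x0,y0)))\<bar>
        \<le> e / (1 + C) * norm (z - (x0,y0))"
      using derf unfolding has_derivative_at_alt by (auto simp: real_norm_def)
    have "\<bar>f x y - A' (x - x0) - (y - y0)\<bar> \<le> e * norm (x - x0)"
      if x: "norm (x - x0) < d / (1 + C)" and y: "\<bar>y - y0\<bar> \<le> C * norm (x - x0)" for x y
    proof -
      have n: "norm ((x,y) - (x0,y0)) \<le> (1 + C) * norm (x - x0)"
        using norm_Pair_le[of "x - x0" "y - y0"] y by (simp add: algebra_simps)
      moreover have "(1 + C) * norm (x - x0) < d"
        using x C by (simp add: field_simps)
      ultimately have "norm ((x,y) - (x0,y0)) < d" by linarith
      from d(2)[OF this] have "\<bar>f x y - A' (x - x0) - (y - y0)\<bar> \<le> e / (1 + C) * norm ((x,y) - (x0,y0))"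
        using g0 by (simp add: f_def algebra_simps)
      also have "\<dots> \<le> e / (1 + C) * ((1 + C) * norm (x - x0))"
        using n that C \<open>e > 0\<close> by (intro mult_left_mono) auto
      also have "\<dots> = e * norm (x - x0)" using C by simp
      finally show ?thesis .
    qed
    then show ?thesis
      using d(1) C by (intro exI[of _ "d / (1 + C)"]) auto
  qed
  define r where "r x = (SOME y. \<bar>y - y0\<bar> \<le> C * norm (x - x0) \<and> g x y = 0)" for x
  have "eventually (\<lambda>x. \<bar>r x - y0\<bar> \<le> C * norm (x - x0) \<and> g x (r x) = 0) (nhds x0)"
  proof -
    obtain d where d: "d > 0" and d': "\<And>x y. norm (x - x0) < d \<Longrightarrow> \<bar>y - y0\<bar> \<le> C * norm (x - x0) \<Longrightarrow>
      \<bar>f x y - A' (x - x0) - (y - y0)\<bar> \<le> 1 * norm (x - x0)"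
      using est[of 1] by auto
    have "eventually (\<lambda>x. norm (x - x0) < min d (\<delta> / C)) (nhds x0)"
      unfolding eventually_nhds_metric using d C \<delta> by (intro exI[of _ "min d (\<delta>/C)"]) (auto simp: dist_norm)
    then show ?thesis
      using cont
    proof eventually_elim
      case (elim x)
      define c where "c = C * norm (x - x0)"
      have c: "0 \<le> c" "c \<le> \<delta>"
        using elim C by (auto simp: c_def field_simps)
      have cont': "continuous_on {y0 - c..y0 + c} (f x)"
        unfolding f_def using c b
        by (intro continuous_intros continuous_on_subset[OF elim(2)]) auto
      have m: "\<bar>A' (x - x0)\<bar> \<le> M * norm (x - x0)"
        using M(2)[of "x - x0"] by (simp add: mult.commute)
      have "\<bar>f x (y0 + c) - A' (x - x0) - c\<bar> \<le> norm (x - x0)"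
           "\<bar>f x (y0 - c) - A' (x - x0) + c\<bar> \<le> norm (x - x0)"
        using d'[of x "y0 + c"] d'[of x "y0 - c"] elim c by (auto simp: c_def)
      moreover have "c = 2 * (M * norm (x - x0)) + 2 * norm (x - x0)"
        by (simp add: c_def C_def algebra_simps)
      ultimately have "f x (y0 + c) \<ge> 0" "f x (y0 - c) \<le> 0"
        using m norm_ge_zero[of "x - x0"] M(1) mult_nonneg_nonneg[of M "norm (x - x0)"] by linarith+
      then obtain y where "y0 - c \<le> y" "y \<le> y0 + c" "f x y = 0"
        using IVT'[of "f x" "y0 - c" 0 "y0 + c"] c cont' by auto
      then have "\<bar>y - y0\<bar> \<le> C * norm (x - x0) \<and> g x y = 0"
        using b by (auto simp: c_def f_def)
      then show ?case unfolding r_def by (rule someI)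
    qed
  qed
  note ev = this
  from eventually_nhds_x_imp_x[OF this] have r0: "r x0 = y0" by simp
  have "(r has_derivative (\<lambda>h. - A' h)) (at x0)"
    unfolding has_derivative_at_alt
  proof (intro conjI allI impI)
    show "bounded_linear (\<lambda>h. - A' h)" using A'lin by (rule bounded_linear_minus)
    fix e :: real assume e: "0 < e"
    obtain d where d: "d > 0" and d': "\<And>x y. norm (x - x0) < d \<Longrightarrow> \<bar>y - y0\<bar> \<le> C * norm (x - x0) \<Longrightarrow>
      \<bar>f x y - A' (x - x0) - (y - y0)\<bar> \<le> e * norm (x - x0)"
      using est[OF e] by auto
    obtain d2 where d2: "d2 > 0" "\<And>x. dist x x0 < d2 \<Longrightarrow> \<bar>r x - y0\<bar> \<le> C * norm (x - x0) \<and> g x (r x) = 0"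
      using ev unfolding eventually_nhds_metric by auto
    show "\<exists>d>0. \<forall>y. norm (y - x0) < d \<longrightarrow> norm (r y - r x0 - - A' (y - x0)) \<le> e * norm (y - x0)"
    proof (intro exI[of _ "min d d2"] conjI allI impI)
      fix x assume x: "norm (x - x0) < min d d2"
      then have "\<bar>r x - y0\<bar> \<le> C * norm (x - x0)" "g x (r x) = 0" using d2(2)[of x] by (auto simp: dist_norm)
      with d'[of x "r x"] x show "norm (r x - r x0 - - A' (x - x0)) \<le> e * norm (x - x0)"
        by (auto simp: f_def r0)
    qed (use d d2 in auto)
  qed
  then have "(r has_derivative (\<lambda>h. - A h / b)) (at x0)" by (simp add: A'_def)
  then show ?thesis
    using r0 by (intro that[of r] eventually_mono[OF ev]) simp_all
qed

section \<open>The collision map of a table\<close>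

abbreviation time_reversal :: "state \<Rightarrow> state" where
  "time_reversal x \<equiv> (fst x, - snd x)"

definition tangent_at :: "wall list \<Rightarrow> real \<Rightarrow> complex" where
  "tangent_at W s = wall_tangent (wall_at W s) (s - offset W (wall_index W s))"

definition collision_map :: "wall list \<Rightarrow> state \<Rightarrow> state" where
  "collision_map W x = (THE y. next_collision W x y)"

definition collision_dom :: "wall list \<Rightarrow> state set" where
  "collision_dom W = {x. \<exists>y. next_collision W x y}"

definition regular :: "wall list \<Rightarrow> state \<Rightarrow> bool" where
  "regular W x \<longleftrightarrow> non_corner W (fst x) \<and> \<bar>snd x\<bar> < pi/2"

lemma velocity_eq: "velocity W x = normal_at W (fst x) * cis (- snd x)"
  by (cases x) simp

declare velocity.simps [simp del]

lemma normal_at_eq: "normal_at W s = \<i> * tangent_at W s"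
  by (simp add: normal_at_def tangent_at_def wall_normal_def)

lemma next_collision_iff:
  "next_collision W x y \<longleftrightarrow> regular W x \<and> regular W y \<and>
     (\<exists>t>0. point_at W (fst y) = point_at W (fst x) + t *\<^sub>R velocity W x \<and>
        (\<forall>u\<in>{0<..<t}. point_at W (fst x) + u *\<^sub>R velocity W x \<notin> boundary W)) \<and>
     velocity W y = reflected (normal_at W (fst y)) (velocity W x)"
  unfolding next_collision_def regular_def reflected_def by blast

locale wall_sequence =
  fixes W :: "wall list"
  assumes wall_length_pos: "w \<in> set W \<Longrightarrow> 0 < wall_length w"
begin

lemma offset_Suc: "offset W (Suc i) = offset W i + wall_length (W ! i)"
  by (simp add: offset_def)

lemma offset_less_Suc: "i < length W \<Longrightarrow> offset W i < offset W (Suc i)"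
  using wall_length_pos[of "W ! i"] by (simp add: offset_Suc)

lemma offset_mono: "i \<le> j \<Longrightarrow> j \<le> length W \<Longrightarrow> offset W i \<le> offset W j"
proof (induction j rule: dec_induct)
  case (step j)
  then show ?case using offset_less_Suc[of j] by simp
qed simp

lemma wall_index_eq:
  assumes "i < length W" "offset W i \<le> s" "s < offset W (Suc i)"
  shows "wall_index W s = i"
  unfolding wall_index_def
proof (rule Least_equality)
  show "s < offset W (Suc i)" by fact
  fix j assume j: "s < offset W (Suc j)"
  show "i \<le> j"
  proof (rule ccontr)
    assume "\<not> i \<le> j"
    then have "offset W (Suc j) \<le> offset W i"
      using assms(1) by (intro offset_mono) auto
    with j assms show False by simp
  qed
qed

end

text \<open>\<open>next_collision\<close> only speaks of the boundary. The open set
  \<open>\<Omega>\<close> supplies the interior of the table: it turns absence of collisions into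
  membership in an open set, which is stable under perturbation, and its boundedness forces a next
  hit.\<close>

locale billiard = wall_sequence W for W :: "wall list" +
  fixes \<Omega> :: "complex set"
  assumes nondegenerate: "w \<in> set W \<Longrightarrow> src w \<noteq> dst w"
    and point_at_inj: "\<lbrakk>non_corner W s; non_corner W s'; point_at W s = point_at W s'\<rbrakk> \<Longrightarrow> s = s'"
    and open_domain: "open \<Omega>"
    and bounded_domain: "bounded \<Omega>"
    and frontier_domain: "frontier \<Omega> \<subseteq> boundary W"
    and domain_boundary: "\<Omega> \<inter> boundary W = {}"
    and domain_side: "non_corner W s \<Longrightarrow> \<exists>V. open V \<and> point_at W s \<in> V \<and>
      (\<forall>q\<in>V. q \<in> \<Omega> \<longleftrightarrow> 0 < side (wall_at W s) q)"
begin

lemma wall_index_less: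
  assumes "non_corner W s"
  shows "wall_index W s < length W" "offset W (wall_index W s) < s"
    "s < offset W (Suc (wall_index W s))"
  using assms wall_index_eq by (auto simp: non_corner_def)

lemma wall_at_in_set: "non_corner W s \<Longrightarrow> wall_at W s \<in> set W"
  using wall_index_less(1) by (simp add: wall_at_def)

lemma wall_at_nondegenerate: "non_corner W s \<Longrightarrow> src (wall_at W s) \<noteq> dst (wall_at W s)"
  using wall_at_in_set nondegenerate by blast

lemma wall_index_near:
  assumes "non_corner W s"
  shows "\<forall>\<^sub>F \<sigma> in nhds s. non_corner W \<sigma> \<and> wall_index W \<sigma> = wall_index W s"
proof -
  let ?i = "wall_index W s"
  have "\<forall>\<^sub>F \<sigma> in nhds s. \<sigma> \<in> {offset W ?i<..<offset W (Suc ?i)}"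
    using wall_index_less[OF assms] by (intro eventually_nhds_in_open) auto
  then show ?thesis
  proof eventually_elim
    case (elim \<sigma>)
    then show ?case
      using wall_index_less(1)[OF assms] wall_index_eq[of ?i \<sigma>] by (auto simp: non_corner_def)
  qed
qed

lemma near_eqs:
  assumes "non_corner W s"
  defines "w \<equiv> wall_at W s" and "b0 \<equiv> offset W (wall_index W s)"
  shows "\<forall>\<^sub>F \<sigma> in nhds s. non_corner W \<sigma> \<and> wall_at W \<sigma> = w \<and> point_at W \<sigma> = wall_point w (\<sigma> - b0) \<and>
    normal_at W \<sigma> = wall_normal w (\<sigma> - b0) \<and> tangent_at W \<sigma> = wall_tangent w (\<sigma> - b0)"
  using wall_index_near[OF assms(1)]
  by eventually_elim (simp add: w_def b0_def wall_at_def point_at_def normal_at_def tangent_at_def)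

lemma
  assumes s: "non_corner W s"
  shows point_at_deriv: "(point_at W has_vector_derivative tangent_at W s) (at s)"
    and normal_at_deriv:
      "(normal_at W has_vector_derivative - of_real (curv_at W s) * tangent_at W s) (at s)"
    and tangent_at_deriv:
      "(tangent_at W has_vector_derivative \<i> * of_real (curv_at W s) * tangent_at W s) (at s)"
proof -
  define w b0 where "w = wall_at W s" and "b0 = offset W (wall_index W s)"
  have sh: "((\<lambda>\<sigma>. \<sigma> - b0) has_vector_derivative 1) (at s)"
    by (auto intro!: derivative_eq_intros)
  have tr: "(g has_vector_derivative d) (at s)"
    if "(f has_vector_derivative d) (at (s - b0))" "\<forall>\<^sub>F \<sigma> in nhds s. g \<sigma> = f (\<sigma> - b0)"
    for f g :: "real \<Rightarrow> complex" and d
  proof -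
    have "((f \<circ> (\<lambda>\<sigma>. \<sigma> - b0)) has_vector_derivative 1 *\<^sub>R d) (at s)"
      by (rule vector_diff_chain_at[OF sh that(1)])
    then have "((\<lambda>\<sigma>. f (\<sigma> - b0)) has_vector_derivative d) (at s)" by (simp add: b0_def comp_def)
    moreover have "\<forall>\<^sub>F \<sigma> in nhds s. f (\<sigma> - b0) = g \<sigma>"
      using that(2) by eventually_elim simp
    ultimately show ?thesis
      unfolding has_vector_derivative_def
      using eventually_nhds_x_imp_x[of "\<lambda>\<sigma>. f (\<sigma> - b0) = g \<sigma>" s]
      by (intro has_derivative_transform_eventually[of "\<lambda>\<sigma>. f (\<sigma> - b0)" _ s UNIV g])
        (auto simp: eventually_at_filter elim: eventually_mono)
  qed
  note ev = near_eqs[OF s, folded w_def b0_def]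
  have t: "tangent_at W s = wall_tangent w (s - b0)" "curv_at W s = curv w"
    by (simp_all add: tangent_at_def w_def b0_def curv_at_def)
  show "(point_at W has_vector_derivative tangent_at W s) (at s)"
    unfolding t by (rule tr[OF wall_point_deriv]) (use ev in \<open>auto elim: eventually_mono\<close>)
  show "(normal_at W has_vector_derivative - of_real (curv_at W s) * tangent_at W s) (at s)"
    unfolding t by (rule tr[OF wall_normal_deriv]) (use ev in \<open>auto elim: eventually_mono\<close>)
  show "(tangent_at W has_vector_derivative \<i> * of_real (curv_at W s) * tangent_at W s) (at s)"
    unfolding t by (rule tr[OF wall_tangent_deriv]) (use ev in \<open>auto elim: eventually_mono\<close>)
qed

lemma isCont_at:
  assumes "non_corner W s"
  shows "isCont (point_at W) s" "isCont (normal_at W) s" "isCont (tangent_at W) s"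
  using point_at_deriv normal_at_deriv tangent_at_deriv assms
  by (auto intro: has_vector_derivative_continuous)

lemma norm_normal_at [simp]: "non_corner W s \<Longrightarrow> norm (normal_at W s) = 1"
  and norm_tangent_at [simp]: "non_corner W s \<Longrightarrow> norm (tangent_at W s) = 1"
  by (simp_all add: normal_at_def tangent_at_def wall_at_nondegenerate)

lemma norm_velocity [simp]: "non_corner W (fst x) \<Longrightarrow> norm (velocity W x) = 1"
  by (simp add: velocity_eq norm_mult)

lemma velocity_normal: "non_corner W (fst x) \<Longrightarrow> velocity W x \<bullet> normal_at W (fst x) = cos (snd x)"
proof -
  assume "non_corner W (fst x)"
  then have n: "(Re (normal_at W (fst x)))\<^sup>2 + (Im (normal_at W (fst x)))\<^sup>2 = 1"
    using norm_normal_at complex_norm1_eq by blast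
  have "velocity W x \<bullet> normal_at W (fst x) =
    ((Re (normal_at W (fst x)))\<^sup>2 + (Im (normal_at W (fst x)))\<^sup>2) * cos (snd x)"
    by (simp add: velocity_eq inner_complex_def algebra_simps power2_eq_square)
  then show ?thesis by (simp only: n)
qed

lemma velocity_tangent: "non_corner W (fst x) \<Longrightarrow> velocity W x \<bullet> tangent_at W (fst x) = sin (snd x)"
proof -
  assume "non_corner W (fst x)"
  then have n: "(Re (tangent_at W (fst x)))\<^sup>2 + (Im (tangent_at W (fst x)))\<^sup>2 = 1"
    using norm_tangent_at complex_norm1_eq by blast
  have "velocity W x \<bullet> tangent_at W (fst x) =
    ((Re (tangent_at W (fst x)))\<^sup>2 + (Im (tangent_at W (fst x)))\<^sup>2) * sin (snd x)"
    by (simp add: velocity_eq normal_at_eq inner_complex_def algebra_simps power2_eq_square)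
  then show ?thesis by (simp only: n)
qed

lemma cos_pos: "regular W x \<Longrightarrow> 0 < cos (snd x)"
  by (auto simp: regular_def abs_less_iff intro!: cos_gt_zero_pi)

lemma velocity_reversal:
  "non_corner W (fst x) \<Longrightarrow>
    velocity W (time_reversal x) = - reflected (normal_at W (fst x)) (velocity W x)"
  using reflected_cis[of "normal_at W (fst x)" "- snd x"] by (simp add: velocity_eq)

lemma regular_reversal [simp]: "regular W (time_reversal x) \<longleftrightarrow> regular W x"
  by (simp add: regular_def)

lemma point_at_boundary: "non_corner W s \<Longrightarrow> point_at W s \<in> boundary W"
proof -
  assume s: "non_corner W s"
  have "s - offset W (wall_index W s) \<in> {0..wall_length (wall_at W s)}"
    using wall_index_less[OF s] by (auto simp: wall_at_def offset_Suc)
  then show ?thesis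
    unfolding boundary_def point_at_def using wall_at_in_set[OF s] by blast
qed

section \<open>Uniqueness and time reversal of the next collision\<close>

lemma next_collision_unique:
  assumes "next_collision W x y" "next_collision W x z"
  shows "y = z"
proof -
  let ?p = "point_at W (fst x)" and ?v = "velocity W x"
  obtain t u where t: "t > 0" "point_at W (fst y) = ?p + t *\<^sub>R ?v" 
      "\<forall>a\<in>{0<..<t}. ?p + a *\<^sub>R ?v \<notin> boundary W"
    and u: "u > 0" "point_at W (fst z) = ?p + u *\<^sub>R ?v" 
      "\<forall>a\<in>{0<..<u}. ?p + a *\<^sub>R ?v \<notin> boundary W"
    using assms unfolding next_collision_iff by blast
  have "point_at W (fst y) \<in> boundary W" "point_at W (fst z) \<in> boundary W"
    using assms by (auto simp: next_collision_iff regular_def intro!: point_at_boundary)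
  then have "t = u"
    using t u by (metis greaterThanLessThan_iff linorder_neqE_linordered_idom)
  then have "fst y = fst z"
    using point_at_inj[of "fst y" "fst z"] t u assms by (simp add: next_collision_iff regular_def)
  moreover have "velocity W y = velocity W z"
    using assms \<open>fst y = fst z\<close> by (simp add: next_collision_iff)
  then have "normal_at W (fst z) * cis (- snd y) = normal_at W (fst z) * cis (- snd z)"
    using \<open>fst y = fst z\<close> by (simp add: velocity_eq)
  ultimately show "y = z"
    using assms reflected_angle_unique[of "normal_at W (fst z)" "snd y" "snd z"]
    by (simp add: next_collision_iff regular_def prod_eq_iff)
qed

lemma collision_map_eq: "next_collision W x y \<Longrightarrow> collision_map W x = y"
  unfolding collision_map_def by (blast intro: the_equality next_collision_unique)

lemma collision_map_in: "x \<in> collision_dom W \<Longrightarrow> next_collision W x (collision_map W x)"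
  using collision_map_eq unfolding collision_dom_def by blast

lemma next_collision_reversal:
  assumes "next_collision W x y"
  shows "next_collision W (time_reversal y) (time_reversal x)"
proof -
  let ?p = "point_at W (fst x)" and ?v = "velocity W x"
  have x: "regular W x" and y: "regular W y"
    and vy: "velocity W y = reflected (normal_at W (fst y)) ?v"
    using assms by (auto simp: next_collision_iff)
  have v: "velocity W (time_reversal y) = - ?v"
    using y vy by (simp add: velocity_reversal regular_def)
  obtain t where t: "t > 0" "point_at W (fst y) = ?p + t *\<^sub>R ?v" 
      "\<forall>a\<in>{0<..<t}. ?p + a *\<^sub>R ?v \<notin> boundary W"
    using assms unfolding next_collision_iff by blast
  have 1: "point_at W (fst y) + u *\<^sub>R (- ?v) = ?p + (t - u) *\<^sub>R ?v" for u
    by (simp add: t algebra_simps)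
  have 2: "?p + (t - u) *\<^sub>R ?v \<notin> boundary W" if "u \<in> {0<..<t}" for u
    using t(3) that by auto
  show ?thesis
    unfolding next_collision_iff
  proof (intro conjI exI[of _ t])
    show "velocity W (time_reversal x) =
      reflected (normal_at W (fst (time_reversal x))) (velocity W (time_reversal y))"
      using x by (simp add: v velocity_reversal regular_def)
    show "point_at W (fst (time_reversal x)) =
      point_at W (fst (time_reversal y)) + t *\<^sub>R velocity W (time_reversal y)"
      using 1[of t] by (simp add: v)
    show "\<forall>u\<in>{0<..<t}. point_at W (fst (time_reversal y)) +
      u *\<^sub>R velocity W (time_reversal y) \<notin> boundary W"
      using 2 unfolding v fst_conv 1 by blast
  qed (use x y t in simp_all)
qed

text \<open>Injectivity is uniqueness of the reversed flight.\<close>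

lemma collision_map_inj:
  assumes "x \<in> collision_dom W" "x' \<in> collision_dom W" "collision_map W x = collision_map W x'"
  shows "x = x'"
proof -
  have "next_collision W x (collision_map W x)" "next_collision W x' (collision_map W x)"
    using collision_map_in[OF assms(1)] collision_map_in[OF assms(2)] assms(3) by simp_all
  then have "time_reversal x = time_reversal x'"
    by (intro next_collision_unique[OF next_collision_reversal next_collision_reversal])
  then show ?thesis by (simp add: prod_eq_iff)
qed

section \<open>Perturbation of a trajectory and the derivative of the collision map\<close>

text \<open>The first claim is uniform in base point and direction, as needed for perturbing a trajectory.\<close>

lemma near_wall:
  assumes s: "non_corner W s" and v: "norm v = 1" "v \<bullet> normal_at W s > 0"
  shows "\<exists>\<epsilon>>0. \<forall>\<^sub>F z in nhds (s, v). \<forall>u\<in>{0<..<\<epsilon>}. norm (snd z) = 1 \<longrightarrow>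
     point_at W (fst z) + u *\<^sub>R snd z \<in> \<Omega>"
  and "\<exists>\<epsilon>>0. \<forall>u\<in>{0<..<\<epsilon>}. point_at W s - u *\<^sub>R v \<notin> \<Omega>"
proof -
  define w where "w = wall_at W s"
  define d where "d = v \<bullet> normal_at W s"
  obtain V where V: "open V" "point_at W s \<in> V" "\<And>q. q \<in> V \<Longrightarrow> q \<in> \<Omega> \<longleftrightarrow> 0 < side w q"
    using domain_side[OF s] w_def by blast
  obtain e where e: "e > 0" "ball (point_at W s) e \<subseteq> V"
    using V open_contains_ball by blast
  \<comment> \<open>The first bound keeps the point in \<open>V\<close>, where the base point
    accounts for the other half of \<open>e\<close>. The second keeps the power positive, given that
    the normal component of the perturbed direction still exceeds \<open>d / 2\<close>.\<close>
  define \<epsilon> where "\<epsilon> = min (e / 2) (d / (\<bar>curv w\<bar> + 1))"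
  have \<epsilon>: "\<epsilon> > 0" using e v by (auto simp: \<epsilon>_def d_def)
  have curv: "curv w * u < d" if "0 < u" "u < \<epsilon>" for u
  proof -
    have "curv w * u \<le> (\<bar>curv w\<bar> + 1) * u" using that by (intro mult_right_mono) auto
    also have "\<dots> < d" using that by (auto simp: \<epsilon>_def field_simps)
    finally show ?thesis .
  qed
  have nd: "src w \<noteq> dst w" using wall_at_nondegenerate[OF s] by (simp add: w_def)
  have fs: "filterlim fst (nhds s) (nhds (s, v))" "filterlim snd (nhds v) (nhds (s, v))"
    using tendsto_fst[OF filterlim_ident, of "(s, v)"] tendsto_snd[OF filterlim_ident, of "(s, v)"]
    by simp_all
  have cs: "((\<lambda>z. f (fst z)) \<longlongrightarrow> f s) (nhds (s, v))" if "isCont f s" for f :: "real \<Rightarrow> complex"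
    using isCont_tendsto_compose[OF that fs(1)] .
  have "\<forall>\<^sub>F z in nhds (s, v). dist (point_at W (fst z)) (point_at W s) < e / 2"
    using cs[OF isCont_at(1)[OF s]] e by (intro tendstoD) auto
  moreover have "((\<lambda>z. snd z \<bullet> normal_at W (fst z)) \<longlongrightarrow> v \<bullet> normal_at W s) (nhds (s, v))"
    by (intro tendsto_inner fs cs isCont_at s)
  then have "\<forall>\<^sub>F z in nhds (s, v). d / 2 < snd z \<bullet> normal_at W (fst z)"
    using v by (intro order_tendstoD) (auto simp: d_def)
  moreover have "\<forall>\<^sub>F z in nhds (s, v). point_at W (fst z) = wall_point w (fst z - offset W (wall_index W s)) \<and>
    normal_at W (fst z) = wall_normal w (fst z - offset W (wall_index W s))"
    using filterlim_iff[THEN iffD1, OF fs(1), rule_format, OF near_eqs[OF s]]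
    by eventually_elim (simp add: w_def)
  ultimately have "\<forall>\<^sub>F z in nhds (s, v). \<forall>u\<in>{0<..<\<epsilon>}. norm (snd z) = 1 \<longrightarrow>
     point_at W (fst z) + u *\<^sub>R snd z \<in> \<Omega>"
  proof eventually_elim
    case (elim z)
    show ?case
    proof (intro ballI impI)
      fix u assume u: "u \<in> {0<..<\<epsilon>}" and z: "norm (snd z) = 1"
      have "dist (point_at W (fst z) + u *\<^sub>R snd z) (point_at W s) \<le>
        dist (point_at W (fst z)) (point_at W s) + norm (u *\<^sub>R snd z)"
        by (metis add_diff_eq diff_add_eq dist_norm norm_triangle_ineq)
      also have "\<dots> < e" using elim(1) u z by (auto simp: \<epsilon>_def)
      finally have "point_at W (fst z) + u *\<^sub>R snd z \<in> V"
        using e by (auto simp: dist_commute)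
      moreover have "side w (point_at W (fst z) + u *\<^sub>R snd z) =
        u * (2 * (snd z \<bullet> normal_at W (fst z)) - curv w * u)"
        using elim(3) side_along[OF nd z] by simp
      moreover have "\<dots> > 0" using u curv[of u] elim(2) by (intro mult_pos_pos) auto
      ultimately show "point_at W (fst z) + u *\<^sub>R snd z \<in> \<Omega>" using V(3) by simp
    qed
  qed
  then show "\<exists>\<epsilon>>0. \<forall>\<^sub>F z in nhds (s, v). \<forall>u\<in>{0<..<\<epsilon>}. norm (snd z) = 1 \<longrightarrow>
     point_at W (fst z) + u *\<^sub>R snd z \<in> \<Omega>" using \<epsilon> by blast
  have "point_at W s - u *\<^sub>R v \<notin> \<Omega>" if u: "0 < u" "u < min e (2 * d / (\<bar>curv w\<bar> + 1))" for u
  proof -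
    have "(\<bar>curv w\<bar> + 1) * u < 2 * d" using u by (auto simp: field_simps)
    moreover have "- curv w * u \<le> (\<bar>curv w\<bar> + 1) * u" using u by (intro mult_right_mono) auto
    ultimately have c: "2 * d + curv w * u > 0" by linarith
    have "point_at W s - u *\<^sub>R v \<in> V"
      using e u v by (auto simp: dist_norm)
    moreover have "side w (point_at W s + u *\<^sub>R (- v)) =
        u * (2 * ((- v) \<bullet> normal_at W s) - curv w * u)"
      unfolding point_at_def normal_at_def w_def[symmetric] using v by (intro side_along nd) auto
    then have "side w (point_at W s - u *\<^sub>R v) = - (u * (2 * d + curv w * u))"
      by (simp add: d_def algebra_simps)
    ultimately show ?thesis using V(3) mult_pos_pos[OF u(1) c] by simp
  qed
  moreover have "min e (2 * d / (\<bar>curv w\<bar> + 1)) > 0" using e v by (auto simp: d_def)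
  ultimately show "\<exists>\<epsilon>>0. \<forall>u\<in>{0<..<\<epsilon>}. point_at W s - u *\<^sub>R v \<notin> \<Omega>"
    by (metis greaterThanLessThan_iff)
qed

lemma near_wall_start:
  assumes "regular W x"
  obtains \<epsilon> where "\<epsilon> > 0" "\<forall>u\<in>{0<..<\<epsilon>}. point_at W (fst x) + u *\<^sub>R velocity W x \<in> \<Omega>"
proof -
  have x: "non_corner W (fst x)" using assms by (simp add: regular_def)
  obtain \<epsilon> where "\<epsilon> > 0" "\<forall>\<^sub>F z in nhds (fst x, velocity W x). \<forall>u\<in>{0<..<\<epsilon>}. norm (snd z) = 1 \<longrightarrow>
     point_at W (fst z) + u *\<^sub>R snd z \<in> \<Omega>"
    using near_wall(1)[OF x norm_velocity[OF x]] cos_pos[OF assms] velocity_normal[OF x] by auto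
  with that eventually_nhds_x_imp_x[OF this(2)] x show ?thesis by simp
qed

text \<open>The flight starts inside \<open>\<Omega>\<close>, and a connected set that also contains
  a point outside \<open>\<Omega>\<close> would meet the frontier, which lies in the
  boundary.\<close>

lemma segment_in_domain:
  assumes x: "regular W x"
    and nb: "\<forall>u\<in>{0<..<t}. point_at W (fst x) + u *\<^sub>R velocity W x \<notin> boundary W"
    and u: "u \<in> {0<..<t}"
  shows "point_at W (fst x) + u *\<^sub>R velocity W x \<in> \<Omega>"
proof (rule ccontr)
  let ?f = "\<lambda>u. point_at W (fst x) + u *\<^sub>R velocity W x"
  assume n: "?f u \<notin> \<Omega>"
  obtain \<epsilon> where e: "\<epsilon> > 0" "\<forall>u\<in>{0<..<\<epsilon>}. ?f u \<in> \<Omega>" using near_wall_start[OF x] .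
  have "connected (?f ` {0<..<t})"
    by (intro connected_continuous_image continuous_intros) auto
  moreover have "?f (min \<epsilon> t / 2) \<in> ?f ` {0<..<t} \<inter> \<Omega>" using e u by auto
  moreover have "?f u \<in> ?f ` {0<..<t} - \<Omega>" using u n by blast
  ultimately have "?f ` {0<..<t} \<inter> frontier \<Omega> \<noteq> {}"
    by (intro connected_Int_frontier) blast+
  then show False using nb frontier_domain by blast
qed

lemma velocity_deriv:
  assumes "non_corner W (fst x)"
  shows "(velocity W has_derivative
    (\<lambda>h. (curv_at W (fst x) * fst h - snd h) *\<^sub>R (\<i> * velocity W x))) (at x)"
proof -
  let ?s = "fst x" and ?k = "curv_at W (fst x)"
  have "((\<lambda>z. normal_at W (fst z)) has_derivative (\<lambda>h. fst h *\<^sub>R (- of_real ?k * tangent_at W ?s))) (at x)"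
    using normal_at_deriv[OF assms] unfolding has_vector_derivative_def
    by (rule has_derivative_compose[OF has_derivative_fst[OF has_derivative_ident]])
  moreover have "((\<lambda>z::state. cis (- snd z)) has_derivative
      (\<lambda>h. (- snd h) *\<^sub>R (\<i> * cis (- snd x)))) (at x)"
    by (auto intro!: derivative_eq_intros)
  ultimately have "((\<lambda>z. normal_at W (fst z) * cis (- snd z)) has_derivative
      (\<lambda>h. normal_at W ?s * ((- snd h) *\<^sub>R (\<i> * cis (- snd x))) +
        (fst h *\<^sub>R (- of_real ?k * tangent_at W ?s)) * cis (- snd x))) (at x)"
    by (rule has_derivative_mult)
  moreover have "normal_at W ?s * ((- snd h) *\<^sub>R (\<i> * cis (- snd x))) +
        (fst h *\<^sub>R (- of_real ?k * tangent_at W ?s)) * cis (- snd x) =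
      (?k * fst h - snd h) *\<^sub>R (\<i> * velocity W x)" for h
    by (simp add: velocity_eq normal_at_eq scaleR_conv_of_real algebra_simps)
  ultimately show ?thesis by (simp add: velocity_eq[abs_def])
qed

lemma incoming_normal:
  assumes "next_collision W x y"
  shows "velocity W x \<bullet> normal_at W (fst y) = - cos (snd y)"
    "velocity W x \<bullet> tangent_at W (fst y) = sin (snd y)"
proof -
  have y: "non_corner W (fst y)" "velocity W y = reflected (normal_at W (fst y)) (velocity W x)"
    using assms by (simp_all add: next_collision_iff regular_def)
  have n: "normal_at W (fst y) \<bullet> normal_at W (fst y) = 1"
    "normal_at W (fst y) \<bullet> tangent_at W (fst y) = 0"
    using y by (simp_all add: dot_square_norm) (simp add: normal_at_eq inner_complex_def)
  show "velocity W x \<bullet> normal_at W (fst y) = - cos (snd y)"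
    using velocity_normal[OF y(1)] n(1) by (simp add: y(2) reflected_def inner_diff_left)
  show "velocity W x \<bullet> tangent_at W (fst y) = sin (snd y)"
    using velocity_tangent[OF y(1)] n(2) by (simp add: y(2) reflected_def inner_diff_left)
qed

text \<open>The point of impact solves a scalar equation whose derivative along the wall is
  \<open>cos (snd y)\<close>, nonzero because the impact is not tangential. That the perturbed
  flight is free as well follows from compactness for its middle part and from
  \<open>near_wall\<close> at its two ends. \<open>\<theta>\<close> is the rotation of the velocity
  and \<open>\<sigma>\<close> the shift of the point of impact.\<close>

lemma collision_smooth:
  assumes xy: "next_collision W x y"
    and t: "point_at W (fst y) = point_at W (fst x) + t *\<^sub>R velocity W x"
  defines "\<theta> \<equiv> \<lambda>h. curv_at W (fst x) * fst h - snd h"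
  defines "\<sigma> \<equiv> \<lambda>h. (t * \<theta> h - cos (snd x) * fst h) / cos (snd y)"
  shows "\<forall>\<^sub>F x' in nhds x. x' \<in> collision_dom W"
    "(collision_map W has_derivative (\<lambda>h. (\<sigma> h, \<theta> h - curv_at W (fst y) * \<sigma> h))) (at x)"
proof -
  let ?v = "velocity W x" and ?s = "fst y"
  have x: "non_corner W (fst x)" and y: "non_corner W ?s" and rx: "regular W x" and ry: "regular W y"
    using xy by (simp_all add: next_collision_iff regular_def)
  obtain t' where t': "t' > 0" "point_at W (fst y) = point_at W (fst x) + t' *\<^sub>R ?v"
      "\<forall>u\<in>{0<..<t'}. point_at W (fst x) + u *\<^sub>R ?v \<notin> boundary W"
    using xy by (auto simp: next_collision_iff)
  have "t' *\<^sub>R ?v = t *\<^sub>R ?v" using t t' by simp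
  then have tt: "t' = t" using norm_velocity[OF x] by (metis scaleR_cancel_right norm_zero zero_neq_one)
  have tpos: "t > 0" and free: "\<forall>u\<in>{0<..<t}. point_at W (fst x) + u *\<^sub>R ?v \<notin> boundary W"
    using t' tt by auto
  have cy: "cos (snd y) > 0" using cos_pos[OF ry] .
  note inc = incoming_normal[OF xy]
  have iT1: "tangent_at W ?s \<bullet> (\<i> * ?v) = cos (snd y)"
    using inc(1) by (simp add: normal_at_eq inner_complex_def algebra_simps)
  have iT0: "tangent_at W (fst x) \<bullet> (\<i> * ?v) = - cos (snd x)"
    using velocity_normal[OF x] by (simp add: normal_at_eq inner_complex_def algebra_simps)
  have vv: "?v \<bullet> ?v = 1" using norm_velocity[OF x] by (simp add: dot_square_norm)
  \<comment> \<open>A zero of \<open>g z\<close> says that the wall point lies on the line of the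
    trajectory from \<open>z\<close>; the position on that line is measured separately by
    \<open>\<tau>\<close>.\<close>
  define g where "g z s = (point_at W s - point_at W (fst z)) \<bullet> (\<i> * velocity W z)" for z :: state and s
  have dv: "((\<lambda>z. \<i> * velocity W z) has_derivative (\<lambda>h. \<i> * (\<theta> h *\<^sub>R (\<i> * ?v)))) (at x)"
    using velocity_deriv[OF x] unfolding \<theta>_def by (rule has_derivative_mult_right)
  have dp: "(point_at W has_derivative (\<lambda>h. h *\<^sub>R tangent_at W s)) (at s)" if "non_corner W s" for s
    using point_at_deriv[OF that] by (simp add: has_vector_derivative_def)
  have "((\<lambda>z. point_at W (snd z) - point_at W (fst (fst z))) has_derivative
      (\<lambda>h. snd h *\<^sub>R tangent_at W ?s - fst (fst h) *\<^sub>R tangent_at W (fst x))) (at (x, ?s))"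
  proof (rule has_derivative_diff)
    have "((\<lambda>z::state\<times>real. snd z) has_derivative (\<lambda>h. snd h)) (at (x, ?s))"
      "((\<lambda>z::state\<times>real. fst (fst z)) has_derivative (\<lambda>h. fst (fst h))) (at (x, ?s))"
      by (auto intro!: derivative_intros)
    from has_derivative_compose[OF this(1), of "point_at W" "\<lambda>h. h *\<^sub>R tangent_at W ?s"]
      has_derivative_compose[OF this(2), of "point_at W" "\<lambda>h. h *\<^sub>R tangent_at W (fst x)"]
    show "((\<lambda>z::state\<times>real. point_at W (snd z)) has_derivative (\<lambda>h. snd h *\<^sub>R tangent_at W ?s)) (at (x, ?s))"
      "((\<lambda>z::state\<times>real. point_at W (fst (fst z))) has_derivative
        (\<lambda>h. fst (fst h) *\<^sub>R tangent_at W (fst x))) (at (x, ?s))"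
      using dp x y by simp_all
  qed
  moreover have "((\<lambda>z. \<i> * velocity W (fst z)) has_derivative
      (\<lambda>h. \<i> * (\<theta> (fst h) *\<^sub>R (\<i> * ?v)))) (at (x, ?s))"
    using has_derivative_compose[OF has_derivative_fst[OF has_derivative_ident], of "\<lambda>z. \<i> * velocity W z" _ "(x, ?s)"]
      dv by simp
  ultimately have "((\<lambda>z. g (fst z) (snd z)) has_derivative
     (\<lambda>h. (point_at W (snd (x, ?s)) - point_at W (fst (fst (x, ?s)))) \<bullet> (\<i> * (\<theta> (fst h) *\<^sub>R (\<i> * ?v))) +
       (snd h *\<^sub>R tangent_at W ?s - fst (fst h) *\<^sub>R tangent_at W (fst x)) \<bullet> (\<i> * velocity W (fst (x, ?s)))))
     (at (x, ?s))"
    unfolding g_def by (rule has_derivative_inner)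
  moreover have "(point_at W ?s - point_at W (fst x)) \<bullet> (\<i> * (\<theta> h *\<^sub>R (\<i> * ?v))) = - (t * \<theta> h)" for h
  proof -
    have "\<i> * (\<theta> h *\<^sub>R (\<i> * ?v)) = - (\<theta> h *\<^sub>R ?v)"
      by (simp add: scaleR_conv_of_real algebra_simps)
    then show ?thesis by (simp add: t vv)
  qed
  ultimately have dg: "((\<lambda>z. g (fst z) (snd z)) has_derivative
     (\<lambda>h. (cos (snd x) * fst (fst h) - t * \<theta> (fst h)) + cos (snd y) * snd h)) (at (x, ?s))"
    by (elim has_derivative_eq_rhs) (simp add: inner_diff_left iT0 iT1 algebra_simps fun_eq_iff)
  have g0: "g x ?s = 0"
    by (simp add: g_def t inner_complex_def)
  let ?i = "wall_index W ?s"
  define \<delta> where "\<delta> = min (?s - offset W ?i) (offset W (Suc ?i) - ?s) / 2"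
  have \<delta>: "\<delta> > 0" using wall_index_less[OF y] by (simp add: \<delta>_def)
  have "continuous_on {?s - \<delta>..?s + \<delta>} (g z)" for z
  proof -
    have "non_corner W s" if "s \<in> {?s - \<delta>..?s + \<delta>}" for s
      using that wall_index_less[OF y] by (auto simp: non_corner_def \<delta>_def min_def field_simps intro!: exI[of _ ?i] split: if_splits)
    then have "continuous_on {?s - \<delta>..?s + \<delta>} (point_at W)"
      by (intro continuous_at_imp_continuous_on) (auto intro: isCont_at)
    then show ?thesis unfolding g_def by (intro continuous_intros)
  qed
  then have cont: "\<forall>\<^sub>F z in nhds x. continuous_on {?s - \<delta>..?s + \<delta>} (g z)" by simp
  have cy0: "cos (snd y) \<noteq> 0" using cy by simp
  obtain r where r: "r x = ?s" "\<forall>\<^sub>F z in nhds x. g z (r z) = 0"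
      "(r has_derivative (\<lambda>h. - (cos (snd x) * fst h - t * \<theta> h) / cos (snd y))) (at x)"
    by (rule implicit_scalar[where A = "\<lambda>h. cos (snd x) * fst h - t * \<theta> h" and b = "cos (snd y)",
        OF dg cy0 g0 \<delta> cont])
  have dr: "(r has_derivative \<sigma>) (at x)"
    using r(3) by (rule has_derivative_eq_rhs) (simp add: \<sigma>_def fun_eq_iff)
  have rlim: "(r \<longlongrightarrow> ?s) (nhds x)"
    using has_derivative_continuous[OF dr] tendsto_at_iff_tendsto_nhds[of r x] r(1) by (simp add: isCont_def)
  have vlim: "(velocity W \<longlongrightarrow> ?v) (nhds x)"
    using has_derivative_continuous[OF velocity_deriv[OF x]] by (simp add: isCont_def tendsto_at_iff_tendsto_nhds)
  have flim: "(fst \<longlongrightarrow> fst x) (nhds x)" "(snd \<longlongrightarrow> snd x) (nhds x)"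
    using tendsto_fst[OF filterlim_ident, of x] tendsto_snd[OF filterlim_ident, of x] by simp_all
  note plim = isCont_tendsto_compose[OF isCont_at(1)[OF x] flim(1)]
    isCont_tendsto_compose[OF isCont_at(1)[OF y] rlim]
    isCont_tendsto_compose[OF isCont_at(2)[OF y] rlim]
    isCont_tendsto_compose[OF isCont_at(3)[OF y] rlim]
  define \<tau> where "\<tau> z = (point_at W (r z) - point_at W (fst z)) \<bullet> velocity W z" for z
  have \<tau>lim: "(\<tau> \<longlongrightarrow> t) (nhds x)"
  proof -
    have "(\<tau> \<longlongrightarrow> (point_at W ?s - point_at W (fst x)) \<bullet> ?v) (nhds x)"
      unfolding \<tau>_def by (intro tendsto_inner tendsto_diff plim vlim)
    then show ?thesis by (simp add: t vv)
  qed
  define G where "G z = (r z, arcsin (velocity W z \<bullet> tangent_at W (r z)))" for z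
  obtain \<epsilon>1 where \<epsilon>1: "\<epsilon>1 > 0" "\<forall>\<^sub>F z in nhds (fst x, ?v). \<forall>u\<in>{0<..<\<epsilon>1}. norm (snd z) = 1 \<longrightarrow>
     point_at W (fst z) + u *\<^sub>R snd z \<in> \<Omega>"
    using near_wall(1)[OF x norm_velocity[OF x]] cos_pos[OF rx] velocity_normal[OF x] by auto
  have "norm (- ?v) = 1" "(- ?v) \<bullet> normal_at W ?s > 0" using x inc cy by auto
  then obtain \<epsilon>2 where \<epsilon>2: "\<epsilon>2 > 0" "\<forall>\<^sub>F z in nhds (?s, - ?v). \<forall>u\<in>{0<..<\<epsilon>2}. norm (snd z) = 1 \<longrightarrow>
     point_at W (fst z) + u *\<^sub>R snd z \<in> \<Omega>"
    using near_wall(1)[OF y] by blast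
  \<comment> \<open>The compact middle part overlaps the two end pieces controlled by
    \<open>\<epsilon>1\<close> and \<open>\<epsilon>2\<close>. The overlap absorbs the difference
    between the perturbed flight time and \<open>t\<close>.\<close>
  define K where "K = (\<lambda>u. point_at W (fst x) + u *\<^sub>R ?v) ` {min \<epsilon>1 t / 2 .. t - min \<epsilon>2 t / 2}"
  have "compact K" unfolding K_def by (intro compact_continuous_image continuous_intros) auto
  moreover have "K \<subseteq> \<Omega>"
    unfolding K_def using segment_in_domain[OF rx free] \<epsilon>1 \<epsilon>2 tpos by (auto simp: min_def)
  ultimately obtain \<eta> where \<eta>: "\<eta> > 0" "(\<Union>q\<in>K. ball q \<eta>) \<subseteq> \<Omega>"
    using open_domain compact_subset_open_imp_ball_epsilon_subset by blast
  have ev: "\<forall>\<^sub>F z in nhds x. next_collision W z (G z)"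
  proof -
    have nb: "\<forall>\<^sub>F z in nhds x. non_corner W (fst z)" "\<forall>\<^sub>F z in nhds x. non_corner W (r z)"
      using filterlim_iff[THEN iffD1, OF flim(1), rule_format, OF near_eqs[OF x]]
        filterlim_iff[THEN iffD1, OF rlim, rule_format, OF near_eqs[OF y]]
      by (auto elim: eventually_mono)
    have "\<bar>snd x\<bar> < pi / 2" using rx by (simp add: regular_def)
    then have sx: "\<forall>\<^sub>F z in nhds x. \<bar>snd z\<bar> < pi / 2"
      using tendsto_rabs[OF flim(2)] by (intro order_tendstoD) auto
    have \<tau>pos: "\<forall>\<^sub>F z in nhds x. 0 < \<tau> z" using \<tau>lim tpos by (rule order_tendstoD)
    have \<tau>less: "\<forall>\<^sub>F z in nhds x. \<tau> z < t + min \<epsilon>2 t / 2" using \<tau>lim tpos \<epsilon>2 by (intro order_tendstoD) auto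
    have \<tau>gt: "\<forall>\<^sub>F z in nhds x. t - min \<epsilon>2 t / 2 < \<tau> z" using \<tau>lim tpos \<epsilon>2 by (intro order_tendstoD) auto
    have "((\<lambda>z. velocity W z \<bullet> normal_at W (r z)) \<longlongrightarrow> ?v \<bullet> normal_at W ?s) (nhds x)"
      by (intro tendsto_inner vlim plim)
    then have vn: "\<forall>\<^sub>F z in nhds x. velocity W z \<bullet> normal_at W (r z) < 0"
      using inc cy by (intro order_tendstoD) auto
    have "filterlim (\<lambda>z. (fst z, velocity W z)) (nhds (fst x, ?v)) (nhds x)"
      by (intro tendsto_Pair flim vlim)
    from filterlim_iff[THEN iffD1, OF this, rule_format, OF \<epsilon>1(2)]
    have e1: "\<forall>\<^sub>F z in nhds x. \<forall>u\<in>{0<..<\<epsilon>1}. norm (velocity W z) = 1 \<longrightarrow>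
       point_at W (fst z) + u *\<^sub>R velocity W z \<in> \<Omega>" by simp
    have "filterlim (\<lambda>z. (r z, - velocity W z)) (nhds (?s, - ?v)) (nhds x)"
      by (intro tendsto_Pair tendsto_minus rlim vlim)
    from filterlim_iff[THEN iffD1, OF this, rule_format, OF \<epsilon>2(2)]
    have e2: "\<forall>\<^sub>F z in nhds x. \<forall>u\<in>{0<..<\<epsilon>2}. norm (velocity W z) = 1 \<longrightarrow>
       point_at W (r z) - u *\<^sub>R velocity W z \<in> \<Omega>" by simp
    have e3: "\<forall>\<^sub>F z in nhds x. dist (point_at W (fst z)) (point_at W (fst x)) < \<eta> / 2"
      using plim(1) \<eta> by (intro tendstoD) auto
    have "\<eta> / (2 * t) > 0" using \<eta> tpos by simp
    then have e4: "\<forall>\<^sub>F z in nhds x. dist (velocity W z) ?v < \<eta> / (2 * t)"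
      using vlim by (intro tendstoD)
    show ?thesis
      using nb sx \<tau>pos \<tau>less \<tau>gt vn e1 e2 e3 e4 r(2)
    proof eventually_elim
      case (elim z)
      let ?q = "point_at W (fst z)" and ?vz = "velocity W z"
      have nz: "norm ?vz = 1" using elim by simp
      have hit: "point_at W (r z) = ?q + \<tau> z *\<^sub>R ?vz"
        using orthonormal_expansion[OF nz, of "point_at W (r z) - ?q"] elim(12)
        by (simp add: g_def \<tau>_def algebra_simps)
      have inside: "?q + u *\<^sub>R ?vz \<in> \<Omega>" if u: "u \<in> {0<..<\<tau> z}" for u
      proof -
        consider "u < \<epsilon>1" | "\<tau> z - u < \<epsilon>2" | "u \<in> {min \<epsilon>1 t / 2 .. t - min \<epsilon>2 t / 2}"
          using elim(5,6) \<epsilon>1 \<epsilon>2 tpos by (fastforce simp: min_def split: if_splits)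
        then show ?thesis
        proof cases
          case 1 then show ?thesis using elim(8) u nz by auto
        next
          case 2
          then have "point_at W (r z) - (\<tau> z - u) *\<^sub>R ?vz \<in> \<Omega>" using elim(9) u nz by auto
          then show ?thesis by (simp add: hit algebra_simps)
        next
          case 3
          have ut: "0 \<le> u" "u \<le> t" using 3 tpos \<epsilon>1 \<epsilon>2 u by (auto simp: min_def split: if_splits)
          have "dist (?q + u *\<^sub>R ?vz) (point_at W (fst x) + u *\<^sub>R ?v) =
              norm ((?q - point_at W (fst x)) + u *\<^sub>R (?vz - ?v))"
            by (simp add: dist_norm algebra_simps)
          also have "\<dots> \<le> norm (?q - point_at W (fst x)) + u * norm (?vz - ?v)"
            using norm_triangle_ineq[of "?q - point_at W (fst x)" "u *\<^sub>R (?vz - ?v)"] ut by simp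
          also have "\<dots> < \<eta> / 2 + t * (\<eta> / (2 * t))"
            using elim(10,11) ut tpos
            by (intro add_less_le_mono mult_mono) (auto simp: dist_norm)
          also have "\<dots> = \<eta>" using tpos by simp
          finally show ?thesis using \<eta>(2) 3 unfolding K_def by (force simp: dist_commute)
        qed
      qed
      have ang: "velocity W z \<bullet> (\<i> * tangent_at W (r z)) < 0" "norm (tangent_at W (r z)) = 1"
        using elim by (simp_all add: normal_at_eq)
      show ?case
        unfolding next_collision_iff
      proof (intro conjI exI[of _ "\<tau> z"])
        show "regular W z" "regular W (G z)"
          using elim reflected_angle(1)[OF ang(2) nz ang(1)] by (simp_all add: regular_def G_def)
        show "velocity W (G z) = reflected (normal_at W (fst (G z))) (velocity W z)"
          using reflected_angle(2)[OF ang(2) nz ang(1)] unfolding velocity_eq[of W "G z"] by (simp add: G_def normal_at_eq)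
        show "point_at W (fst (G z)) = ?q + \<tau> z *\<^sub>R ?vz" by (simp add: G_def hit)
        show "\<forall>u\<in>{0<..<\<tau> z}. ?q + u *\<^sub>R ?vz \<notin> boundary W" using inside domain_boundary by blast
        show "0 < \<tau> z" by fact
      qed
    qed
  qed
  then show "\<forall>\<^sub>F x' in nhds x. x' \<in> collision_dom W"
    unfolding collision_dom_def by eventually_elim blast
  have sy: "\<bar>snd y\<bar> < pi/2" using ry by (simp add: regular_def)
  have ss: "-1 < sin (snd y)" "sin (snd y) < 1"
  proof -
    have "(sin (snd y))\<^sup>2 < 1" using cy by (simp add: sin_squared_eq)
    then show "-1 < sin (snd y)" "sin (snd y) < 1" using abs_square_less_1[of "sin (snd y)"] by auto
  qed
  have "((\<lambda>z. tangent_at W (r z)) has_derivative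
      (\<lambda>h. \<sigma> h *\<^sub>R (\<i> * of_real (curv_at W ?s) * tangent_at W ?s))) (at x)"
    using has_derivative_compose[OF dr, of "tangent_at W"] tangent_at_deriv[OF y]
    by (simp add: r(1) has_vector_derivative_def)
  from has_derivative_inner[OF velocity_deriv[OF x] this]
  have "((\<lambda>z. velocity W z \<bullet> tangent_at W (r z)) has_derivative
     (\<lambda>h. ?v \<bullet> (\<sigma> h *\<^sub>R (\<i> * of_real (curv_at W ?s) * tangent_at W ?s)) +
        (\<theta> h *\<^sub>R (\<i> * ?v)) \<bullet> tangent_at W ?s)) (at x)"
    by (simp add: \<theta>_def r(1))
  moreover have "?v \<bullet> (\<sigma> h *\<^sub>R (\<i> * of_real (curv_at W ?s) * tangent_at W ?s)) +
        (\<theta> h *\<^sub>R (\<i> * ?v)) \<bullet> tangent_at W ?s = cos (snd y) * (\<theta> h - curv_at W ?s * \<sigma> h)" for h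
  proof -
    have "\<sigma> h *\<^sub>R (\<i> * of_real (curv_at W ?s) * tangent_at W ?s) = (\<sigma> h * curv_at W ?s) *\<^sub>R normal_at W ?s"
      by (simp add: normal_at_eq scaleR_conv_of_real)
    then show ?thesis
      using inc(1) iT1 by (simp add: inner_commute[of "\<i> * ?v"] algebra_simps)
  qed
  ultimately have dm: "((\<lambda>z. velocity W z \<bullet> tangent_at W (r z)) has_derivative
     (\<lambda>h. cos (snd y) * (\<theta> h - curv_at W ?s * \<sigma> h))) (at x)" by simp
  have m: "velocity W x \<bullet> tangent_at W (r x) = sin (snd y)" using inc(2) r(1) by simp
  have "((\<lambda>z. arcsin (velocity W z \<bullet> tangent_at W (r z))) has_derivative
     (\<lambda>h. (cos (snd y) * (\<theta> h - curv_at W ?s * \<sigma> h)) * inverse (sqrt (1 - (sin (snd y))\<^sup>2)))) (at x)"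
    using has_derivative_arcsin[of "\<lambda>z. velocity W z \<bullet> tangent_at W (r z)" x, OF _ _ dm] ss
    by (simp add: m)
  moreover have "sqrt (1 - (sin (snd y))\<^sup>2) = cos (snd y)"
    using cy by (simp add: cos_squared_eq[symmetric])
  ultimately have "((\<lambda>z. arcsin (velocity W z \<bullet> tangent_at W (r z))) has_derivative
     (\<lambda>h. \<theta> h - curv_at W ?s * \<sigma> h)) (at x)"
    using cy0 by (elim has_derivative_eq_rhs) (simp add: fun_eq_iff)
  with dr have dG: "(G has_derivative (\<lambda>h. (\<sigma> h, \<theta> h - curv_at W ?s * \<sigma> h))) (at x)"
    unfolding G_def by (rule has_derivative_Pair)
  have eq: "\<forall>\<^sub>F z in nhds x. G z = collision_map W z"
    using ev by eventually_elim (simp add: collision_map_eq)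
  show "(collision_map W has_derivative (\<lambda>h. (\<sigma> h, \<theta> h - curv_at W ?s * \<sigma> h))) (at x)"
    using eq eventually_nhds_x_imp_x[OF eq]
    by (intro has_derivative_transform_eventually[OF dG])
      (auto simp: eventually_at_filter elim: eventually_mono)
qed

end

section \<open>Exceptional trajectories\<close>

text \<open>The line of the trajectory passes through no endpoint of a wall and touches no circle
  carrying a wall; for a straight wall the second condition excludes parallel motion. Whole lines
  and circles instead of rays and arcs keep both conditions linear in the velocity.\<close>

definition generic :: "wall list \<Rightarrow> state \<Rightarrow> bool" where
  "generic W x \<longleftrightarrow> (\<forall>w\<in>set W.
     (\<forall>q\<in>{wall_point w 0, wall_point w (wall_length w)}.
        (q - point_at W (fst x)) \<bullet> (\<i> * velocity W x) \<noteq> 0) \<and>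
     (normal_field w (point_at W (fst x)) \<bullet> (\<i> * velocity W x))\<^sup>2 \<noteq> 1)"

lemma inner_mult_complex: "c \<bullet> (m * z) = (c * cnj m) \<bullet> (z::complex)"
  by (simp add: inner_complex_def algebra_simps)

text \<open>Multiplication by \<open>cis \<alpha>\<close> turns the condition into a quadratic
  equation for \<open>cis \<alpha>\<close>, which is nontrivial unless \<open>a\<close> and
  \<open>d\<close> both vanish.\<close>

lemma finite_angles:
  fixes a :: complex
  assumes "a \<noteq> 0 \<or> d \<noteq> 0"
  shows "finite {\<alpha>. \<bar>\<alpha>\<bar> < pi/2 \<and> a \<bullet> cis (- \<alpha>) = d}"
proof -
  let ?S = "{\<alpha>. \<bar>\<alpha>\<bar> < pi/2 \<and> a \<bullet> cis (- \<alpha>) = d}"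
  define p where "p = [:cnj a, - 2 * of_real d, a:]"
  have "p \<noteq> 0" using assms by (auto simp: p_def)
  then have "finite {z. poly p z = 0}" by (rule poly_roots_finite)
  moreover have "cis ` ?S \<subseteq> {z. poly p z = 0}"
  proof clarify
    fix \<alpha> assume d: "d = a \<bullet> cis (- \<alpha>)"
    have "2 * of_real d = a * cis \<alpha> + cnj a * cnj (cis \<alpha>)"
      unfolding d by (simp add: complex_eq_iff inner_complex_def)
    moreover have "cis \<alpha> * cnj (cis \<alpha>) = 1" by (simp add: cis_cnj cis_mult)
    then have "cnj a * cnj (cis \<alpha>) * cis \<alpha> = cnj a" by (simp add: mult.assoc mult.commute)
    ultimately show "poly p (cis \<alpha>) = 0"
      by (simp add: p_def algebra_simps)
  qed
  ultimately have "finite (cis ` ?S)" by (rule finite_subset[rotated])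
  moreover have "inj_on cis ?S"
  proof (rule inj_onI)
    fix x y assume "x \<in> ?S" "y \<in> ?S" "cis x = cis y"
    then show "x = y"
      using reflected_angle_unique[of 1 "- x" "- y"] by simp
  qed
  ultimately show ?thesis by (rule finite_imageD)
qed

text \<open>By Fubini it suffices that almost every section is null. The sections are finite by
  \<open>finite_angles\<close>, except where \<open>a s = 0\<close> and \<open>d = 0\<close>, which
  the last hypothesis confines to a countable set.\<close>

lemma negligible_angles:
  fixes a :: "real \<Rightarrow> complex"
  assumes S: "open S" and a: "continuous_on S a" and ad: "countable {s\<in>S. a s = 0} \<or> d \<noteq> 0"
  shows "negligible {z. fst z \<in> S \<and> \<bar>snd z\<bar> < pi/2 \<and> a (fst z) \<bullet> cis (- snd z) = d}"
    (is "negligible ?Z")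
proof -
  define U where "U = S \<times> {- pi/2<..<pi/2}"
  have U: "open U" using S unfolding U_def by (intro open_Times) auto
  have "continuous_on U (\<lambda>z. a (fst z) \<bullet> cis (- snd z))"
    unfolding U_def by (intro continuous_intros continuous_on_compose2[OF a]) auto
  then have "closedin (top_of_set U) (U \<inter> (\<lambda>z. a (fst z) \<bullet> cis (- snd z)) -` {d})"
    by (rule continuous_closedin_preimage) simp
  moreover have "U \<inter> (\<lambda>z. a (fst z) \<bullet> cis (- snd z)) -` {d} = ?Z"
    by (auto simp: U_def abs_less_iff)
  ultimately obtain T where "closed T" "?Z = U \<inter> T" by (auto simp: closedin_closed)
  then have borel: "?Z \<in> sets borel" using U by auto
  have "AE s in lborel. AE \<alpha> in lborel. (s, \<alpha>) \<notin> ?Z"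
  proof -
    define N where "N = (if d \<noteq> 0 then {} else {s\<in>S. a s = 0})"
    have "countable N" using ad by (auto simp: N_def)
    then have "AE s in lborel. s \<notin> N" by (intro AE_not_in countable_imp_null_set_lborel)
    then show ?thesis
    proof eventually_elim
      case (elim s)
      show ?case
      proof (cases "s \<in> S")
        case True
        then have "finite {\<alpha>. \<bar>\<alpha>\<bar> < pi/2 \<and> a s \<bullet> cis (- \<alpha>) = d}"
          using elim by (intro finite_angles) (auto simp: N_def split: if_splits)
        then have "AE \<alpha> in lborel. \<alpha> \<notin> {\<alpha>. \<bar>\<alpha>\<bar> < pi/2 \<and> a s \<bullet> cis (- \<alpha>) = d}"
          by (intro AE_not_in finite_imp_null_set_lborel)
        then show ?thesis by eventually_elim auto
      qed auto
    qed
  qed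
  then have "AE z in lborel \<Otimes>\<^sub>M lborel. z \<notin> ?Z"
  proof (rule lborel_pair.AE_pair_measure[rotated])
    have "{z \<in> space (lborel \<Otimes>\<^sub>M lborel). z \<notin> ?Z} = - ?Z"
      by (auto simp: space_pair_measure)
    also have "\<dots> \<in> sets borel" using borel by (rule borel_comp)
    finally show "{z \<in> space (lborel \<Otimes>\<^sub>M lborel). z \<notin> ?Z} \<in> sets (lborel \<Otimes>\<^sub>M lborel)"
      by (simp only: lborel_prod sets_lborel)
  qed
  then have "AE z in lborel. z \<notin> ?Z" by (simp only: lborel_prod)
  then have "?Z \<in> null_sets lborel"
    using borel AE_iff_null_sets[of ?Z lborel] by simp
  then show ?thesis unfolding negligible_iff_null_sets by (rule null_sets_completionI)
qed

context billiard
begin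

lemma open_non_corner: "open {s. non_corner W s}"
proof -
  have "{s. non_corner W s} = (\<Union>i<length W. {offset W i<..<offset W (Suc i)})"
    by (auto simp: non_corner_def)
  then show ?thesis by auto
qed

lemma negligible_velocity:
  assumes S: "open S" "S \<subseteq> {s. non_corner W s}" and c: "continuous_on S c"
    and cd: "countable {s\<in>S. c s = 0} \<or> d \<noteq> 0"
  shows "negligible {x. fst x \<in> S \<and> \<bar>snd x\<bar> < pi/2 \<and> c (fst x) \<bullet> velocity W x = d}"
proof -
  have n: "continuous_on S (normal_at W)"
    using S by (intro continuous_at_imp_continuous_on) (auto intro: isCont_at)
  have "{s\<in>S. c s * cnj (normal_at W s) = 0} = {s\<in>S. c s = 0}"
    using norm_normal_at S(2)
    by (metis (lifting) complex_cnj_zero_iff mem_Collect_eq mult_eq_0_iff norm_zero subsetD zero_neq_one)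
  then have "negligible {z. fst z \<in> S \<and> \<bar>snd z\<bar> < pi/2 \<and>
      (c (fst z) * cnj (normal_at W (fst z))) \<bullet> cis (- snd z) = d}"
    using cd by (intro negligible_angles[of _ "\<lambda>s. c s * cnj (normal_at W s)"]
      continuous_intros S c n) auto
  then show ?thesis
    by (simp add: velocity_eq inner_mult_complex)
qed

lemma negligible_nongeneric: "negligible {x. regular W x \<and> \<not> generic W x}"
proof -
  have p: "continuous_on {s. non_corner W s} (point_at W)"
    by (intro continuous_at_imp_continuous_on) (auto intro: isCont_at)
  have rot: "c \<bullet> (\<i> * v) = (- \<i> * c) \<bullet> v" for c v :: complex
    by (simp add: inner_complex_def)
  have 1: "negligible {x. regular W x \<and> (q - point_at W (fst x)) \<bullet> (\<i> * velocity W x) = 0}" for q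
  proof -
    \<comment> \<open>Injectivity of the boundary coordinate leaves at most one coordinate at which
      the vector to \<open>q\<close> degenerates.\<close>
    have "countable {s. non_corner W s \<and> - \<i> * (q - point_at W s) = 0}"
    proof (cases "\<exists>a. non_corner W a \<and> point_at W a = q")
      case True
      then obtain a where "non_corner W a" "point_at W a = q" by blast
      then have "{s. non_corner W s \<and> - \<i> * (q - point_at W s) = 0} \<subseteq> {a}"
        by (auto intro!: point_at_inj[of _ a])
      then show ?thesis by (rule countable_subset) simp
    next
      case False
      then have "{s. non_corner W s \<and> - \<i> * (q - point_at W s) = 0} = {}" by auto
      then show ?thesis by (simp only: countable_empty)
    qed
    then show ?thesis
      unfolding rot regular_def conj_assoc
      using negligible_velocity[of "{s. non_corner W s}" "\<lambda>s. - \<i> * (q - point_at W s)" 0]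
      by (simp add: open_non_corner continuous_intros p)
  qed
  have 2: "negligible {x. regular W x \<and> normal_field w (point_at W (fst x)) \<bullet> (\<i> * velocity W x) = d}"
    if "d \<noteq> 0" for w d
    using that negligible_velocity[of "{s. non_corner W s}"
      "\<lambda>s. - \<i> * (wall_normal w 0 - of_real (curv w) * (point_at W s - src w))" d]
    unfolding rot normal_field_def regular_def conj_assoc
    by (simp add: open_non_corner continuous_intros p)
  have "{x. regular W x \<and> \<not> generic W x} \<subseteq> (\<Union>w\<in>set W.
      {x. regular W x \<and> (wall_point w 0 - point_at W (fst x)) \<bullet> (\<i> * velocity W x) = 0} \<union>
      {x. regular W x \<and> (wall_point w (wall_length w) - point_at W (fst x)) \<bullet> (\<i> * velocity W x) = 0} \<union>
      {x. regular W x \<and> normal_field w (point_at W (fst x)) \<bullet> (\<i> * velocity W x) = 1} \<union>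
      {x. regular W x \<and> normal_field w (point_at W (fst x)) \<bullet> (\<i> * velocity W x) = - 1})"
    by (auto simp: generic_def power2_eq_1_iff)
  moreover have "negligible \<dots>"
    by (intro negligible_Union finite_imageI ballI) (auto intro!: 1 2 negligible_Un)
  ultimately show ?thesis by (rule negligible_subset[rotated])
qed

text \<open>The first hit is the least element of a closed set of times, nonempty because an
  unobstructed ray would leave the bounded domain. Genericity makes the hit non-corner and
  transversal, and since the particle comes from inside, it arrives against the normal.\<close>

lemma collision_exists:
  assumes x: "regular W x" and gen: "generic W x"
  shows "x \<in> collision_dom W"
proof -
  let ?p = "point_at W (fst x)" and ?v = "velocity W x"
  define f where "f u = ?p + u *\<^sub>R ?v" for u
  have nc: "non_corner W (fst x)" using x by (simp add: regular_def)
  have nv: "norm ?v = 1" using nc by simp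
  obtain \<epsilon> where \<epsilon>: "\<epsilon> > 0" "\<forall>u\<in>{0<..<\<epsilon>}. f u \<in> \<Omega>"
    using near_wall_start[OF x] unfolding f_def by blast
  have "compact (boundary W)"
    unfolding boundary_def by (intro compact_UN compact_continuous_image continuous_wall_point) auto
  then have cb: "closed (boundary W)" by (rule compact_imp_closed)
  \<comment> \<open>Cutting off the times below \<open>\<epsilon>\<close> removes the starting
    point, which itself lies on the boundary, and makes the set closed.\<close>
  define A where "A = {u. \<epsilon> \<le> u \<and> f u \<in> boundary W}"
  have "continuous_on UNIV f" unfolding f_def by (intro continuous_intros)
  then have "closed (f -` boundary W)" using cb by (simp add: continuous_on_closed_vimage)
  then have "closed ({\<epsilon>..} \<inter> f -` boundary W)" by (intro closed_Int) auto
  moreover have "{\<epsilon>..} \<inter> f -` boundary W = A" by (auto simp: A_def)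
  ultimately have cA: "closed A" by simp
  have "A \<noteq> {}"
  proof
    assume "A = {}"
    have in\<Omega>: "f u \<in> \<Omega>" if u: "u > 0" for u
    proof -
      have "\<forall>a\<in>{0<..<u + 1}. f a \<notin> boundary W"
        using \<open>A = {}\<close> \<epsilon> domain_boundary by (force simp: A_def not_le)
      then show ?thesis using segment_in_domain[OF x] u unfolding f_def by force
    qed
    obtain B where B: "\<And>q. q \<in> \<Omega> \<Longrightarrow> norm q \<le> B" using bounded_domain by (auto simp: bounded_iff)
    define u where "u = norm ?p + \<bar>B\<bar> + 1"
    have "u > 0" unfolding u_def using norm_ge_zero[of ?p] by linarith
    have "u = norm (u *\<^sub>R ?v)" using nv \<open>u > 0\<close> by simp
    also have "\<dots> \<le> norm (f u) + norm ?p"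
      using norm_triangle_ineq4[of "f u" ?p] by (simp add: f_def)
    also have "\<dots> \<le> B + norm ?p" using B[OF in\<Omega>[OF \<open>u > 0\<close>]] by simp
    finally show False by (simp add: u_def)
  qed
  define t where "t = Inf A"
  have bA: "bdd_below A" by (auto simp: A_def intro: bdd_belowI)
  have tA: "t \<in> A" unfolding t_def using closed_contains_Inf[OF \<open>A \<noteq> {}\<close> bA cA] .
  have tpos: "t > 0" using tA \<epsilon> by (simp add: A_def)
  have free: "\<forall>u\<in>{0<..<t}. f u \<notin> boundary W"
  proof
    fix u assume u: "u \<in> {0<..<t}"
    show "f u \<notin> boundary W"
    proof (cases "u < \<epsilon>")
      case True then show ?thesis using \<epsilon> u domain_boundary by force
    next
      case False
      moreover have "u \<notin> A" using u cInf_lower[OF _ bA, of u] by (auto simp: t_def)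
      ultimately show ?thesis by (simp add: A_def)
    qed
  qed
  obtain w r where w: "w \<in> set W" "r \<in> {0..wall_length w}" "f t = wall_point w r"
    using tA by (auto simp: A_def boundary_def)
  have ft: "f t - ?p = t *\<^sub>R ?v" by (simp add: f_def)
  have ivv: "?v \<bullet> (\<i> * ?v) = 0" by (simp add: inner_complex_def)
  have "(f t - ?p) \<bullet> (\<i> * ?v) = 0" unfolding ft by (simp add: ivv)
  then have "r \<noteq> 0" "r \<noteq> wall_length w" using gen w by (auto simp: generic_def)
  then have r: "0 < r" "r < wall_length w" using w by auto
  obtain i where i: "i < length W" "w = W ! i" using w(1) by (metis in_set_conv_nth)
  define s where "s = offset W i + r"
  have s: "non_corner W s" "wall_index W s = i"
    using i r wall_index_eq[of i s] by (auto simp: s_def non_corner_def offset_Suc)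
  then have ps: "point_at W s = f t" and ns: "normal_at W s = wall_normal w r"
    using w i by (simp_all add: point_at_def normal_at_def wall_at_def s_def)
  have nf: "normal_at W s = normal_field w (f t)"
    unfolding ns w(3) normal_field_def by (rule wall_normal_eq)
  have "normal_at W s \<bullet> (\<i> * ?v) = normal_field w ?p \<bullet> (\<i> * ?v)"
    unfolding nf normal_field_def f_def by (simp add: inner_complex_def algebra_simps)
  \<comment> \<open>The component of the unit normal across the trajectory is not +-1, so by
    Pythagoras its component along the trajectory does not vanish.\<close>
  then have "(normal_at W s \<bullet> (\<i> * ?v))\<^sup>2 \<noteq> 1" using gen w(1) by (simp add: generic_def)
  moreover have "(normal_at W s \<bullet> ?v)\<^sup>2 + (normal_at W s \<bullet> (\<i> * ?v))\<^sup>2 = 1"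
  proof -
    have "(normal_at W s \<bullet> ?v)\<^sup>2 + (normal_at W s \<bullet> (\<i> * ?v))\<^sup>2 =
      ((Re (normal_at W s))\<^sup>2 + (Im (normal_at W s))\<^sup>2) * ((Re ?v)\<^sup>2 + (Im ?v)\<^sup>2)"
      by (simp add: inner_complex_def power2_eq_square algebra_simps)
    also have "\<dots> = 1"
      using complex_norm1_eq[of ?v] nv complex_norm1_eq[of "normal_at W s"] norm_normal_at[OF s(1)] by simp
    finally show ?thesis .
  qed
  ultimately have ne: "normal_at W s \<bullet> ?v \<noteq> 0" by auto
  \<comment> \<open>With a positive normal component, the points just before the hit would lie on
    the outer side of the wall.\<close>
  have neg: "?v \<bullet> normal_at W s < 0"
  proof (rule ccontr)
    assume "\<not> ?v \<bullet> normal_at W s < 0"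
    then have "?v \<bullet> normal_at W s > 0" using ne by (simp add: inner_commute)
    then obtain \<eta> where \<eta>: "\<eta> > 0" "\<forall>u\<in>{0<..<\<eta>}. point_at W s - u *\<^sub>R ?v \<notin> \<Omega>"
      using near_wall(2)[OF s(1) nv] by blast
    define u where "u = min \<eta> t / 2"
    have u: "0 < u" "u < \<eta>" "u < t" using \<eta> tpos by (auto simp: u_def)
    have "f (t - u) \<in> \<Omega>"
      unfolding f_def by (rule segment_in_domain[OF x, of t]) (use free u in \<open>auto simp: f_def\<close>)
    moreover have "f (t - u) = point_at W s - u *\<^sub>R ?v" by (simp add: ps f_def algebra_simps)
    ultimately show False using \<eta> u by auto
  qed
  have ang: "?v \<bullet> (\<i> * tangent_at W s) < 0" "norm (tangent_at W s) = 1"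
    using neg s by (simp_all add: normal_at_eq)
  define y where "y = (s, arcsin (?v \<bullet> tangent_at W s))"
  have "next_collision W x y"
    unfolding next_collision_iff
  proof (intro conjI exI[of _ t])
    show "regular W y" using s reflected_angle(1)[OF ang(2) nv ang(1)] by (simp add: regular_def y_def)
    show "velocity W y = reflected (normal_at W (fst y)) ?v"
      using reflected_angle(2)[OF ang(2) nv ang(1)] unfolding velocity_eq[of W y] by (simp add: y_def normal_at_eq)
  qed (use x tpos free ps in \<open>auto simp: y_def f_def\<close>)
  then show ?thesis unfolding collision_dom_def by blast
qed

section \<open>Flight lengths, and null sets under the collision map\<close>

lemma regular_collision_dom: "x \<in> collision_dom W \<Longrightarrow> regular W x"
  and regular_collision_map: "x \<in> collision_dom W \<Longrightarrow> regular W (collision_map W x)"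
  using collision_map_in by (auto simp: next_collision_iff)

definition flight :: "state \<Rightarrow> real" where
  "flight x = dist (point_at W (fst x)) (point_at W (fst (collision_map W x)))"

lemma flight:
  assumes "x \<in> collision_dom W"
  shows "0 < flight x"
    "point_at W (fst (collision_map W x)) = point_at W (fst x) + flight x *\<^sub>R velocity W x"
    "u \<in> {0<..<flight x} \<Longrightarrow> point_at W (fst x) + u *\<^sub>R velocity W x \<in> \<Omega>"
proof -
  let ?y = "collision_map W x" and ?p = "point_at W (fst x)"
  have c: "next_collision W x ?y" using collision_map_in[OF assms] .
  then obtain t where t: "t > 0" "point_at W (fst ?y) = ?p + t *\<^sub>R velocity W x"
      "\<forall>u\<in>{0<..<t}. ?p + u *\<^sub>R velocity W x \<notin> boundary W"
    by (auto simp: next_collision_iff)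
  have x: "regular W x" using regular_collision_dom[OF assms] .
  then have f: "flight x = t" using t by (simp add: flight_def dist_norm regular_def)
  show "0 < flight x" "point_at W (fst ?y) = ?p + flight x *\<^sub>R velocity W x"
    using t f by simp_all
  show "?p + u *\<^sub>R velocity W x \<in> \<Omega>" if "u \<in> {0<..<flight x}"
    using segment_in_domain[OF x t(3)] that f by simp
qed

lemma collision_map_deriv:
  assumes "x \<in> collision_dom W"
  defines "y \<equiv> collision_map W x"
  defines "\<theta> \<equiv> \<lambda>h. curv_at W (fst x) * fst h - snd h"
  defines "\<sigma> \<equiv> \<lambda>h. (flight x * \<theta> h - cos (snd x) * fst h) / cos (snd y)"
  shows "(collision_map W has_derivative (\<lambda>h. (\<sigma> h, \<theta> h - curv_at W (fst y) * \<sigma> h))) (at x)"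
  using collision_smooth(2)[OF collision_map_in[OF assms(1)] flight(2)[OF assms(1)]]
  unfolding y_def \<theta>_def \<sigma>_def .

lemma collision_dom_near: "x \<in> collision_dom W \<Longrightarrow> \<forall>\<^sub>F z in nhds x. z \<in> collision_dom W"
  using collision_smooth(1)[OF collision_map_in flight(2)] .

lemma negligible_collision_preimage:
  assumes "negligible N"
  shows "negligible {x \<in> collision_dom W. collision_map W x \<in> N}"
proof -
  have lin: "linear time_reversal"
    by (rule linearI) auto
  have R: "negligible (time_reversal ` M)" if "negligible M" for M
    by (intro negligible_differentiable_image_negligible that order_refl
      linear_imp_differentiable_on lin)
  have "collision_map W differentiable_on (time_reversal ` N \<inter> collision_dom W)"
    unfolding differentiable_on_def differentiable_def
    using collision_map_deriv has_derivative_at_withinI by blast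
  then have neg: "negligible (collision_map W ` (time_reversal ` N \<inter> collision_dom W))"
    using R[OF assms] by (intro negligible_differentiable_image_negligible)
      (auto intro: negligible_subset)
  have "{x \<in> collision_dom W. collision_map W x \<in> N} \<subseteq>
      time_reversal ` (collision_map W ` (time_reversal ` N \<inter> collision_dom W))"
  proof clarify
    fix s \<alpha> assume x: "(s, \<alpha>) \<in> collision_dom W" and N: "collision_map W (s, \<alpha>) \<in> N"
    let ?y = "time_reversal (collision_map W (s, \<alpha>))"
    have c: "next_collision W ?y (s, - \<alpha>)"
      using next_collision_reversal[OF collision_map_in[OF x]] by simp
    then have "?y \<in> collision_dom W" "collision_map W ?y = (s, - \<alpha>)"
      using collision_map_eq by (auto simp: collision_dom_def)
    then have "(s, - \<alpha>) \<in> collision_map W ` (time_reversal ` N \<inter> collision_dom W)"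
      using N by force
    from imageI[OF this, of time_reversal]
    show "(s, \<alpha>) \<in> time_reversal ` (collision_map W ` (time_reversal ` N \<inter> collision_dom W))"
      by simp
  qed
  then show ?thesis using R[OF neg] by (rule negligible_subset[rotated])
qed

definition good :: "state set \<Rightarrow> state set" where
  "good N = {x. regular W x \<and> (\<forall>j. (collision_map W ^^ j) x \<in> collision_dom W - N)}"

lemma good_collision: "x \<in> good N \<Longrightarrow> (collision_map W ^^ j) x \<in> good N"
proof -
  assume x: "x \<in> good N"
  have "(collision_map W ^^ j) x \<in> collision_dom W" using x by (auto simp: good_def)
  then have "regular W ((collision_map W ^^ j) x)" by (rule regular_collision_dom)
  moreover have "(collision_map W ^^ i) ((collision_map W ^^ j) x) \<in> collision_dom W - N" for i
    using x by (auto simp: good_def simp flip: funpow_add[unfolded comp_def fun_eq_iff, rule_format])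
  ultimately show ?thesis by (simp add: good_def)
qed

lemma negligible_not_good:
  assumes N: "negligible N"
  shows "negligible {x. regular W x \<and> x \<notin> good N}"
proof -
  \<comment> \<open>\<open>B j\<close> collects the states whose orbit reaches a defective state
    after \<open>j\<close> collisions; it is an iterated preimage of a null set.\<close>
  define B where "B = rec_nat {x. regular W x \<and> (x \<notin> collision_dom W \<or> x \<in> N)}
    (\<lambda>_ B. {x \<in> collision_dom W. collision_map W x \<in> B})"
  have B0: "B 0 = {x. regular W x \<and> (x \<notin> collision_dom W \<or> x \<in> N)}"
    and BS: "\<And>j. B (Suc j) = {x \<in> collision_dom W. collision_map W x \<in> B j}"
    by (simp_all add: B_def)
  have "B 0 \<subseteq> {x. regular W x \<and> \<not> generic W x} \<union> N"
    using collision_exists by (auto simp: B0)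
  then have "negligible (B 0)"
    using negligible_nongeneric N by (meson negligible_Un negligible_subset)
  then have neg: "negligible (B j)" for j
    by (induction j) (simp_all add: BS negligible_collision_preimage)
  have "(collision_map W ^^ j) x \<in> collision_dom W - N"
    if "regular W x" "x \<notin> (\<Union>j. B j)" for x j
    using that
  proof (induction j arbitrary: x)
    case 0
    then have "x \<notin> B 0" by blast
    then show ?case using 0 by (simp add: B0)
  next
    case (Suc j)
    have "x \<notin> B 0" using Suc by blast
    then have x: "x \<in> collision_dom W" using Suc.prems(1) by (simp add: B0)
    have "collision_map W x \<notin> B i" for i
    proof -
      have "x \<notin> B (Suc i)" using Suc.prems by blast
      then show ?thesis using x by (simp add: BS)
    qed
    then show ?case
      using Suc.IH[of "collision_map W x"] regular_collision_map[OF x] by (simp add: funpow_swap1)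
  qed
  then have "{x. regular W x \<and> x \<notin> good N} \<subseteq> (\<Union>j. B j)"
    unfolding good_def by blast
  moreover have "negligible (\<Union>j. B j)" using neg by (intro negligible_countable_Union) auto
  ultimately show ?thesis by (rule negligible_subset[rotated])
qed

end

section \<open>The first-return map\<close>

text \<open>
  A tangent vector corresponds to an infinitesimal beam of outgoing trajectories; its transversal
  displacement and its rotation evolve linearly along a free flight.
\<close>

definition displacement :: "state \<Rightarrow> real \<times> real \<Rightarrow> real" where
  "displacement x v = - cos (snd x) * fst v"

definition rotation :: "wall list \<Rightarrow> state \<Rightarrow> real \<times> real \<Rightarrow> real" where
  "rotation W x v = curv_at W (fst x) * fst v - snd v"

context billiard
begin

lemma regular_phase_space:
  assumes "regular W x"
  shows "x \<in> phase_space W \<longleftrightarrow> curv_at W (fst x) \<noteq> 0"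
proof -
  let ?s = "fst x" and ?i = "wall_index W (fst x)"
  have nc: "non_corner W ?s" and a: "- (pi/2) \<le> snd x" "snd x \<le> pi/2"
    using assms by (auto simp: regular_def)
  note i = wall_index_less[OF nc]
  have "j = ?i" if "j < length W" "offset W j \<le> ?s" "?s \<le> offset W (Suc j)" for j
  proof (rule ccontr)
    assume "j \<noteq> ?i"
    then consider "Suc j \<le> ?i" | "Suc ?i \<le> j" by linarith
    then show False
    proof cases
      case 1 then show False using offset_mono[OF 1] i that by simp
    next
      case 2 then show False using offset_mono[OF 2] i that by simp
    qed
  qed
  moreover have "x \<in> phase_space W \<longleftrightarrow>
      (\<exists>j. j < length W \<and> curv (W ! j) \<noteq> 0 \<and> offset W j \<le> ?s \<and> ?s \<le> offset W (Suc j))"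
    using a by (cases x) (auto simp: phase_space_def)
  ultimately have "x \<in> phase_space W \<longleftrightarrow> curv (W ! ?i) \<noteq> 0"
    using i by (metis less_imp_le)
  then show ?thesis by (simp add: curv_at_def wall_at_def)
qed

lemma first_return_iff:
  "first_return W n x y \<longleftrightarrow> x \<in> phase_space W \<and> y \<in> phase_space W \<and>
     (\<forall>i\<le>n. (collision_map W ^^ i) x \<in> collision_dom W) \<and>
     (\<forall>i\<in>{1..n}. (collision_map W ^^ i) x \<notin> phase_space W) \<and> y = (collision_map W ^^ Suc n) x"
    (is "_ \<longleftrightarrow> ?R")
proof
  assume "first_return W n x y"
  then obtain z where z: "x \<in> phase_space W" "y \<in> phase_space W" "z 0 = x" "z (Suc n) = y"
      "\<And>i. i \<le> n \<Longrightarrow> next_collision W (z i) (z (Suc i))" "\<And>i. i \<in> {1..n} \<Longrightarrow> z i \<notin> phase_space W"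
    unfolding first_return_def by blast
  have "z i = (collision_map W ^^ i) x" if "i \<le> Suc n" for i
    using that
  proof (induction i)
    case (Suc i)
    then show ?case using collision_map_eq[OF z(5)[of i]] by simp
  qed (use z in simp)
  note eq = this
  have "(collision_map W ^^ i) x \<in> collision_dom W" if "i \<le> n" for i
    unfolding collision_dom_def mem_Collect_eq by (rule exI[of _ "z (Suc i)"]) (use z(5)[OF that] eq[of i] that in simp)
  then show ?R using z(1,2) z(6) eq z(4) by auto
next
  assume R: ?R
  show "first_return W n x y"
    unfolding first_return_def
  proof (intro conjI exI[of _ "\<lambda>i. (collision_map W ^^ i) x"])
    show "\<forall>i\<le>n. next_collision W ((collision_map W ^^ i) x) ((collision_map W ^^ Suc i) x)"
      using R collision_map_in by simp
    show "y \<in> phase_space W" using R by blast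
  qed (use R in \<open>auto simp only: funpow_0\<close>)
qed

lemma first_return_unique:
  assumes "first_return W n x y" "first_return W m x z"
  shows "n = m \<and> y = z"
proof -
  have "\<not> i < j" if "first_return W i x y" "first_return W j x z" for i j y z
    using that unfolding first_return_iff by (metis Suc_le_eq atLeastAtMost_iff le_add1 plus_1_eq_Suc)
  then have "n = m" using assms by (metis linorder_neqE_nat)
  then show ?thesis using assms by (simp add: first_return_iff)
qed

lemma
  assumes "first_return W n x y"
  shows return_map_eq: "return_map W x = y" and flat_collisions_eq: "flat_collisions W x = n"
    and return_dom_in: "x \<in> return_dom W"
proof -
  show "return_map W x = y"
    unfolding return_map_def using assms first_return_unique by (intro the_equality) blast+
  show "flat_collisions W x = n"
    unfolding flat_collisions_def using assms first_return_unique by (intro the_equality) blast+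
  show "x \<in> return_dom W" using assms unfolding return_dom_def by blast
qed

lemma collision_funpow_inj:
  assumes "(collision_map W ^^ n) x = (collision_map W ^^ n) y"
    "\<forall>i<n. (collision_map W ^^ i) x \<in> collision_dom W" "\<forall>i<n. (collision_map W ^^ i) y \<in> collision_dom W"
  shows "x = y"
  using assms
proof (induction n)
  case (Suc n)
  then show ?case using collision_map_inj[of "(collision_map W ^^ n) x" "(collision_map W ^^ n) y"] by simp
qed simp

text \<open>Two orbits with the same return are compared backwards from it. Injectivity of the
  collision map places the later start on the longer orbit, whose intermediate states lie outside
  the phase space, so the lengths agree.\<close>

lemma return_map_inj: "inj_on (return_map W) (return_dom W)"
proof (rule inj_onI)
  have *: "x = x'" if "first_return W n x y" "first_return W m x' y" "n \<le> m" for n m x x' y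
  proof -
    let ?T = "collision_map W"
    have shift: "(?T ^^ i) ((?T ^^ (m - n)) x') = (?T ^^ (i + (m - n))) x'" for i
      by (simp only: funpow_add comp_def)
    have "Suc n + (m - n) = Suc m" using that(3) by simp
    then have "(?T ^^ Suc n) x = (?T ^^ Suc n) ((?T ^^ (m - n)) x')"
      using that(1,2) unfolding shift first_return_iff by metis
    then have "x = (?T ^^ (m - n)) x'"
      using that by (rule_tac collision_funpow_inj[of "Suc n"])
        (auto simp only: first_return_iff shift less_Suc_eq_le)
    then show ?thesis using that by (cases "m = n") (auto simp: first_return_iff)
  qed
  fix x x' assume x: "x \<in> return_dom W" "x' \<in> return_dom W" "return_map W x = return_map W x'"
  then obtain n m y y' where "first_return W n x y" "first_return W m x' y'"
    unfolding return_dom_def by blast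
  moreover from this have "y = y'" using return_map_eq x(3) by metis
  ultimately show "x = x'" using * by (metis nat_le_linear)
qed

lemma return_inv_return_map: "x \<in> return_dom W \<Longrightarrow> return_inv W (return_map W x) = x"
  unfolding return_inv_def using return_map_inj by (rule inv_into_f_f)

text \<open>Free flight is a shear and the reflection adds the mirror term. The common minus sign
  expresses that a reflection reverses the transversal orientation; both components change sign
  together, so no focal distance is affected.\<close>

lemma collision_map_beam:
  assumes x: "x \<in> collision_dom W"
  defines "y \<equiv> collision_map W x"
  obtains D where "(collision_map W has_derivative D) (at x)"
    "\<And>v. displacement y (D v) = - (displacement x v + flight x * rotation W x v)"
    "\<And>v. rotation W y (D v) = - (rotation W x v -
       2 * curv_at W (fst y) * (displacement x v + flight x * rotation W x v) / cos (snd y))"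
proof -
  define \<theta> where "\<theta> h = curv_at W (fst x) * fst h - snd h" for h :: "real \<times> real"
  define \<sigma> where "\<sigma> h = (flight x * \<theta> h - cos (snd x) * fst h) / cos (snd y)" for h
  have D: "(collision_map W has_derivative (\<lambda>h. (\<sigma> h, \<theta> h - curv_at W (fst y) * \<sigma> h))) (at x)"
    using collision_map_deriv[OF x] unfolding \<sigma>_def \<theta>_def y_def .
  have "cos (snd y) > 0" unfolding y_def by (intro cos_pos regular_collision_map x)
  then have c: "cos (snd y) * \<sigma> v = displacement x v + flight x * rotation W x v" for v
    by (simp add: \<sigma>_def \<theta>_def displacement_def rotation_def)
  have r: "\<sigma> v = (displacement x v + flight x * rotation W x v) / cos (snd y)" for v
    using c[of v] \<open>cos (snd y) > 0\<close> by (simp add: field_simps)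
  have t: "\<theta> v = rotation W x v" for v by (simp add: \<theta>_def rotation_def)
  show ?thesis
  proof (rule that[OF D])
    fix v
    show "displacement y (\<sigma> v, \<theta> v - curv_at W (fst y) * \<sigma> v) =
        - (displacement x v + flight x * rotation W x v)"
      using c[of v] by (simp add: displacement_def)
    show "rotation W y (\<sigma> v, \<theta> v - curv_at W (fst y) * \<sigma> v) = - (rotation W x v -
       2 * curv_at W (fst y) * (displacement x v + flight x * rotation W x v) / cos (snd y))"
      unfolding rotation_def[of W y] fst_conv snd_conv t by (simp add: r)
  qed
qed

section \<open>Beams along a complete return\<close>

definition path_length :: "nat \<Rightarrow> state \<Rightarrow> real" where
  "path_length n x = (\<Sum>i<n. flight ((collision_map W ^^ i) x))"

lemma path_length_Suc: "path_length (Suc n) x = path_length n x + flight ((collision_map W ^^ n) x)"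
  by (simp add: path_length_def)

text \<open>The mirror term has the curvature as a factor and vanishes. The sign
  \<open>\<epsilon>\<close> records the parity of the number of reflections, and the quadratic forms
  of the cones do not see it.\<close>

lemma flat_beam:
  assumes "\<forall>i<n. (collision_map W ^^ i) x \<in> collision_dom W"
    "\<forall>i\<in>{1..n}. curv_at W (fst ((collision_map W ^^ i) x)) = 0"
  shows "\<exists>D \<epsilon>. ((collision_map W ^^ n) has_derivative D) (at x) \<and> \<bar>\<epsilon>\<bar> = 1 \<and>
    (\<forall>v. displacement ((collision_map W ^^ n) x) (D v) =
        \<epsilon> * (displacement x v + path_length n x * rotation W x v) \<and>
      rotation W ((collision_map W ^^ n) x) (D v) = \<epsilon> * rotation W x v)"
  using assms
proof (induction n)
  case 0
  have "((collision_map W ^^ 0) has_derivative (\<lambda>v. v)) (at x)"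
    by (simp add: id_def has_derivative_ident)
  then show ?case
    by (intro exI[of _ "\<lambda>v. v"] exI[of _ 1]) (simp add: path_length_def)
next
  case (Suc n)
  let ?x = "(collision_map W ^^ n) x" 
  obtain D \<epsilon> where D: "((collision_map W ^^ n) has_derivative D) (at x)" "\<bar>\<epsilon>\<bar> = 1"
    "\<And>v. displacement ?x (D v) = \<epsilon> * (displacement x v + path_length n x * rotation W x v)"
    "\<And>v. rotation W ?x (D v) = \<epsilon> * rotation W x v"
    using Suc by auto
  have x: "?x \<in> collision_dom W" using Suc.prems(1) by simp
  obtain E where E: "(collision_map W has_derivative E) (at ?x)"
    "\<And>v. displacement (collision_map W ?x) (E v) = - (displacement ?x v + flight ?x * rotation W ?x v)"
    "\<And>v. rotation W (collision_map W ?x) (E v) = - (rotation W ?x v -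
       2 * curv_at W (fst (collision_map W ?x)) * (displacement ?x v + flight ?x * rotation W ?x v) /
         cos (snd (collision_map W ?x)))"
    using collision_map_beam[OF x] by metis
  have k: "curv_at W (fst (collision_map W ?x)) = 0"
    using Suc.prems(2)[rule_format, of "Suc n"] by simp
  have "((\<lambda>z. collision_map W ((collision_map W ^^ n) z)) has_derivative (\<lambda>v. E (D v))) (at x)"
    using has_derivative_compose[OF D(1) E(1)] .
  then have "((collision_map W ^^ Suc n) has_derivative (\<lambda>v. E (D v))) (at x)"
    by (simp add: comp_def)
  moreover have "(collision_map W ^^ Suc n) x = collision_map W ?x" by simp
  moreover have "displacement (collision_map W ?x) (E (D v)) =
      - \<epsilon> * (displacement x v + path_length (Suc n) x * rotation W x v) \<and>
      rotation W (collision_map W ?x) (E (D v)) = - \<epsilon> * rotation W x v" for v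
    by (simp add: E D k path_length_Suc) (simp add: algebra_simps)
  ultimately show ?case
    using D(2) by (intro exI[of _ "\<lambda>v. E (D v)"] exI[of _ "- \<epsilon>"]) (simp del: funpow.simps)
qed

lemma eventually_funpow:
  assumes "\<forall>i<n. (collision_map W ^^ i) x \<in> collision_dom W"
    and "\<forall>\<^sub>F z in nhds ((collision_map W ^^ n) x). P z"
  shows "\<forall>\<^sub>F z in nhds x. P ((collision_map W ^^ n) z)"
  using assms
proof (induction n arbitrary: P)
  case (Suc n)
  let ?x = "(collision_map W ^^ n) x"
  have "?x \<in> collision_dom W" using Suc.prems(1) by simp
  from has_derivative_continuous[OF collision_map_deriv[OF this]]
  have "filterlim (collision_map W) (nhds (collision_map W ?x)) (nhds ?x)"
    using tendsto_at_iff_tendsto_nhds[of "collision_map W" ?x] by (simp add: isCont_def)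
  from filterlim_iff[THEN iffD1, OF this, rule_format, of P] Suc.prems(2)
  have "\<forall>\<^sub>F z in nhds ?x. P (collision_map W z)" by simp
  then show ?case using Suc by simp
qed simp

lemma regular_funpow:
  assumes "\<forall>i\<le>n. (collision_map W ^^ i) x \<in> collision_dom W" "i \<le> Suc n"
  shows "regular W ((collision_map W ^^ i) x)"
proof (cases "i = Suc n")
  case True
  then show ?thesis using assms(1) regular_collision_map by simp
next
  case False
  then show ?thesis using assms regular_collision_dom by simp
qed

text \<open>The curvature is locally constant away from corners, so a nearby orbit visits straight
  and curved walls in the same order. Near \<open>x\<close> the return map is therefore a fixed
  iterate of the collision map, which makes it differentiable there.\<close>

lemma first_return_near:
  assumes "first_return W n x y"
  shows "\<forall>\<^sub>F z in nhds x. first_return W n z ((collision_map W ^^ Suc n) z)"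
proof -
  let ?T = "collision_map W"
  note x = assms[unfolded first_return_iff]
  have dom: "\<forall>\<^sub>F z in nhds x. \<forall>i\<in>{..n}. (?T ^^ i) z \<in> collision_dom W"
    using x by (intro eventually_ball_finite ballI eventually_funpow collision_dom_near) auto
  have reg: "regular W ((?T ^^ i) x)" if "i \<le> Suc n" for i
    using x that by (intro regular_funpow) auto
  have near: "\<forall>\<^sub>F z in nhds ((?T ^^ i) x). curv_at W (fst z) = curv_at W (fst ((?T ^^ i) x))"
    if "i \<le> Suc n" for i
  proof -
    have "non_corner W (fst ((?T ^^ i) x))" using reg[OF that] by (simp add: regular_def)
    from near_eqs[OF this]
    have "\<forall>\<^sub>F s in nhds (fst ((?T ^^ i) x)). curv_at W s = curv_at W (fst ((?T ^^ i) x))"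
      by eventually_elim (simp add: curv_at_def)
    from filterlim_iff[THEN iffD1, OF tendsto_fst[OF filterlim_ident], rule_format, OF this]
    show ?thesis .
  qed
  have curv: "\<forall>\<^sub>F z in nhds x. \<forall>i\<in>{..Suc n}. curv_at W (fst ((?T ^^ i) z)) = curv_at W (fst ((?T ^^ i) x))"
    using x by (intro eventually_ball_finite ballI eventually_funpow near) auto
  show ?thesis
    using dom curv
  proof eventually_elim
    case (elim z)
    have regz: "regular W ((?T ^^ i) z)" if "i \<le> Suc n" for i
      using elim(1) that by (intro regular_funpow) auto
    have ps: "(?T ^^ i) z \<in> phase_space W \<longleftrightarrow> (?T ^^ i) x \<in> phase_space W" if "i \<le> Suc n" for i
      unfolding regular_phase_space[OF reg[OF that]] regular_phase_space[OF regz[OF that]]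
      using elim(2) that by simp
    show ?case
      unfolding first_return_iff
      using x elim(1) ps[of 0] ps[of "Suc n"] ps by (auto simp del: funpow.simps simp: funpow_0)
  qed
qed

lemma return_map_beam:
  assumes fr: "first_return W n x y"
  obtains D \<epsilon> where "(return_map W has_derivative D) (at x)" "\<bar>\<epsilon>\<bar> = 1"
    "\<And>v. displacement y (D v) = \<epsilon> * (displacement x v + path_length (Suc n) x * rotation W x v)"
    "\<And>v. rotation W y (D v) = \<epsilon> * (rotation W x v -
       2 * curv_at W (fst y) * (displacement x v + path_length (Suc n) x * rotation W x v) / cos (snd y))"
proof -
  let ?T = "collision_map W"
  note x = fr[unfolded first_return_iff]
  let ?x = "(?T ^^ n) x"
  have "curv_at W (fst ((?T ^^ i) x)) = 0" if "i \<in> {1..n}" for i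
    using x that regular_phase_space[of "(?T ^^ i) x"] regular_collision_dom by auto
  then obtain D \<epsilon> where D: "((?T ^^ n) has_derivative D) (at x)" "\<bar>\<epsilon>\<bar> = 1"
    "\<And>v. displacement ?x (D v) = \<epsilon> * (displacement x v + path_length n x * rotation W x v)"
    "\<And>v. rotation W ?x (D v) = \<epsilon> * rotation W x v"
    using flat_beam[of n x] x by auto
  have "?x \<in> collision_dom W" and y: "?T ?x = y" using x by simp_all
  then obtain E where E: "(?T has_derivative E) (at ?x)"
    "\<And>v. displacement y (E v) = - (displacement ?x v + flight ?x * rotation W ?x v)"
    "\<And>v. rotation W y (E v) = - (rotation W ?x v -
       2 * curv_at W (fst y) * (displacement ?x v + flight ?x * rotation W ?x v) / cos (snd y))"
    using collision_map_beam by metis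
  have "((\<lambda>z. ?T ((?T ^^ n) z)) has_derivative (\<lambda>v. E (D v))) (at x)"
    using has_derivative_compose[OF D(1) E(1)] .
  moreover have ev: "\<forall>\<^sub>F z in nhds x. ?T ((?T ^^ n) z) = return_map W z"
    using first_return_near[OF fr] by eventually_elim (simp add: return_map_eq)
  ultimately have "(return_map W has_derivative (\<lambda>v. E (D v))) (at x)"
    using eventually_nhds_x_imp_x[OF ev]
    by (elim has_derivative_transform_eventually) (auto simp: eventually_at_filter elim: eventually_mono)
  from that[OF this, of "- \<epsilon>"] show ?thesis
    using D(2) by (simp add: D E path_length_Suc algebra_simps diff_divide_distrib add_divide_distrib)
qed

end

section \<open>Cones\<close>

text \<open>The focal distance is f = - J / J' for displacement J and rotation J'. The linear
  factors of the three forms vanish on the boundary rays of the cones: f = 0 and f = cos \<alpha> /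
  k in \<open>form0\<close>, f = 0 and f infinite in \<open>form1\<close>, f = cos \<alpha> / (2 k)
  and f = cos \<alpha> / k in \<open>form2\<close>. The sign of each form makes it nonnegative on
  the intended side.\<close>

definition form0 :: "wall list \<Rightarrow> state \<Rightarrow> real \<times> real \<Rightarrow> real" where
  "form0 W x v = displacement x v *
     (cos (snd x) * rotation W x v + curv_at W (fst x) * displacement x v)"

definition form1 :: "wall list \<Rightarrow> state \<Rightarrow> real \<times> real \<Rightarrow> real" where
  "form1 W x v = displacement x v * rotation W x v"

definition form2 :: "wall list \<Rightarrow> state \<Rightarrow> real \<times> real \<Rightarrow> real" where
  "form2 W x v = - ((cos (snd x) * rotation W x v + 2 * curv_at W (fst x) * displacement x v) *
     (cos (snd x) * rotation W x v + curv_at W (fst x) * displacement x v))"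

lemma focal_eq:
  assumes "0 < cos (snd x)"
  shows "focal W x v = (if displacement x v = 0 then 0 else if rotation W x v = 0 then - \<infinity>
    else ereal (- displacement x v / rotation W x v))"
  using assms
  by (cases x; cases v) (auto simp: focal_def displacement_def rotation_def Let_def field_simps)

lemma beam_nonzero:
  assumes "0 < cos (snd x)" "v \<noteq> 0"
  shows "displacement x v \<noteq> 0 \<or> rotation W x v \<noteq> 0"
  using assms by (cases v) (auto simp: displacement_def rotation_def zero_prod_def)

lemma quotient_cases:
  assumes "(J::real) \<noteq> 0" "J' \<noteq> 0"
  obtains f where "J = - f * J'" "f \<noteq> 0" "- J / J' = f"
  using that[of "- J / J'"] assms by simp

lemma cone0_eq:
  assumes c: "0 < cos (snd x)" and k: "curv_at W (fst x) < 0"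
  shows "cone0 W x = {v. 0 \<le> form0 W x v}"
proof -
  let ?c = "cos (snd x)" and ?k = "curv_at W (fst x)"
  have "(v = 0 \<or> v \<noteq> 0 \<and> ereal (- (?c / \<bar>?k\<bar>)) \<le> focal W x v \<and> focal W x v \<le> 0) \<longleftrightarrow> 0 \<le> form0 W x v" for v
  proof (cases "displacement x v = 0 \<or> rotation W x v = 0")
    case True
    show ?thesis
    proof (cases "displacement x v = 0")
      case True
      then show ?thesis using k c by (auto simp: focal_eq[OF c] form0_def divide_le_0_iff)
    next
      case nz: False
      then have "form0 W x v = ?k * (displacement x v)\<^sup>2"
        using True by (simp add: form0_def power2_eq_square)
      also have "\<dots> < 0" using nz k by (simp add: mult_neg_pos)
      finally have "form0 W x v < 0" .
      moreover have "v \<noteq> 0" using nz by (auto simp: displacement_def)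
      ultimately show ?thesis using nz True by (simp add: focal_eq[OF c])
    qed
  next
    case False
    then obtain f where f: "displacement x v = - f * rotation W x v" "f \<noteq> 0"
        "- displacement x v / rotation W x v = f"
      using quotient_cases by metis
    have v: "v \<noteq> 0" using False by (auto simp: displacement_def)
    have "form0 W x v = (rotation W x v)\<^sup>2 * (f * (?k * f - ?c))"
      unfolding form0_def f(1) by (simp add: power2_eq_square algebra_simps)
    then have "0 \<le> form0 W x v \<longleftrightarrow> 0 \<le> f * (?k * f - ?c)"
      using False by (simp add: zero_le_mult_iff)
    also have "\<dots> \<longleftrightarrow> - (?c / \<bar>?k\<bar>) \<le> f \<and> f \<le> 0"
    proof -
      have "0 \<le> f * (?k * f - ?c) \<longleftrightarrow> f < 0 \<and> ?k * f \<le> ?c"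
      proof (cases "f > 0")
        case True
        then have "?k * f < 0" using k by (simp add: mult_less_0_iff)
        then show ?thesis using True c by (auto simp: zero_le_mult_iff)
      qed (use f(2) in \<open>auto simp: zero_le_mult_iff\<close>)
      also have "?k * f \<le> ?c \<longleftrightarrow> - (?c / \<bar>?k\<bar>) \<le> f" using k by (simp add: field_simps)
      finally show ?thesis using f(2) by auto
    qed
    finally show ?thesis using False v f(3) by (simp add: focal_eq[OF c])
  qed
  then show ?thesis unfolding cone0_def focal_cone_def by blast
qed

lemma cone1_eq:
  assumes c: "0 < cos (snd x)"
  shows "cone1 W x = {v. 0 \<le> form1 W x v}"
proof -
  have "(v = 0 \<or> v \<noteq> 0 \<and> - \<infinity> \<le> focal W x v \<and> focal W x v \<le> 0) \<longleftrightarrow> 0 \<le> form1 W x v" for v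
  proof (cases "displacement x v = 0 \<or> rotation W x v = 0")
    case True
    then show ?thesis by (auto simp: focal_eq[OF c] form1_def)
  next
    case False
    then obtain f where f: "displacement x v = - f * rotation W x v" "f \<noteq> 0"
        "- displacement x v / rotation W x v = f"
      using quotient_cases by metis
    have v: "v \<noteq> 0" using False by (auto simp: displacement_def)
    have "form1 W x v = (rotation W x v)\<^sup>2 * (- f)"
      unfolding form1_def f(1) by (simp add: power2_eq_square)
    then have "0 \<le> form1 W x v \<longleftrightarrow> f \<le> 0" using False by (simp add: mult_le_0_iff zero_le_mult_iff)
    then show ?thesis
      using False v f(3) by (simp add: focal_eq[OF c])
  qed
  then show ?thesis unfolding cone1_def focal_cone_def by blast
qed

lemma cone2_bounds:
  fixes c k f :: real
  assumes "0 < c" "0 < k"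
  shows "(2 * k * f - c) * (c - k * f) \<ge> 0 \<longleftrightarrow> c / (2 * k) \<le> f \<and> f \<le> c / k"
proof -
  have "(2 * k * f - c) * (c - k * f) \<ge> 0 \<longleftrightarrow> c \<le> 2 * (k * f) \<and> k * f \<le> c"
    using assms by (auto simp: zero_le_mult_iff)
  also have "\<dots> \<longleftrightarrow> c / (2 * k) \<le> f \<and> f \<le> c / k"
    using assms by (simp add: field_simps)
  finally show ?thesis .
qed

lemma cone2_eq:
  assumes c: "0 < cos (snd x)" and k: "curv_at W (fst x) > 0"
  shows "cone2 W x = {v. 0 \<le> form2 W x v}"
proof -
  let ?c = "cos (snd x)" and ?k = "curv_at W (fst x)"
  have ck: "0 < ?c / (2 * ?k)" using c k by simp
  have "(v = 0 \<or> v \<noteq> 0 \<and> ereal (?c / (2 * \<bar>?k\<bar>)) \<le> focal W x v \<and> focal W x v \<le> ereal (?c / \<bar>?k\<bar>))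
     \<longleftrightarrow> 0 \<le> form2 W x v" for v
  proof (cases "v = 0")
    case True then show ?thesis by (simp add: form2_def displacement_def rotation_def)
  next
    case nz: False
    note J = beam_nonzero[OF c nz, of W]
    show ?thesis
    proof (cases "displacement x v = 0 \<or> rotation W x v = 0")
      case True
      have "form2 W x v < 0"
      proof (cases "displacement x v = 0")
        case J0: True
        then have "form2 W x v = - ((?c * rotation W x v)\<^sup>2)"
          by (simp add: form2_def power2_eq_square)
        then show ?thesis using J J0 c by simp
      next
        case nJ: False
        then have "form2 W x v = - (2 * (?k * displacement x v)\<^sup>2)"
          using True by (simp add: form2_def power2_eq_square)
        then show ?thesis using nJ k by simp
      qed
      then show ?thesis using True ck k nz by (auto simp: focal_eq[OF c] not_le)
    next
      case False
      then obtain f where f: "displacement x v = - f * rotation W x v" "f \<noteq> 0"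
          "- displacement x v / rotation W x v = f"
        using quotient_cases by metis
      have "form2 W x v = (rotation W x v)\<^sup>2 * ((2 * ?k * f - ?c) * (?c - ?k * f))"
        unfolding form2_def f(1) by (simp add: power2_eq_square algebra_simps)
      then have "0 \<le> form2 W x v \<longleftrightarrow> 0 \<le> (2 * ?k * f - ?c) * (?c - ?k * f)"
        using False by (simp add: zero_le_mult_iff)
      also have "\<dots> \<longleftrightarrow> ?c / (2 * ?k) \<le> f \<and> f \<le> ?c / ?k" by (rule cone2_bounds[OF c k])
      finally show ?thesis using False nz f(3) k by (simp add: focal_eq[OF c])
    qed
  qed
  then show ?thesis unfolding cone2_def focal_cone_def by blast
qed

lemma continuous_forms:
  "continuous_on UNIV (form0 W x)" "continuous_on UNIV (form1 W x)" "continuous_on UNIV (form2 W x)"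
  unfolding form0_def form1_def form2_def displacement_def rotation_def
  by (auto intro!: continuous_intros)

lemma form_interior:
  fixes q :: "real \<times> real \<Rightarrow> real"
  assumes "continuous_on UNIV q" "0 < q v"
  shows "v \<in> interior {v. 0 \<le> q v}"
proof -
  have "open {v. 0 < q v}" using assms(1) by (intro open_Collect_less) auto
  then show ?thesis using assms(2) by (intro interiorI[of "{v. 0 < q v}"]) auto
qed

section \<open>Beams in free flight\<close>

text \<open>A nonnegative product means that the focus does not lie ahead, so free flight moves the
  beam away from it and cannot refocus it.\<close>

lemma diverging_displacement:
  fixes J J' \<tau> :: real
  assumes "0 \<le> J * J'" "J \<noteq> 0 \<or> J' \<noteq> 0" "0 < \<tau>"
  shows "0 < (J + \<tau> * J')\<^sup>2" "0 \<le> (J + \<tau> * J') * J'"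
proof -
  have "(J + \<tau> * J')\<^sup>2 = J\<^sup>2 + (\<tau> * J')\<^sup>2 + 2 * \<tau> * (J * J')"
    by (simp add: power2_eq_square algebra_simps)
  moreover have "0 < J\<^sup>2 + (\<tau> * J')\<^sup>2"
    using assms by (auto simp: sum_power2_gt_zero_iff)
  moreover have "0 \<le> 2 * \<tau> * (J * J')" using assms by simp
  ultimately show "0 < (J + \<tau> * J')\<^sup>2" by linarith
  have "(J + \<tau> * J') * J' = J * J' + \<tau> * J'\<^sup>2" by (simp add: power2_eq_square algebra_simps)
  also have "\<dots> \<ge> 0" using assms by simp
  finally show "0 \<le> (J + \<tau> * J') * J'" .
qed

lemma form0_diverging:
  fixes J J' c k :: real
  assumes "0 \<le> J * (c * J' + k * J)" "0 < c" "k < 0"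
  shows "0 \<le> J * J'"
proof -
  have "c * (J * J') = J * (c * J' + k * J) + (- k) * J\<^sup>2" by (simp add: power2_eq_square algebra_simps)
  moreover have "0 \<le> (- k) * J\<^sup>2" using assms by (intro mult_nonneg_nonneg) auto
  ultimately have "0 \<le> c * (J * J')" using assms(1) by linarith
  then show ?thesis using assms(2) by (simp add: zero_le_mult_iff)
qed

text \<open>The conclusion is the value of \<open>form0\<close> after the next collision, expressed
  by the beam before the flight. The following lemmas state their conclusions in the same way;
  \<open>return_beam_forms\<close> makes the translation.\<close>

lemma diverging_to_form0:
  fixes J J' \<tau> c k :: real
  assumes J: "0 \<le> J * J'" "J \<noteq> 0 \<or> J' \<noteq> 0" and "0 < \<tau>" "0 < c" "k < 0"
  shows "0 < (J + \<tau> * J') * (c * J' - k * (J + \<tau> * J'))"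
proof -
  have "(J + \<tau> * J') * (c * J' - k * (J + \<tau> * J')) =
      c * ((J + \<tau> * J') * J') + (- k) * (J + \<tau> * J')\<^sup>2"
    by (simp add: power2_eq_square algebra_simps)
  moreover have "0 \<le> c * ((J + \<tau> * J') * J')" using diverging_displacement[OF J] assms by simp
  moreover have "0 < (- k) * (J + \<tau> * J')\<^sup>2"
    using diverging_displacement[OF J] assms by (intro mult_pos_pos) auto
  ultimately show ?thesis by linarith
qed

lemma form2_focal:
  fixes J J' c k :: real
  assumes q: "0 \<le> - ((c * J' + 2 * k * J) * (c * J' + k * J))" and J: "J \<noteq> 0 \<or> J' \<noteq> 0"
    and "0 < c" "0 < k"
  obtains f where "J = - f * J'" "J' \<noteq> 0" "c / (2 * k) \<le> f" "f \<le> c / k"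
proof -
  have "J' \<noteq> 0"
  proof
    assume "J' = 0"
    then have "2 * k * k * J\<^sup>2 \<le> 0" using q by (simp add: power2_eq_square algebra_simps)
    then show False using assms J \<open>J' = 0\<close> by (simp add: mult_le_0_iff)
  qed
  define f where "f = - J / J'"
  have f: "J = - f * J'" using \<open>J' \<noteq> 0\<close> by (simp add: f_def)
  have "- ((c * J' + 2 * k * J) * (c * J' + k * J)) = J'\<^sup>2 * ((2 * k * f - c) * (c - k * f))"
    unfolding f by (simp add: power2_eq_square algebra_simps)
  then have "0 \<le> (2 * k * f - c) * (c - k * f)" using q \<open>J' \<noteq> 0\<close> by (simp add: zero_le_mult_iff)
  then show ?thesis using that[of f] f \<open>J' \<noteq> 0\<close> cone2_bounds[OF assms(3,4)] by simp
qed

text \<open>There are two ways into the dispersing cone. A flight longer than c / k carries the beam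
  past its focus, and it arrives diverging. Otherwise the focus, at distance at least c / (2 k),
  lies beyond the foot of the perpendicular from the centre of the dispersing arc, which is at
  distance \<tau> - c' / k'.\<close>

lemma form2_to_form0:
  fixes J J' \<tau> c k c' k' :: real
  assumes "0 \<le> - ((c * J' + 2 * k * J) * (c * J' + k * J))" "J \<noteq> 0 \<or> J' \<noteq> 0"
    and "0 < c" "0 < k" "0 < c'" "k' < 0"
    and \<tau>: "c / k < \<tau> \<or> \<tau> - c' / k' < c / (2 * k)"
  shows "0 < (J + \<tau> * J') * (c' * J' - k' * (J + \<tau> * J'))"
proof -
  obtain f where f: "J = - f * J'" "J' \<noteq> 0" "c / (2 * k) \<le> f" "f \<le> c / k"
    using form2_focal assms(1-4) by blast
  have "(J + \<tau> * J') * (c' * J' - k' * (J + \<tau> * J')) = J'\<^sup>2 * ((\<tau> - f) * (c' - k' * (\<tau> - f)))"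
    unfolding f by (simp add: power2_eq_square algebra_simps)
  moreover have "0 < (\<tau> - f) * (c' - k' * (\<tau> - f))"
    using \<tau>
  proof
    assume "c / k < \<tau>"
    then have "0 < \<tau> - f" using f by simp
    moreover from this have "k' * (\<tau> - f) < 0" using assms by (simp add: mult_less_0_iff)
    ultimately show ?thesis using assms by (intro mult_pos_pos) auto
  next
    assume "\<tau> - c' / k' < c / (2 * k)"
    then have "\<tau> - f < c' / k'" using f by simp
    moreover from this have "c' < k' * (\<tau> - f)" using assms by (simp add: field_simps)
    moreover have "c' / k' < 0" using assms by (simp add: divide_less_0_iff)
    ultimately show ?thesis by (intro mult_neg_neg) auto
  qed
  ultimately show ?thesis using f by simp
qed

lemma form0_focal:
  fixes J J' c k :: real
  assumes q: "0 \<le> J * (c * J' + k * J)" and J: "J \<noteq> 0 \<or> J' \<noteq> 0" and "0 < c" "k < 0"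
  obtains g where "J = g * J'" "J' \<noteq> 0" "0 \<le> g" "g \<le> - c / k"
proof -
  have "J' \<noteq> 0"
  proof
    assume "J' = 0"
    then have "0 \<le> k * J\<^sup>2" using q by (simp add: power2_eq_square algebra_simps)
    then show False using assms J \<open>J' = 0\<close> by (simp add: zero_le_mult_iff)
  qed
  define g where "g = J / J'"
  have g: "J = g * J'" using \<open>J' \<noteq> 0\<close> by (simp add: g_def)
  have "J * J' = J'\<^sup>2 * g" by (simp add: g power2_eq_square)
  then have g0: "0 \<le> g" using form0_diverging[OF q assms(3,4)] \<open>J' \<noteq> 0\<close> by (simp add: zero_le_mult_iff)
  have "J * (c * J' + k * J) = J'\<^sup>2 * (g * (c + k * g))"
    unfolding g by (simp add: power2_eq_square algebra_simps)
  then have "0 \<le> g * (c + k * g)" using q \<open>J' \<noteq> 0\<close> by (simp add: zero_le_mult_iff)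
  then have "g = 0 \<or> 0 \<le> c + k * g" using g0 by (auto simp: zero_le_mult_iff)
  then have "g \<le> - c / k"
  proof
    assume "g = 0"
    have "0 \<le> - c / k" using assms by (simp add: divide_le_0_iff)
    then show ?thesis using \<open>g = 0\<close> by simp
  next
    assume "0 \<le> c + k * g"
    then show ?thesis using assms by (simp add: field_simps)
  qed
  then show ?thesis using that[of g] g \<open>J' \<noteq> 0\<close> g0 by simp
qed

text \<open>The virtual source lies \<open>g\<close> behind the dispersing point, hence at distance
  \<tau> + g from the focusing arc. This is less than the focal length c' / (2 k') of the mirror, so
  the image is virtual and the beam keeps diverging.\<close>

lemma form0_to_form1:
  fixes J J' \<tau> c k c' k' :: real
  assumes "0 \<le> J * (c * J' + k * J)" "J \<noteq> 0 \<or> J' \<noteq> 0"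
    and "0 < c" "k < 0" "0 < c'" "0 < k'" "0 < \<tau>"
    and \<tau>: "\<tau> - c / k < c' / (2 * k')"
  shows "0 < (J + \<tau> * J') * (J' - 2 * k' * (J + \<tau> * J') / c')"
proof -
  obtain g where g: "J = g * J'" "J' \<noteq> 0" "0 \<le> g" "g \<le> - c / k"
    using form0_focal assms(1-4) by blast
  have "(J + \<tau> * J') * (J' - 2 * k' * (J + \<tau> * J') / c') =
      J'\<^sup>2 * ((\<tau> + g) * (1 - 2 * k' * (\<tau> + g) / c'))"
    unfolding g by (simp add: power2_eq_square algebra_simps add_divide_distrib)
  moreover have "0 < (\<tau> + g) * (1 - 2 * k' * (\<tau> + g) / c')"
  proof (rule mult_pos_pos)
    show "0 < \<tau> + g" using g assms by simp
    have "\<tau> + g < c' / (2 * k')" using \<tau> g by simp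
    then show "0 < 1 - 2 * k' * (\<tau> + g) / c'" using assms by (simp add: field_simps)
  qed
  ultimately show ?thesis using g by simp
qed

text \<open>A source at a finite distance greater than c' / k' has its image strictly between c' /
  (2 k') and c' / k'.\<close>

lemma form0_to_form2:
  fixes J J' \<tau> c k c' k' :: real
  assumes "0 \<le> J * (c * J' + k * J)" "J \<noteq> 0 \<or> J' \<noteq> 0"
    and "0 < c" "k < 0" "0 < c'" "0 < k'" and \<tau>: "c' / k' < \<tau>"
  shows "0 < c' * J' * (k' * (J + \<tau> * J') - c' * J')"
proof -
  obtain g where g: "J = g * J'" "J' \<noteq> 0" "0 \<le> g" "g \<le> - c / k"
    using form0_focal assms(1-4) by blast
  have eq: "c' * J' * (k' * (J + \<tau> * J') - c' * J') = J'\<^sup>2 * (c' * (k' * (\<tau> + g) - c'))"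
    unfolding g by (simp add: power2_eq_square algebra_simps)
  have "c' / k' < \<tau> + g" using \<tau> g by simp
  then have "0 < k' * (\<tau> + g) - c'" using assms by (simp add: field_simps)
  then show ?thesis unfolding eq using g assms by (intro mult_pos_pos) auto
qed

text \<open>Here the source may be at infinity: parallel beams are focused exactly at c' / (2 k')
  and stay on the boundary of the cone. What is strict is the avoidance of the other boundary ray,
  the one that later collisions with the arc preserve.\<close>

lemma form1_to_form2:
  fixes J J' \<tau> c' k' :: real
  assumes q: "0 \<le> J * J'" and J: "J \<noteq> 0 \<or> J' \<noteq> 0"
    and "0 < c'" "0 < k'" and \<tau>: "c' / k' < \<tau>"
  shows "0 \<le> c' * J' * (k' * (J + \<tau> * J') - c' * J')" "k' * (J + \<tau> * J') - c' * J' \<noteq> 0"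
proof -
  have t: "0 < k' * \<tau> - c'" using assms by (simp add: field_simps)
  have eq: "c' * J' * (k' * (J + \<tau> * J') - c' * J') = c' * (k' * (J * J') + (k' * \<tau> - c') * J'\<^sup>2)"
    by (simp add: power2_eq_square algebra_simps)
  have nn: "0 \<le> k' * (J * J')" "0 \<le> (k' * \<tau> - c') * J'\<^sup>2" using assms t by simp_all
  show "0 \<le> c' * J' * (k' * (J + \<tau> * J') - c' * J')"
    by (subst eq, rule mult_nonneg_nonneg[OF less_imp_le[OF assms(3)] add_nonneg_nonneg[OF nn]])
  show "k' * (J + \<tau> * J') - c' * J' \<noteq> 0"
  proof
    assume 0: "k' * (J + \<tau> * J') - c' * J' = 0"
    then have "J' * (k' * (J + \<tau> * J') - c' * J') = 0" by simp
    then have "k' * (J * J') + (k' * \<tau> - c') * J'\<^sup>2 = 0" by (simp add: power2_eq_square algebra_simps)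
    then have "(k' * \<tau> - c') * J'\<^sup>2 = 0" using nn by linarith
    then show False using t J 0 assms by simp
  qed
qed

text \<open>The beam focuses within distance c / k, so the focus is at least c' / k' in front of the
  next collision. Equality requires the critical flight length and the focus at distance c / k
  together: the midpoint of a chord is imaged to the midpoint of the next.\<close>

lemma form2_to_form2:
  fixes J J' \<tau> c k c' k' :: real
  assumes "0 \<le> - ((c * J' + 2 * k * J) * (c * J' + k * J))" "J \<noteq> 0 \<or> J' \<noteq> 0"
    and "0 < c" "0 < k" "0 < c'" "0 < k'" and \<tau>: "c / k + c' / k' \<le> \<tau>"
  shows "0 \<le> c' * J' * (k' * (J + \<tau> * J') - c' * J')"
    "c / k + c' / k' < \<tau> \<or> c * J' + k * J \<noteq> 0 \<Longrightarrow> 0 < c' * J' * (k' * (J + \<tau> * J') - c' * J')"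
proof -
  obtain f where f: "J = - f * J'" "J' \<noteq> 0" "c / (2 * k) \<le> f" "f \<le> c / k"
    using form2_focal assms(1-4) by blast
  have eq: "c' * J' * (k' * (J + \<tau> * J') - c' * J') = J'\<^sup>2 * (c' * (k' * (\<tau> - f) - c'))"
    unfolding f by (simp add: power2_eq_square algebra_simps)
  have "c' / k' \<le> \<tau> - f" using \<tau> f by simp
  then have "0 \<le> k' * (\<tau> - f) - c'" using assms by (simp add: field_simps)
  then show "0 \<le> c' * J' * (k' * (J + \<tau> * J') - c' * J')" unfolding eq using assms by (intro mult_nonneg_nonneg) auto
  assume s: "c / k + c' / k' < \<tau> \<or> c * J' + k * J \<noteq> 0"
  have "c * J' + k * J = J' * (c - k * f)" unfolding f by (simp add: algebra_simps)
  moreover have "c - k * f = 0 \<longleftrightarrow> f = c / k" using assms by (auto simp: field_simps)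
  ultimately have "c / k + c' / k' < \<tau> \<or> f \<noteq> c / k" using s by auto
  then have "c' / k' < \<tau> - f" using \<tau> f by auto
  then have "0 < k' * (\<tau> - f) - c'" using assms by (simp add: field_simps)
  then show "0 < c' * J' * (k' * (J + \<tau> * J') - c' * J')" unfolding eq using assms f by (intro mult_pos_pos) auto
qed

section \<open>Walls as plane curves\<close>

lemma inner_rotate: "(z::complex) \<bullet> (\<i> * z) = 0" "(\<i> * z) \<bullet> z = 0"
  by (simp_all add: inner_complex_def)

lemma inner_unit:
  assumes "norm e = 1"
  shows "(e * z) \<bullet> e = Re z" "(e * z) \<bullet> (\<i> * e) = Im z"
proof -
  have e: "(Re e)\<^sup>2 + (Im e)\<^sup>2 = 1" using assms complex_norm1_eq by blast
  have "(e * z) \<bullet> e = ((Re e)\<^sup>2 + (Im e)\<^sup>2) * Re z" "(e * z) \<bullet> (\<i> * e) = ((Re e)\<^sup>2 + (Im e)\<^sup>2) * Im z"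
    by (simp_all add: inner_complex_def power2_eq_square algebra_simps)
  then show "(e * z) \<bullet> e = Re z" "(e * z) \<bullet> (\<i> * e) = Im z" by (simp_all only: e)
qed

definition along :: "wall \<Rightarrow> complex \<Rightarrow> real" where
  "along w q = (q - src w) \<bullet> sgn (dst w - src w)"

definition across :: "wall \<Rightarrow> complex \<Rightarrow> real" where
  "across w q = (q - src w) \<bullet> (\<i> * sgn (dst w - src w))"

context
  fixes w :: wall
  assumes nondeg: "src w \<noteq> dst w" and minor: "\<bar>curv w\<bar> * dist (src w) (dst w) \<le> 2"
begin

lemma half_turn_arcsin:
  "sin (half_turn w) = curv w * dist (src w) (dst w) / 2"
  "\<bar>half_turn w\<bar> \<le> pi/2" "0 \<le> cos (half_turn w)"
proof -
  have "\<bar>curv w * dist (src w) (dst w) / 2\<bar> \<le> 1"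
    using minor by (simp add: abs_mult)
  then have b: "-1 \<le> curv w * dist (src w) (dst w) / 2" "curv w * dist (src w) (dst w) / 2 \<le> 1"
    by linarith+
  then show "sin (half_turn w) = curv w * dist (src w) (dst w) / 2"
    by (simp add: half_turn_def del: divide_le_eq_1 divide_le_0_iff)
  have "- (pi/2) \<le> half_turn w" "half_turn w \<le> pi/2"
    unfolding half_turn_def using arcsin_bounded[OF b] by auto
  then show "\<bar>half_turn w\<bar> \<le> pi/2" "0 \<le> cos (half_turn w)"
    by (auto intro: cos_ge_zero)
qed

lemma half_turn_sgn: "curv w \<noteq> 0 \<Longrightarrow> sgn (half_turn w) = sgn (curv w)"
proof -
  assume k: "curv w \<noteq> 0"
  have d: "0 < dist (src w) (dst w)" using nondeg by simp
  have "half_turn w > 0 \<longleftrightarrow> 0 < sin (half_turn w)" "half_turn w < 0 \<longleftrightarrow> sin (half_turn w) < 0"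
    using half_turn_arcsin(2) sin_gt_zero[of "half_turn w"] sin_gt_zero[of "- half_turn w"]
    by (cases "half_turn w" "0::real" rule: linorder_cases; force)+
  then show ?thesis
    using k d by (auto simp: half_turn_arcsin(1) sgn_if zero_less_mult_iff mult_less_0_iff)
qed

lemma side_coordinates:
  "side w q = curv w * (dist (src w) (dst w) * along w q - (along w q)\<^sup>2 - (across w q)\<^sup>2)
     + 2 * cos (half_turn w) * across w q"
proof -
  let ?e = "sgn (dst w - src w)"
  have e: "norm ?e = 1" using nondeg by (simp add: norm_sgn)
  have q: "q - src w = along w q *\<^sub>R ?e + across w q *\<^sub>R (\<i> * ?e)"
    using orthonormal_expansion[OF e] by (simp add: along_def across_def)
  have n: "wall_normal w 0 = cos (half_turn w) *\<^sub>R (\<i> * ?e) + sin (half_turn w) *\<^sub>R ?e"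
  proof -
    have "cis (- half_turn w) = of_real (cos (half_turn w)) - \<i> * of_real (sin (half_turn w))"
      by (simp add: complex_eq_iff)
    then show ?thesis
      by (simp add: wall_normal_def wall_tangent_def scaleR_conv_of_real right_diff_distrib)
        (simp add: algebra_simps)
  qed
  have ee: "?e \<bullet> ?e = 1" "?e \<bullet> (\<i> * ?e) = 0" "(\<i> * ?e) \<bullet> ?e = 0" "(\<i> * ?e) \<bullet> (\<i> * ?e) = 1"
    using e by (simp_all add: dot_square_norm norm_mult inner_rotate)
  have "(q - src w) \<bullet> wall_normal w 0 = along w q * sin (half_turn w) + across w q * cos (half_turn w)"
    unfolding q n by (simp add: ee inner_add_left inner_add_right)
  moreover have "(norm (q - src w))\<^sup>2 = (along w q)\<^sup>2 + (across w q)\<^sup>2"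
    unfolding dot_square_norm[symmetric] q by (simp add: ee inner_add_left inner_add_right power2_eq_square)
  ultimately show ?thesis
    by (simp add: side_def half_turn_arcsin(1) algebra_simps)
qed

lemma coordinates_inject: "along w p = along w q \<Longrightarrow> across w p = across w q \<Longrightarrow> p = q"
proof -
  let ?e = "sgn (dst w - src w)"
  assume a: "along w p = along w q" "across w p = across w q"
  have e: "norm ?e = 1" using nondeg by (simp add: norm_sgn)
  have "p - src w = q - src w"
    using a orthonormal_expansion[OF e, of "p - src w"] orthonormal_expansion[OF e, of "q - src w"]
    by (simp add: along_def across_def)
  then show "p = q" by simp
qed

lemma wall_point_coordinates:
  "curv w * along w (wall_point w t) = sin (curv w * t - half_turn w) + sin (half_turn w)"
  "curv w * across w (wall_point w t) = cos (half_turn w) - cos (curv w * t - half_turn w)"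
proof -
  let ?e = "sgn (dst w - src w)" and ?z = "cis (curv w * t - half_turn w) - cis (- half_turn w)"
  have e: "norm ?e = 1" using nondeg by (simp add: norm_sgn)
  have *: "curv w *\<^sub>R (wall_point w t - src w) = ?e * (- \<i> * ?z)"
    by (cases "curv w = 0") (simp_all add: wall_point_def wall_tangent_def scaleR_conv_of_real field_simps)
  have "curv w * along w (wall_point w t) = (?e * (- \<i> * ?z)) \<bullet> ?e"
    unfolding along_def *[symmetric] by simp
  then show "curv w * along w (wall_point w t) = sin (curv w * t - half_turn w) + sin (half_turn w)"
    unfolding inner_unit[OF e] by simp
  have "curv w * across w (wall_point w t) = (?e * (- \<i> * ?z)) \<bullet> (\<i> * ?e)"
    unfolding across_def *[symmetric] by simp
  then show "curv w * across w (wall_point w t) = cos (half_turn w) - cos (curv w * t - half_turn w)"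
    unfolding inner_unit[OF e] by simp
qed

text \<open>\<open>curv w * t - half_turn w\<close> is the angle from the chord to the tangent.
  Absolute values treat both signs of the curvature at once.\<close>

lemma arc_angle:
  assumes k: "curv w \<noteq> 0"
  shows "t \<in> {0..wall_length w} \<longleftrightarrow> \<bar>curv w * t - half_turn w\<bar> \<le> \<bar>half_turn w\<bar>"
    "t \<in> {0<..<wall_length w} \<longleftrightarrow> \<bar>curv w * t - half_turn w\<bar> < \<bar>half_turn w\<bar>"
proof -
  let ?k = "curv w" and ?f = "half_turn w"
  consider "0 < ?k" "0 < ?f" | "?k < 0" "?f < 0"
    using half_turn_sgn[OF k] k by (auto simp: sgn_if split: if_splits)
  then have "(t \<in> {0..wall_length w} \<longleftrightarrow> \<bar>?k * t - ?f\<bar> \<le> \<bar>?f\<bar>) \<and>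
    (t \<in> {0<..<wall_length w} \<longleftrightarrow> \<bar>?k * t - ?f\<bar> < \<bar>?f\<bar>)"
  proof cases
    case 1
    have t: "0 \<le> t \<longleftrightarrow> 0 \<le> ?k * t" "0 < t \<longleftrightarrow> 0 < ?k * t"
      using 1 by (simp_all add: zero_le_mult_iff zero_less_mult_iff)
    have L: "t \<le> wall_length w \<longleftrightarrow> ?k * t \<le> 2 * ?f" "t < wall_length w \<longleftrightarrow> ?k * t < 2 * ?f"
      using 1 by (simp_all add: wall_length_def field_simps)
    show ?thesis unfolding atLeastAtMost_iff greaterThanLessThan_iff t L using \<open>0 < ?f\<close> by linarith
  next
    case 2
    have t: "0 \<le> t \<longleftrightarrow> ?k * t \<le> 0" "0 < t \<longleftrightarrow> ?k * t < 0"
      using 2 by (simp_all add: mult_le_0_iff mult_less_0_iff)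
    have L: "t \<le> wall_length w \<longleftrightarrow> 2 * ?f \<le> ?k * t" "t < wall_length w \<longleftrightarrow> 2 * ?f < ?k * t"
      using 2 by (simp_all add: wall_length_def field_simps)
    show ?thesis unfolding atLeastAtMost_iff greaterThanLessThan_iff t L using \<open>?f < 0\<close> by linarith
  qed
  then show "t \<in> {0..wall_length w} \<longleftrightarrow> \<bar>?k * t - ?f\<bar> \<le> \<bar>?f\<bar>"
    "t \<in> {0<..<wall_length w} \<longleftrightarrow> \<bar>?k * t - ?f\<bar> < \<bar>?f\<bar>" by auto
qed

lemma wall_length_positive: "0 < wall_length w"
  using half_turn_sgn nondeg
  by (cases "curv w" "0::real" rule: linorder_cases)
    (auto simp: wall_length_def zero_less_divide_iff sgn_if split: if_splits)

lemma wall_point_straight: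
  assumes "curv w = 0"
  shows "along w (wall_point w t) = t" "across w (wall_point w t) = 0" "wall_length w = dist (src w) (dst w)"
proof -
  let ?e = "sgn (dst w - src w)"
  have e: "?e \<bullet> ?e = 1" using nondeg by (simp add: dot_square_norm norm_sgn)
  have "wall_point w t - src w = t *\<^sub>R ?e"
    using assms by (simp add: wall_point_def wall_tangent_def half_turn_def)
  then show "along w (wall_point w t) = t" "across w (wall_point w t) = 0"
    using e by (simp_all add: along_def across_def inner_rotate)
qed (use assms in \<open>simp add: wall_length_def\<close>)

lemma wall_point_inj: "inj_on (wall_point w) {0..wall_length w}"
proof (rule inj_onI)
  fix t u assume t: "t \<in> {0..wall_length w}" "u \<in> {0..wall_length w}" and eq: "wall_point w t = wall_point w u"
  show "t = u"
  proof (cases "curv w = 0")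
    case True
    then show ?thesis using wall_point_straight(1) eq by metis
  next
    case False
    have "sin (curv w * t - half_turn w) = sin (curv w * u - half_turn w)"
      using wall_point_coordinates(1)[of t] wall_point_coordinates(1)[of u] eq by simp
    moreover have "\<bar>curv w * t - half_turn w\<bar> \<le> pi/2" "\<bar>curv w * u - half_turn w\<bar> \<le> pi/2"
      using t arc_angle(1)[OF False] half_turn_arcsin(2) by force+
    then have "- (pi/2) \<le> curv w * t - half_turn w" "curv w * t - half_turn w \<le> pi/2"
      "- (pi/2) \<le> curv w * u - half_turn w" "curv w * u - half_turn w \<le> pi/2"
      by linarith+
    ultimately have "curv w * t - half_turn w = curv w * u - half_turn w"
      by (rule sin_inj_pi[of "curv w * t - half_turn w" "curv w * u - half_turn w", rotated 4])
    then show ?thesis using False by simp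
  qed
qed

lemma arc_interior:
  assumes "curv w \<noteq> 0" "t \<in> {0<..<wall_length w}"
  shows "curv w * across w (wall_point w t) < 0"
proof -
  have "\<bar>curv w * t - half_turn w\<bar> < \<bar>half_turn w\<bar>" using assms arc_angle by blast
  then have "cos \<bar>half_turn w\<bar> < cos \<bar>curv w * t - half_turn w\<bar>"
    using half_turn_arcsin(2) pi_gt_zero by (intro cos_monotone_0_pi) linarith+
  then show ?thesis using wall_point_coordinates(2)[of t] by simp
qed

text \<open>Scaled by the curvature about its centre, the circle becomes the unit circle and the
  chord lies at height \<open>cos (half_turn w)\<close>. Since the cosine decreases in the absolute
  angle up to pi/2, a minor arc is exactly the cap beyond its chord.\<close>

lemma mem_arc:
  assumes k: "curv w \<noteq> 0"
  shows "q \<in> wall_point w ` {0..wall_length w} \<longleftrightarrow> side w q = 0 \<and> curv w * across w q \<le> 0"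
proof safe
  fix t assume t: "t \<in> {0..wall_length w}"
  show "side w (wall_point w t) = 0" by (rule side_wall_point_0[OF nondeg])
  have "\<bar>curv w * t - half_turn w\<bar> \<le> \<bar>half_turn w\<bar>" using t arc_angle[OF k] by blast
  then have "cos \<bar>half_turn w\<bar> \<le> cos \<bar>curv w * t - half_turn w\<bar>"
    using half_turn_arcsin(2) pi_gt_zero by (intro cos_monotone_0_pi_le) linarith+
  then show "curv w * across w (wall_point w t) \<le> 0" using wall_point_coordinates(2)[of t] by simp
next
  assume q: "side w q = 0" "curv w * across w q \<le> 0"
  let ?k = "curv w" and ?f = "half_turn w"
  \<comment> \<open>The scaled coordinates, to be recognized as sine and cosine of the angle of the
    tangent.\<close>
  define X Y where "X = ?k * along w q - sin ?f" and "Y = cos ?f - ?k * across w q"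
  have "?k * side w q = 2 * sin ?f * (?k * along w q) - (?k * along w q)\<^sup>2 - (?k * across w q)\<^sup>2
      + 2 * cos ?f * (?k * across w q)"
    unfolding side_coordinates half_turn_arcsin(1) by (simp add: power2_eq_square algebra_simps)
  also have "\<dots> = (sin ?f)\<^sup>2 + (cos ?f)\<^sup>2 - (X\<^sup>2 + Y\<^sup>2)"
    by (simp add: X_def Y_def power2_eq_square algebra_simps del: sin_cos_squared_add sin_cos_squared_add2)
  finally have XY: "X\<^sup>2 + Y\<^sup>2 = 1" using q by simp
  have Y: "cos ?f \<le> Y" "0 \<le> Y" using q half_turn_arcsin(3) by (auto simp: Y_def)
  have "X\<^sup>2 \<le> 1" using XY zero_le_power2[of Y] by linarith
  then have X: "-1 \<le> X" "X \<le> 1" using abs_square_le_1 by (auto simp: abs_le_iff)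
  define \<theta> where "\<theta> = arcsin X"
  have s: "sin \<theta> = X" using X by (simp add: \<theta>_def)
  have "cos \<theta> = sqrt (1 - X\<^sup>2)" using X by (simp add: \<theta>_def cos_arcsin)
  also have "1 - X\<^sup>2 = Y\<^sup>2" using XY by simp
  finally have c: "cos \<theta> = Y" using Y by simp
  have \<theta>: "\<bar>\<theta>\<bar> \<le> pi/2" using arcsin_bounded[OF X] by (auto simp: \<theta>_def abs_le_iff)
  have "\<bar>\<theta>\<bar> \<le> \<bar>?f\<bar>"
  proof (rule ccontr)
    assume "\<not> \<bar>\<theta>\<bar> \<le> \<bar>?f\<bar>"
    then have "cos \<bar>\<theta>\<bar> < cos \<bar>?f\<bar>" using \<theta> pi_gt_zero by (intro cos_monotone_0_pi) linarith+
    then show False using c Y by simp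
  qed
  moreover define t where "t = (\<theta> + ?f) / ?k"
  moreover have kt: "?k * t - ?f = \<theta>" using k by (simp add: t_def)
  ultimately have t: "t \<in> {0..wall_length w}" unfolding arc_angle(1)[OF k] by simp
  have "?k * along w (wall_point w t) = ?k * along w q" "?k * across w (wall_point w t) = ?k * across w q"
    unfolding wall_point_coordinates kt s c by (simp_all add: X_def Y_def)
  then have "q = wall_point w t" using k by (intro coordinates_inject) auto
  then show "q \<in> wall_point w ` {0..wall_length w}" using t by blast
qed

lemma mem_straight:
  assumes k: "curv w = 0"
  shows "q \<in> wall_point w ` {0..wall_length w} \<longleftrightarrow>
    across w q = 0 \<and> 0 \<le> along w q \<and> along w q \<le> dist (src w) (dst w)"
proof safe
  assume q: "across w q = 0" "0 \<le> along w q" "along w q \<le> dist (src w) (dst w)"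
  have "q = wall_point w (along w q)"
    using q(1) by (intro coordinates_inject) (simp_all add: wall_point_straight[OF k])
  then show "q \<in> wall_point w ` {0..wall_length w}"
    using q(2,3) wall_point_straight(3)[OF k] by auto
qed (use wall_point_straight[OF k] in auto)

end

section \<open>The table\<close>

lemma sgn_Complex:
  assumes "0 < r"
  shows "sgn (Complex r 0) = 1" "sgn (Complex (- r) 0) = - 1" "sgn (Complex 0 r) = \<i>" "sgn (Complex 0 (- r)) = - \<i>"
  using assms by (simp_all add: complex_eq_iff Re_sgn Im_sgn norm_complex_def)

text \<open>
  In coordinates along and across the chord: a disc whose chord subtends less than a right angle
  lies, on the inner side of the chord, inside the isosceles right triangle over the chord.
\<close>

lemma lens:
  fixes k c \<xi> \<eta> :: real
  assumes "k < 0" "- k < 2 * c" "k * (\<xi> - \<xi>\<^sup>2 - \<eta>\<^sup>2) + 2 * c * \<eta> \<le> 0" "0 < \<eta>"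
  shows "\<eta> < \<xi>" "\<eta> < 1 - \<xi>"
proof -
  have *: "(- k) * (\<xi> * (1 - \<xi>)) \<ge> (- k) * \<eta>\<^sup>2 + 2 * c * \<eta>"
    using assms(3) by (simp add: algebra_simps power2_eq_square)
  have "2 * c * \<eta> > (- k) * \<eta>" using assms(2,4) by (rule mult_strict_right_mono)
  with * have "(- k) * (\<xi> * (1 - \<xi>)) > (- k) * (\<eta>\<^sup>2 + \<eta>)" by (simp add: algebra_simps)
  then have **: "\<xi> * (1 - \<xi>) > \<eta>\<^sup>2 + \<eta>" using assms(1) by (metis mult_less_cancel_left_pos neg_0_less_iff_less)
  show "\<eta> < \<xi>"
  proof (rule ccontr)
    assume "\<not> \<eta> < \<xi>"
    have "\<xi> * (1 - \<xi>) \<le> \<xi>" by (simp add: algebra_simps)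
    then show False using ** \<open>\<not> \<eta> < \<xi>\<close> assms zero_le_power2[of \<eta>] by linarith
  qed
  show "\<eta> < 1 - \<xi>"
  proof (rule ccontr)
    assume "\<not> \<eta> < 1 - \<xi>"
    have "\<xi> * (1 - \<xi>) = (1 - \<xi>) - (1 - \<xi>)\<^sup>2" by (simp add: power2_eq_square algebra_simps)
    then show False using ** \<open>\<not> \<eta> < 1 - \<xi>\<close> zero_le_power2[of \<eta>] zero_le_power2[of "1 - \<xi>"] by linarith
  qed
qed

locale strip_table =
  fixes kd h kf l :: real
  assumes kd: "- sqrt 2 < kd" "kd < 0" and h: "0 < h" and kf: "0 < kf" "kf \<le> 2" and l: "0 < l"
begin

abbreviation W :: "wall list" where "W \<equiv> table kd h kf l"

text \<open>The power with respect to a dispersing circle in the coordinates along and across its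
  chord. The three dispersing arcs are congruent with chords of length 1, so one function serves
  them all.\<close>

definition dispersing_side :: "real \<Rightarrow> real \<Rightarrow> real" where
  "dispersing_side \<xi> \<eta> = kd * (\<xi> - \<xi>\<^sup>2 - \<eta>\<^sup>2) + 2 * cos (arcsin (kd / 2)) * \<eta>"

definition focusing_side :: "real \<Rightarrow> real \<Rightarrow> real" where
  "focusing_side \<xi> \<eta> = kf * (\<xi> - \<xi>\<^sup>2 - \<eta>\<^sup>2) + 2 * cos (arcsin (kf / 2)) * \<eta>"

text \<open>The table is written as a union of three overlapping open sets. The upper piece contains
  the open central rectangle, the strip piece runs across it, and the lower piece reaches from the
  focusing arc into it, so that the segments that are not walls consist of interior points.\<close>

definition upper_domain :: "complex set" where
  "upper_domain = {q. 0 < Re q \<and> Re q < 1 \<and> 0 < Im q \<and> Im q < 1 + h \<and>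
     0 < dispersing_side (Im q - h) (1 - Re q) \<and> 0 < dispersing_side (1 - Re q) (1 + h - Im q) \<and>
     0 < dispersing_side (1 + h - Im q) (Re q)}"

definition strip_domain :: "complex set" where
  "strip_domain = {q. - l < Re q \<and> Re q < 1 + l \<and> 0 < Im q \<and> Im q < h}"

definition lower_domain :: "complex set" where
  "lower_domain = {q. 0 < focusing_side (Re q) (Im q) \<and> 0 < Re q \<and> Re q < 1 \<and> Im q < h}"

definition domain :: "complex set" where
  "domain = upper_domain \<union> strip_domain \<union> lower_domain"

lemma abs_kd: "\<bar>kd\<bar> \<le> 2"
proof -
  have "sqrt 2 \<le> 2" by (rule real_le_lsqrt) simp_all
  then show ?thesis using kd by simp
qed

text \<open>The bound - sqrt 2 < kd enters here: the half turn of a dispersing arc is smaller than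
  pi/4 in absolute value, so its cosine exceeds its absolute sine. By \<open>lens\<close> each arc
  then stays in the right isosceles triangle over its side of the square, which keeps the three arcs
  apart.\<close>

lemma cos_kd: "- kd < 2 * cos (arcsin (kd / 2))"
proof -
  have b: "-1 \<le> kd / 2" "kd / 2 \<le> 1" using abs_kd by auto
  have c: "cos (arcsin (kd / 2)) = sqrt (1 - (kd / 2)\<^sup>2)" using b by (simp add: cos_arcsin)
  have "(- kd)\<^sup>2 < (sqrt 2)\<^sup>2" using kd by (intro power_strict_mono) auto
  then have "kd\<^sup>2 < 2" by simp
  then have "(- kd / 2)\<^sup>2 < 1 - (kd / 2)\<^sup>2" by (simp add: power_divide)
  then have "- kd / 2 < sqrt (1 - (kd / 2)\<^sup>2)" by (rule real_less_rsqrt)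
  then show ?thesis unfolding c by simp
qed

lemma cos_kf: "0 \<le> cos (arcsin (kf / 2))"
  using kf arcsin_bounded[of "kf / 2"] by (intro cos_ge_zero) auto

lemma dispersing_lens:
  "dispersing_side \<xi> \<eta> \<le> 0 \<Longrightarrow> 0 < \<eta> \<Longrightarrow> \<eta> < \<xi> \<and> \<eta> < 1 - \<xi>"
  using lens[OF kd(2) cos_kd, of \<xi> \<eta>] by (simp add: dispersing_side_def)

lemma dispersing_side_chord:
  "dispersing_side \<xi> 0 \<le> 0 \<longleftrightarrow> 0 \<le> \<xi> \<and> \<xi> \<le> 1"
proof -
  have "dispersing_side \<xi> 0 = kd * (\<xi> * (1 - \<xi>))"
    by (simp add: dispersing_side_def power2_eq_square algebra_simps)
  then show ?thesis using kd by (auto simp: mult_le_0_iff zero_le_mult_iff)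
qed

lemma dispersing_side_nonpos:
  assumes "dispersing_side \<xi> \<eta> \<le> 0" "0 \<le> \<eta>"
  shows "0 \<le> \<xi>" "\<xi> \<le> 1" "2 * \<eta> < 1"
  using assms dispersing_lens[of \<xi> \<eta>] dispersing_side_chord[of \<xi>] by (cases "\<eta> = 0"; force)+

lemma focusing_side_chord: "0 < focusing_side \<xi> 0 \<longleftrightarrow> 0 < \<xi> \<and> \<xi> < 1"
proof -
  have "focusing_side \<xi> 0 = kf * (\<xi> * (1 - \<xi>))"
    by (simp add: focusing_side_def power2_eq_square algebra_simps)
  then show ?thesis using kf by (auto simp: zero_less_mult_iff)
qed

lemma focusing_side_pos:
  assumes "0 < focusing_side \<xi> \<eta>" "\<eta> \<le> 0"
  shows "0 < \<xi>" "\<xi> < 1" "- 1 < \<eta>"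
proof -
  have "2 * cos (arcsin (kf / 2)) * \<eta> \<le> 0" using assms(2) cos_kf by (simp add: mult_nonneg_nonpos)
  then have "0 < kf * (\<xi> - \<xi>\<^sup>2 - \<eta>\<^sup>2)" using assms(1) unfolding focusing_side_def by linarith
  then have "0 < \<xi> - \<xi>\<^sup>2 - \<eta>\<^sup>2" using kf by (simp add: zero_less_mult_iff)
  then have *: "\<eta>\<^sup>2 < \<xi> * (1 - \<xi>)" by (simp add: power2_eq_square right_diff_distrib)
  then have "0 < \<xi> * (1 - \<xi>)" using zero_le_power2[of \<eta>] by linarith
  then show 1: "0 < \<xi>" "\<xi> < 1" by (auto simp: zero_less_mult_iff)
  have "\<xi> * (1 - \<xi>) \<le> 1 * 1" using 1 by (intro mult_mono) auto
  then have "\<eta>\<^sup>2 < 1" using * by simp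
  then show "- 1 < \<eta>" using abs_square_less_1[of \<eta>] by (simp add: abs_less_iff)
qed

section \<open>The walls in coordinates\<close>

lemma length_table: "length W = 10"
  by (simp add: table_def)

lemma nth_table:
  "W ! 0 = Wall (Complex 0 0) (Complex 1 0) kf"
  "W ! 1 = Wall (Complex 1 0) (Complex (1 + l) 0) 0"
  "W ! 2 = Wall (Complex (1 + l) 0) (Complex (1 + l) h) 0"
  "W ! 3 = Wall (Complex (1 + l) h) (Complex 1 h) 0"
  "W ! 4 = Wall (Complex 1 h) (Complex 1 (1 + h)) kd"
  "W ! 5 = Wall (Complex 1 (1 + h)) (Complex 0 (1 + h)) kd"
  "W ! 6 = Wall (Complex 0 (1 + h)) (Complex 0 h) kd"
  "W ! 7 = Wall (Complex 0 h) (Complex (- l) h) 0"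
  "W ! 8 = Wall (Complex (- l) h) (Complex (- l) 0) 0"
  "W ! 9 = Wall (Complex (- l) 0) (Complex 0 0) 0"
  by (simp_all add: table_def)

lemma table_cases:
  assumes "i < length W"
  obtains "i = 0" | "i = 1" | "i = 2" | "i = 3" | "i = 4" | "i = 5" | "i = 6" | "i = 7" | "i = 8" | "i = 9"
proof -
  have "i = 0 \<or> i = 1 \<or> i = 2 \<or> i = 3 \<or> i = 4 \<or> i = 5 \<or> i = 6 \<or> i = 7 \<or> i = 8 \<or> i = 9"
    using assms unfolding length_table by arith
  then show ?thesis using that by blast
qed

lemma dist_table:
  "dist (src (W ! 0)) (dst (W ! 0)) = 1" "dist (src (W ! 1)) (dst (W ! 1)) = l"
  "dist (src (W ! 2)) (dst (W ! 2)) = h" "dist (src (W ! 3)) (dst (W ! 3)) = l"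
  "dist (src (W ! 4)) (dst (W ! 4)) = 1" "dist (src (W ! 5)) (dst (W ! 5)) = 1"
  "dist (src (W ! 6)) (dst (W ! 6)) = 1" "dist (src (W ! 7)) (dst (W ! 7)) = l"
  "dist (src (W ! 8)) (dst (W ! 8)) = h" "dist (src (W ! 9)) (dst (W ! 9)) = l"
  unfolding nth_table using l h by (simp_all add: dist_norm norm_complex_def)

lemma curv_table:
  "curv (W ! 0) = kf" "curv (W ! 1) = 0" "curv (W ! 2) = 0" "curv (W ! 3) = 0" "curv (W ! 4) = kd"
  "curv (W ! 5) = kd" "curv (W ! 6) = kd" "curv (W ! 7) = 0" "curv (W ! 8) = 0" "curv (W ! 9) = 0"
  by (simp_all only: nth_table wall.sel)

lemma proper_table:
  assumes "i < length W"
  shows "src (W ! i) \<noteq> dst (W ! i)" "\<bar>curv (W ! i)\<bar> * dist (src (W ! i)) (dst (W ! i)) \<le> 2"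
proof -
  show "src (W ! i) \<noteq> dst (W ! i)"
    by (rule table_cases[OF assms]) (simp_all only: nth_table, use l h in \<open>simp_all add: complex_eq_iff\<close>)
  show "\<bar>curv (W ! i)\<bar> * dist (src (W ! i)) (dst (W ! i)) \<le> 2"
    by (rule table_cases[OF assms]) (simp_all only: dist_table curv_table, use abs_kd kf in simp_all)
qed

lemma coordinates_table:
  "along (W ! 0) q = Re q" "across (W ! 0) q = Im q"
  "along (W ! 1) q = Re q - 1" "across (W ! 1) q = Im q"
  "along (W ! 2) q = Im q" "across (W ! 2) q = 1 + l - Re q"
  "along (W ! 3) q = 1 + l - Re q" "across (W ! 3) q = h - Im q"
  "along (W ! 4) q = Im q - h" "across (W ! 4) q = 1 - Re q"
  "along (W ! 5) q = 1 - Re q" "across (W ! 5) q = 1 + h - Im q"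
  "along (W ! 6) q = 1 + h - Im q" "across (W ! 6) q = Re q"
  "along (W ! 7) q = - Re q" "across (W ! 7) q = h - Im q"
  "along (W ! 8) q = h - Im q" "across (W ! 8) q = Re q + l"
  "along (W ! 9) q = Re q + l" "across (W ! 9) q = Im q"
proof -
  have "Complex 1 0 - Complex 0 0 = Complex 1 0" "Complex (1 + l) 0 - Complex 1 0 = Complex l 0"
    "Complex (1 + l) h - Complex (1 + l) 0 = Complex 0 h" "Complex 1 h - Complex (1 + l) h = Complex (- l) 0"
    "Complex 1 (1 + h) - Complex 1 h = Complex 0 1" "Complex 0 (1 + h) - Complex 1 (1 + h) = Complex (- 1) 0"
    "Complex 0 h - Complex 0 (1 + h) = Complex 0 (- 1)" "Complex (- l) h - Complex 0 h = Complex (- l) 0"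
    "Complex (- l) 0 - Complex (- l) h = Complex 0 (- h)" "Complex 0 0 - Complex (- l) 0 = Complex l 0"
    by (simp_all add: complex_eq_iff)
  note d = this
  show "along (W ! 0) q = Re q" "across (W ! 0) q = Im q"
  "along (W ! 1) q = Re q - 1" "across (W ! 1) q = Im q"
  "along (W ! 2) q = Im q" "across (W ! 2) q = 1 + l - Re q"
  "along (W ! 3) q = 1 + l - Re q" "across (W ! 3) q = h - Im q"
  "along (W ! 4) q = Im q - h" "across (W ! 4) q = 1 - Re q"
  "along (W ! 5) q = 1 - Re q" "across (W ! 5) q = 1 + h - Im q"
  "along (W ! 6) q = 1 + h - Im q" "across (W ! 6) q = Re q"
  "along (W ! 7) q = - Re q" "across (W ! 7) q = h - Im q"
  "along (W ! 8) q = h - Im q" "across (W ! 8) q = Re q + l"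
  "along (W ! 9) q = Re q + l" "across (W ! 9) q = Im q"
    unfolding along_def across_def nth_table wall.sel d
      sgn_Complex[OF zero_less_one] sgn_Complex[OF l] sgn_Complex[OF h]
    by (simp_all add: inner_complex_def)
qed

lemma side_table:
  "side (W ! 0) q = focusing_side (Re q) (Im q)"
  "side (W ! 1) q = 2 * Im q"
  "side (W ! 2) q = 2 * (1 + l - Re q)"
  "side (W ! 3) q = 2 * (h - Im q)"
  "side (W ! 4) q = dispersing_side (Im q - h) (1 - Re q)"
  "side (W ! 5) q = dispersing_side (1 - Re q) (1 + h - Im q)"
  "side (W ! 6) q = dispersing_side (1 + h - Im q) (Re q)"
  "side (W ! 7) q = 2 * (h - Im q)"
  "side (W ! 8) q = 2 * (Re q + l)"
  "side (W ! 9) q = 2 * Im q"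
proof -
  have *: "side (W ! i) q = curv (W ! i) * (dist (src (W ! i)) (dst (W ! i)) * along (W ! i) q
      - (along (W ! i) q)\<^sup>2 - (across (W ! i) q)\<^sup>2) + 2 * cos (half_turn (W ! i)) * across (W ! i) q"
    if "i < 10" for i
    using side_coordinates[OF proper_table] that by (simp add: length_table)
  note eqs = half_turn_def coordinates_table dist_table curv_table focusing_side_def dispersing_side_def
  show "side (W ! 0) q = focusing_side (Re q) (Im q)"
    using *[of 0] unfolding eqs by simp
  show "side (W ! 1) q = 2 * Im q"
    using *[of 1] unfolding eqs by simp
  show "side (W ! 2) q = 2 * (1 + l - Re q)"
    using *[of 2] unfolding eqs by simp
  show "side (W ! 3) q = 2 * (h - Im q)"
    using *[of 3] unfolding eqs by simp
  show "side (W ! 4) q = dispersing_side (Im q - h) (1 - Re q)"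
    using *[of 4] unfolding eqs by simp
  show "side (W ! 5) q = dispersing_side (1 - Re q) (1 + h - Im q)"
    using *[of 5] unfolding eqs by simp
  show "side (W ! 6) q = dispersing_side (1 + h - Im q) (Re q)"
    using *[of 6] unfolding eqs by simp
  show "side (W ! 7) q = 2 * (h - Im q)"
    using *[of 7] unfolding eqs by simp
  show "side (W ! 8) q = 2 * (Re q + l)"
    using *[of 8] unfolding eqs by simp
  show "side (W ! 9) q = 2 * Im q"
    using *[of 9] unfolding eqs by simp
qed

definition wall_set :: "nat \<Rightarrow> complex set" where
  "wall_set i = wall_point (W ! i) ` {0..wall_length (W ! i)}"

lemma boundary_table: "boundary W = (\<Union>i<10. wall_set i)"
  unfolding boundary_def wall_set_def set_conv_nth length_table by auto

lemma wall_set_iff: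
  "q \<in> wall_set 0 \<longleftrightarrow> focusing_side (Re q) (Im q) = 0 \<and> Im q \<le> 0"
  "q \<in> wall_set 1 \<longleftrightarrow> Im q = 0 \<and> 1 \<le> Re q \<and> Re q \<le> 1 + l"
  "q \<in> wall_set 2 \<longleftrightarrow> Re q = 1 + l \<and> 0 \<le> Im q \<and> Im q \<le> h"
  "q \<in> wall_set 3 \<longleftrightarrow> Im q = h \<and> 1 \<le> Re q \<and> Re q \<le> 1 + l"
  "q \<in> wall_set 4 \<longleftrightarrow> dispersing_side (Im q - h) (1 - Re q) = 0 \<and> Re q \<le> 1"
  "q \<in> wall_set 5 \<longleftrightarrow> dispersing_side (1 - Re q) (1 + h - Im q) = 0 \<and> Im q \<le> 1 + h"
  "q \<in> wall_set 6 \<longleftrightarrow> dispersing_side (1 + h - Im q) (Re q) = 0 \<and> 0 \<le> Re q"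
  "q \<in> wall_set 7 \<longleftrightarrow> Im q = h \<and> - l \<le> Re q \<and> Re q \<le> 0"
  "q \<in> wall_set 8 \<longleftrightarrow> Re q = - l \<and> 0 \<le> Im q \<and> Im q \<le> h"
  "q \<in> wall_set 9 \<longleftrightarrow> Im q = 0 \<and> - l \<le> Re q \<and> Re q \<le> 0"
proof -
  have c: "q \<in> wall_set i \<longleftrightarrow> side (W ! i) q = 0 \<and> curv (W ! i) * across (W ! i) q \<le> 0"
    if "curv (W ! i) \<noteq> 0" "i < 10" for i
    unfolding wall_set_def using that by (intro mem_arc proper_table) (simp_all add: length_table)
  have s: "q \<in> wall_set i \<longleftrightarrow> across (W ! i) q = 0 \<and> 0 \<le> along (W ! i) q \<and>
      along (W ! i) q \<le> dist (src (W ! i)) (dst (W ! i))"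
    if "curv (W ! i) = 0" "i < 10" for i
    unfolding wall_set_def using that by (intro mem_straight proper_table) (simp_all add: length_table)
  note eqs = curv_table coordinates_table side_table dist_table
  show "q \<in> wall_set 0 \<longleftrightarrow> focusing_side (Re q) (Im q) = 0 \<and> Im q \<le> 0"
    using c[of 0] kd kf unfolding eqs by (auto simp: mult_le_0_iff)
  show "q \<in> wall_set 1 \<longleftrightarrow> Im q = 0 \<and> 1 \<le> Re q \<and> Re q \<le> 1 + l"
    using s[of 1] kd kf unfolding eqs by (auto simp: mult_le_0_iff)
  show "q \<in> wall_set 2 \<longleftrightarrow> Re q = 1 + l \<and> 0 \<le> Im q \<and> Im q \<le> h"
    using s[of 2] kd kf unfolding eqs by (auto simp: mult_le_0_iff)
  show "q \<in> wall_set 3 \<longleftrightarrow> Im q = h \<and> 1 \<le> Re q \<and> Re q \<le> 1 + l"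
    using s[of 3] kd kf unfolding eqs by (auto simp: mult_le_0_iff)
  show "q \<in> wall_set 4 \<longleftrightarrow> dispersing_side (Im q - h) (1 - Re q) = 0 \<and> Re q \<le> 1"
    using c[of 4] kd kf unfolding eqs by (auto simp: mult_le_0_iff)
  show "q \<in> wall_set 5 \<longleftrightarrow> dispersing_side (1 - Re q) (1 + h - Im q) = 0 \<and> Im q \<le> 1 + h"
    using c[of 5] kd kf unfolding eqs by (auto simp: mult_le_0_iff)
  show "q \<in> wall_set 6 \<longleftrightarrow> dispersing_side (1 + h - Im q) (Re q) = 0 \<and> 0 \<le> Re q"
    using c[of 6] kd kf unfolding eqs by (auto simp: mult_le_0_iff)
  show "q \<in> wall_set 7 \<longleftrightarrow> Im q = h \<and> - l \<le> Re q \<and> Re q \<le> 0"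
    using s[of 7] kd kf unfolding eqs by (auto simp: mult_le_0_iff)
  show "q \<in> wall_set 8 \<longleftrightarrow> Re q = - l \<and> 0 \<le> Im q \<and> Im q \<le> h"
    using s[of 8] kd kf unfolding eqs by (auto simp: mult_le_0_iff)
  show "q \<in> wall_set 9 \<longleftrightarrow> Im q = 0 \<and> - l \<le> Re q \<and> Re q \<le> 0"
    using s[of 9] kd kf unfolding eqs by (auto simp: mult_le_0_iff)
qed

lemma continuous_sides [continuous_intros]:
  "continuous_on S f \<Longrightarrow> continuous_on S g \<Longrightarrow> continuous_on S (\<lambda>q. dispersing_side (f q) (g q))"
  "continuous_on S f \<Longrightarrow> continuous_on S g \<Longrightarrow> continuous_on S (\<lambda>q. focusing_side (f q) (g q))"
  unfolding dispersing_side_def focusing_side_def by (intro continuous_intros; assumption)+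

section \<open>The domain and its frontier\<close>

lemma table_domain_open: "open domain"
  unfolding domain_def upper_domain_def strip_domain_def lower_domain_def
  by (intro open_Un open_Collect_conj open_Collect_less continuous_intros)

lemma domain_bounds:
  assumes "q \<in> domain"
  shows "- l < Re q" "Re q < 1 + l" "- 1 < Im q" "Im q < 1 + h"
proof -
  note d = assms[unfolded domain_def upper_domain_def strip_domain_def lower_domain_def Un_iff mem_Collect_eq]
  show "- l < Re q" "Re q < 1 + l" "Im q < 1 + h" using d l h by auto
  show "- 1 < Im q"
    using d focusing_side_pos(3)[of "Re q" "Im q"] by (cases "Im q \<le> 0") auto
qed

lemma table_domain_bounded: "bounded domain"
proof (rule boundedI)
  fix q assume "q \<in> domain"
  from domain_bounds[OF this] have "\<bar>Re q\<bar> \<le> 1 + l" "\<bar>Im q\<bar> \<le> 1 + h" using l h by linarith+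
  then show "norm q \<le> (1 + l) + (1 + h)" using cmod_le[of q] by linarith
qed

lemma table_domain_boundary: "domain \<inter> boundary W = {}"
proof -
  have "q \<notin> wall_set i" if q: "q \<in> domain" and i: "i < length W" for q i
  proof -
    note d = q[unfolded domain_def upper_domain_def strip_domain_def lower_domain_def Un_iff mem_Collect_eq]
    note n4 = dispersing_side_nonpos[of "Im q - h" "1 - Re q"]
    note n5 = dispersing_side_nonpos[of "1 - Re q" "1 + h - Im q"]
    note n6 = dispersing_side_nonpos[of "1 + h - Im q" "Re q"]
    show ?thesis
      by (rule table_cases[OF i]; simp only: wall_set_iff; use d n4 n5 n6 l h in force)
  qed
  then show ?thesis unfolding boundary_table using length_table by auto
qed

text \<open>Weak inequalities give a closed set containing the domain. A point of it outside the
  domain satisfies one of them with equality, and this puts it on a wall or on a segment inside the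
  table; points of the latter kind belong to another piece of the domain, as \<open>low\<close>,
  \<open>mid\<close> and \<open>strip\<close> record.\<close>

lemma table_frontier_domain: "frontier domain \<subseteq> boundary W"
proof
  fix q assume q: "q \<in> frontier domain"
  define x y where "x = Re q" and "y = Im q"
  define U where "U = {q. 0 \<le> Re q \<and> Re q \<le> 1 \<and> 0 \<le> Im q \<and> Im q \<le> 1 + h \<and>
     0 \<le> dispersing_side (Im q - h) (1 - Re q) \<and> 0 \<le> dispersing_side (1 - Re q) (1 + h - Im q) \<and>
     0 \<le> dispersing_side (1 + h - Im q) (Re q)}"
  define S where "S = {q. - l \<le> Re q \<and> Re q \<le> 1 + l \<and> 0 \<le> Im q \<and> Im q \<le> h}"
  define B where "B = {q. 0 \<le> focusing_side (Re q) (Im q) \<and> 0 \<le> Re q \<and> Re q \<le> 1 \<and> Im q \<le> h}"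
  have "closed (U \<union> S \<union> B)"
    unfolding U_def S_def B_def by (intro closed_Un closed_Collect_conj closed_Collect_le continuous_intros)
  moreover have "domain \<subseteq> U \<union> S \<union> B"
    by (auto simp: domain_def upper_domain_def strip_domain_def lower_domain_def U_def S_def B_def)
  ultimately have "closure domain \<subseteq> U \<union> S \<union> B" by (intro closure_minimal)
  moreover have "q \<in> closure domain" using q unfolding frontier_def by (rule DiffD1)
  ultimately have cl: "q \<in> U \<union> S \<union> B" by (rule subsetD)
  have nd: "q \<notin> domain" using q table_domain_open by (simp add: frontier_def interior_open)
  have wall: "q \<in> boundary W" if "q \<in> wall_set i" "i < 10" for i
    using that by (auto simp: boundary_table)
  have low: "0 < x \<Longrightarrow> x < 1 \<Longrightarrow> y = 0 \<Longrightarrow> False"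
    using nd focusing_side_chord[of x] h by (auto simp: domain_def lower_domain_def x_def y_def)
  have strip: "- l < x \<Longrightarrow> x < 1 + l \<Longrightarrow> 0 < y \<Longrightarrow> y < h \<Longrightarrow> False"
    using nd by (auto simp: domain_def strip_domain_def x_def y_def)
  have ds: "0 < dispersing_side \<xi> \<eta>" if "\<xi> \<le> 0 \<or> 1 \<le> \<xi> \<or> 1 \<le> \<eta>" "0 < \<eta>" for \<xi> \<eta>
  proof (rule ccontr)
    assume "\<not> 0 < dispersing_side \<xi> \<eta>"
    then show False using dispersing_lens[of \<xi> \<eta>] that by auto
  qed
  have mid: "0 < x \<Longrightarrow> x < 1 \<Longrightarrow> y = h \<Longrightarrow> False"
    using nd ds[of 0 "1 - x"] ds[of "1 - x" 1] ds[of 1 x] h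
    by (auto simp: domain_def upper_domain_def x_def y_def)
  have in_strip: "q \<in> boundary W" if "q \<in> S"
  proof (rule ccontr)
    assume nb: "q \<notin> boundary W"
    have b: "- l \<le> x" "x \<le> 1 + l" "0 \<le> y" "y \<le> h" using that by (simp_all add: S_def x_def y_def)
    have "q \<notin> wall_set 1" "q \<notin> wall_set 2" "q \<notin> wall_set 3" "q \<notin> wall_set 7" "q \<notin> wall_set 8"
        "q \<notin> wall_set 9"
      using nb wall[of 1] wall[of 2] wall[of 3] wall[of 7] wall[of 8] wall[of 9] by auto
    then have n: "\<not> (y = 0 \<and> 1 \<le> x \<and> x \<le> 1 + l)" "\<not> (x = 1 + l \<and> 0 \<le> y \<and> y \<le> h)"
        "\<not> (y = h \<and> 1 \<le> x \<and> x \<le> 1 + l)" "\<not> (y = h \<and> - l \<le> x \<and> x \<le> 0)"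
        "\<not> (x = - l \<and> 0 \<le> y \<and> y \<le> h)" "\<not> (y = 0 \<and> - l \<le> x \<and> x \<le> 0)"
      unfolding wall_set_iff x_def y_def by blast+
    have x: "- l < x" "x < 1 + l" using n(2,5) b by linarith+
    have "y \<noteq> 0" using n(1,6) b low by (meson not_le)
    moreover have "y \<noteq> h" using n(3,4) b mid by (meson not_le)
    ultimately show False using strip[OF x] b by simp
  qed
  consider "q \<in> U" | "q \<in> S" | "q \<in> B" "y \<le> 0" | "q \<in> B" "0 < y" "y \<le> h" 
    using cl by (cases "y \<le> 0") (auto simp: B_def y_def)
  then show "q \<in> boundary W"
  proof cases
    case 1
    show ?thesis
    proof (rule ccontr)
      assume nb: "q \<notin> boundary W"
      have "q \<notin> wall_set 4" "q \<notin> wall_set 5" "q \<notin> wall_set 6" "q \<notin> wall_set 9" "q \<notin> wall_set 1"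
        using nb wall[of 4] wall[of 5] wall[of 6] wall[of 9] wall[of 1] by auto
      then have pos: "0 < dispersing_side (y - h) (1 - x)" "0 < dispersing_side (1 - x) (1 + h - y)"
        "0 < dispersing_side (1 + h - y) x" and corner: "\<not> (y = 0 \<and> (x = 0 \<or> x = 1))"
        using 1 l unfolding wall_set_iff by (auto simp: U_def x_def y_def less_le)
      have b: "0 \<le> x" "x \<le> 1" "0 \<le> y" "y \<le> 1 + h" using 1 by (simp_all add: U_def x_def y_def)
      have "x = 0 \<Longrightarrow> y < h" "x = 1 \<Longrightarrow> y < h" "y \<noteq> 1 + h"
        using pos b dispersing_side_chord[of "1 + h - y"] dispersing_side_chord[of "y - h"]
          dispersing_side_chord[of "1 - x"] by (auto simp: not_le[symmetric])
      then have "0 < x" "x < 1" "y < 1 + h"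
        using strip corner b l by (auto simp: less_le)
      then show False
        using nd pos b low by (auto simp: domain_def upper_domain_def x_def y_def less_le)
    qed
  next
    case 2
    then show ?thesis by (rule in_strip)
  next
    case 3
    show ?thesis
    proof (cases "focusing_side x y = 0")
      case True
      then show ?thesis using wall[of 0] 3 by (simp add: wall_set_iff x_def y_def)
    next
      case False
      then have "0 < focusing_side x y" using 3 by (simp add: B_def x_def y_def)
      from focusing_side_pos[OF this 3(2)] this 3 show ?thesis
        using nd h by (auto simp: domain_def lower_domain_def x_def y_def)
    qed
  next
    case 4
    then have "q \<in> S" using l by (auto simp: B_def S_def x_def y_def)
    then show ?thesis by (rule in_strip)
  qed
qed

text \<open>
  Pairwise disjoint sets containing the walls without their endpoints: convex pieces of the plane or
  the segments themselves.
\<close>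

definition wall_region :: "nat \<Rightarrow> complex set" where
  "wall_region i = {q. let x = Re q; y = Im q in
     [y < 0,
      y = 0 \<and> 1 < x \<and> x < 1 + l,
      x = 1 + l \<and> 0 < y \<and> y < h,
      y = h \<and> 1 < x \<and> x < 1 + l,
      0 < 1 - x \<and> 1 - x < y - h \<and> 1 - x < 1 + h - y,
      0 < 1 + h - y \<and> 1 + h - y < x \<and> 1 + h - y < 1 - x,
      0 < x \<and> x < y - h \<and> x < 1 + h - y,
      y = h \<and> - l < x \<and> x < 0,
      x = - l \<and> 0 < y \<and> y < h,
      y = 0 \<and> - l < x \<and> x < 0] ! i}"

lemma wall_region_iff:
  "q \<in> wall_region 0 \<longleftrightarrow> Im q < 0"
  "q \<in> wall_region 1 \<longleftrightarrow> Im q = 0 \<and> 1 < Re q \<and> Re q < 1 + l"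
  "q \<in> wall_region 2 \<longleftrightarrow> Re q = 1 + l \<and> 0 < Im q \<and> Im q < h"
  "q \<in> wall_region 3 \<longleftrightarrow> Im q = h \<and> 1 < Re q \<and> Re q < 1 + l"
  "q \<in> wall_region 4 \<longleftrightarrow> 0 < 1 - Re q \<and> 1 - Re q < Im q - h \<and> 1 - Re q < 1 + h - Im q"
  "q \<in> wall_region 5 \<longleftrightarrow> 0 < 1 + h - Im q \<and> 1 + h - Im q < Re q \<and> 1 + h - Im q < 1 - Re q"
  "q \<in> wall_region 6 \<longleftrightarrow> 0 < Re q \<and> Re q < Im q - h \<and> Re q < 1 + h - Im q"
  "q \<in> wall_region 7 \<longleftrightarrow> Im q = h \<and> - l < Re q \<and> Re q < 0"
  "q \<in> wall_region 8 \<longleftrightarrow> Re q = - l \<and> 0 < Im q \<and> Im q < h"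
  "q \<in> wall_region 9 \<longleftrightarrow> Im q = 0 \<and> - l < Re q \<and> Re q < 0"
  by (simp_all add: wall_region_def Let_def)

lemma wall_region_disjoint:
  assumes "i < length W" "j < length W" "q \<in> wall_region i" "q \<in> wall_region j"
  shows "i = j"
  using assms(3,4)
  by (rule_tac table_cases[OF assms(1)]; rule_tac table_cases[OF assms(2)]; simp only: wall_region_iff; (use l h in linarith)?)

lemma wall_interior:
  assumes i: "i < length W" and t: "0 < t" "t < wall_length (W ! i)"
  shows "wall_point (W ! i) t \<in> wall_region i"
proof -
  define q where "q = wall_point (W ! i) t"
  have s0: "side (W ! i) q = 0"
    unfolding q_def by (rule side_wall_point_0[OF proper_table(1)[OF i]])
  have arc: "curv (W ! i) \<noteq> 0 \<Longrightarrow> curv (W ! i) * across (W ! i) q < 0"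
    unfolding q_def by (intro arc_interior proper_table i) (use t in auto)
  have straight: "curv (W ! i) = 0 \<Longrightarrow> across (W ! i) q = 0 \<and> 0 < along (W ! i) q \<and>
      along (W ! i) q < dist (src (W ! i)) (dst (W ! i))"
    using wall_point_straight[OF proper_table[OF i]] t unfolding q_def by simp
  note eqs = curv_table coordinates_table side_table dist_table wall_region_iff
  have lens: "0 < \<eta> \<Longrightarrow> dispersing_side \<xi> \<eta> = 0 \<Longrightarrow> \<eta> < \<xi> \<and> \<eta> < 1 - \<xi>" for \<xi> \<eta>
    using dispersing_lens[of \<xi> \<eta>] by simp
  have "q \<in> wall_region i"
  proof (rule table_cases[OF i])
    assume n: "i = 0"
    show ?thesis using arc kf unfolding n eqs by (auto simp: mult_less_0_iff)
  next
    assume n: "i = 1"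
    show ?thesis using straight unfolding n eqs by (auto simp: mult_less_0_iff)
  next
    assume n: "i = 2"
    show ?thesis using straight unfolding n eqs by (auto simp: mult_less_0_iff)
  next
    assume n: "i = 3"
    show ?thesis using straight unfolding n eqs by (auto simp: mult_less_0_iff)
  next
    assume n: "i = 4"
    show ?thesis using s0 arc kd lens[of "1 - Re q" "Im q - h"] unfolding n eqs by (auto simp: mult_less_0_iff)
  next
    assume n: "i = 5"
    show ?thesis using s0 arc kd lens[of "1 + h - Im q" "1 - Re q"] unfolding n eqs by (auto simp: mult_less_0_iff)
  next
    assume n: "i = 6"
    show ?thesis using s0 arc kd lens[of "Re q" "1 + h - Im q"] unfolding n eqs by (auto simp: mult_less_0_iff)
  next
    assume n: "i = 7"
    show ?thesis using straight unfolding n eqs by (auto simp: mult_less_0_iff)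
  next
    assume n: "i = 8"
    show ?thesis using straight unfolding n eqs by (auto simp: mult_less_0_iff)
  next
    assume n: "i = 9"
    show ?thesis using straight unfolding n eqs by (auto simp: mult_less_0_iff)
  qed
  then show ?thesis by (simp add: q_def)
qed

text \<open>Each neighbourhood is chosen to meet no other wall, so that within it the sign of a
  single power decides membership. For a dispersing arc the open triangle over its chord
  serves.\<close>

lemma table_domain_side:
  assumes i: "i < length W" and q: "q \<in> wall_region i"
  shows "\<exists>V. open V \<and> q \<in> V \<and> (\<forall>p\<in>V. p \<in> domain \<longleftrightarrow> 0 < side (W ! i) p)"
proof -
  have regions:
    "wall_region 4 = {q. 0 < 1 - Re q \<and> 1 - Re q < Im q - h \<and> 1 - Re q < 1 + h - Im q}"
    "wall_region 5 = {q. 0 < 1 + h - Im q \<and> 1 + h - Im q < Re q \<and> 1 + h - Im q < 1 - Re q}"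
    "wall_region 6 = {q. 0 < Re q \<and> Re q < Im q - h \<and> Re q < 1 + h - Im q}"
    by (auto simp: wall_region_iff)
  have op: "open {p. Im p < 0}" "open {p. 1 < Re p \<and> Re p < 1 + l \<and> Im p < h}"
    "open {p. 1 < Re p \<and> 0 < Im p \<and> Im p < h}" "open {p. 1 < Re p \<and> Re p < 1 + l \<and> 0 < Im p}"
    "open (wall_region 4)" "open (wall_region 5)" "open (wall_region 6)"
    "open {p. - l < Re p \<and> Re p < 0 \<and> 0 < Im p}"
    "open {p. Re p < 0 \<and> 0 < Im p \<and> Im p < h}" "open {p. - l < Re p \<and> Re p < 0 \<and> Im p < h}"
    unfolding regions by (intro open_Collect_conj open_Collect_less continuous_intros)+
  note dom = domain_def upper_domain_def strip_domain_def lower_domain_def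
  have pos: "0 < dispersing_side \<xi> \<eta>" if "\<xi> \<le> \<eta> \<or> 1 - \<xi> \<le> \<eta>" "0 < \<eta>" for \<xi> \<eta>
  proof (rule ccontr)
    assume "\<not> 0 < dispersing_side \<xi> \<eta>"
    then show False using dispersing_lens[of \<xi> \<eta>] that by auto
  qed
  show ?thesis
  proof (rule table_cases[OF i])
    assume i: "i = 0"
    show ?thesis
      using q h focusing_side_pos unfolding i wall_region_iff side_table
      by (intro exI[of _ "{p. Im p < 0}"] conjI op) (auto simp: dom)
  next
    assume i: "i = 1"
    show ?thesis
      using q h l unfolding i wall_region_iff side_table
      by (intro exI[of _ "{p. 1 < Re p \<and> Re p < 1 + l \<and> Im p < h}"] conjI op) (auto simp: dom)
  next
    assume i: "i = 2"
    show ?thesis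
      using q h l unfolding i wall_region_iff side_table
      by (intro exI[of _ "{p. 1 < Re p \<and> 0 < Im p \<and> Im p < h}"] conjI op) (auto simp: dom)
  next
    assume i: "i = 3"
    show ?thesis
      using q h l unfolding i wall_region_iff side_table
      by (intro exI[of _ "{p. 1 < Re p \<and> Re p < 1 + l \<and> 0 < Im p}"] conjI op) (auto simp: dom)
  next
    assume i: "i = 4"
    have "p \<in> domain \<longleftrightarrow> 0 < dispersing_side (Im p - h) (1 - Re p)" if "p \<in> wall_region 4" for p
    proof -
      have "0 < dispersing_side (1 - Re p) (1 + h - Im p)" "0 < dispersing_side (1 + h - Im p) (Re p)"
        using that by (intro pos; simp only: wall_region_iff; linarith)+
      then show ?thesis using that h by (auto simp: dom wall_region_iff)
    qed
    then show ?thesis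
      using q op(5) unfolding i side_table by blast
  next
    assume i: "i = 5"
    have "p \<in> domain \<longleftrightarrow> 0 < dispersing_side (1 - Re p) (1 + h - Im p)" if "p \<in> wall_region 5" for p
    proof -
      have "0 < dispersing_side (Im p - h) (1 - Re p)" "0 < dispersing_side (1 + h - Im p) (Re p)"
        using that by (intro pos; simp only: wall_region_iff; linarith)+
      then show ?thesis using that h by (auto simp: dom wall_region_iff)
    qed
    then show ?thesis
      using q op(6) unfolding i side_table by blast
  next
    assume i: "i = 6"
    have "p \<in> domain \<longleftrightarrow> 0 < dispersing_side (1 + h - Im p) (Re p)" if "p \<in> wall_region 6" for p
    proof -
      have "0 < dispersing_side (1 - Re p) (1 + h - Im p)" "0 < dispersing_side (Im p - h) (1 - Re p)"
        using that by (intro pos; simp only: wall_region_iff; linarith)+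
      then show ?thesis using that h by (auto simp: dom wall_region_iff)
    qed
    then show ?thesis
      using q op(7) unfolding i side_table by blast
  next
    assume i: "i = 7"
    show ?thesis
      using q h l unfolding i wall_region_iff side_table
      by (intro exI[of _ "{p. - l < Re p \<and> Re p < 0 \<and> 0 < Im p}"] conjI op) (auto simp: dom)
  next
    assume i: "i = 8"
    show ?thesis
      using q h l unfolding i wall_region_iff side_table
      by (intro exI[of _ "{p. Re p < 0 \<and> 0 < Im p \<and> Im p < h}"] conjI op) (auto simp: dom)
  next
    assume i: "i = 9"
    show ?thesis
      using q h l unfolding i wall_region_iff side_table
      by (intro exI[of _ "{p. - l < Re p \<and> Re p < 0 \<and> Im p < h}"] conjI op) (auto simp: dom)
  qed
qed

section \<open>The table as an instance of the general billiard\<close>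

sublocale wall_sequence W
  using wall_length_positive[OF proper_table] by unfold_locales (metis in_set_conv_nth)

lemma non_corner_region:
  assumes "non_corner W s"
  shows "wall_index W s < length W" "point_at W s \<in> wall_region (wall_index W s)"
    "s - offset W (wall_index W s) \<in> {0..wall_length (W ! wall_index W s)}"
proof -
  obtain i where i: "i < length W" "offset W i < s" "s < offset W (Suc i)"
    using assms by (auto simp: non_corner_def)
  have idx: "wall_index W s = i" using i by (intro wall_index_eq) auto
  show "wall_index W s < length W" using i idx by simp
  have t: "0 < s - offset W i" "s - offset W i < wall_length (W ! i)" using i by (simp_all add: offset_def)
  show "point_at W s \<in> wall_region (wall_index W s)"
    unfolding point_at_def wall_at_def idx using wall_interior[OF i(1) t] .
  show "s - offset W (wall_index W s) \<in> {0..wall_length (W ! wall_index W s)}"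
    unfolding idx using t by simp
qed

sublocale billiard W domain
proof
  fix w assume "w \<in> set W"
  then show "src w \<noteq> dst w" using proper_table(1) by (metis in_set_conv_nth)
next
  fix s s' assume s: "non_corner W s" and s': "non_corner W s'" and eq: "point_at W s = point_at W s'"
  note r = non_corner_region[OF s] and r' = non_corner_region[OF s']
  have i: "wall_index W s = wall_index W s'"
    using wall_region_disjoint[OF r(1) r'(1) r(2)] r'(2) eq by simp
  have "s - offset W (wall_index W s) = s' - offset W (wall_index W s)"
    using wall_point_inj[OF proper_table[OF r(1)]] eq r(3) r'(3)
    unfolding point_at_def wall_at_def i by (meson inj_onD)
  then show "s = s'" by simp
next
  show "open domain" "bounded domain" "frontier domain \<subseteq> boundary W" "domain \<inter> boundary W = {}"
    by (fact table_domain_open table_domain_bounded table_frontier_domain table_domain_boundary)+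
next
  fix s assume "non_corner W s"
  from non_corner_region[OF this]
  show "\<exists>V. open V \<and> point_at W s \<in> V \<and> (\<forall>q\<in>V. q \<in> domain \<longleftrightarrow> 0 < side (wall_at W s) q)"
    unfolding wall_at_def by (intro table_domain_side)
qed

end

section \<open>Excursions into the strips\<close>

lemma finite_times:
  fixes b c H :: real
  assumes "b \<noteq> 0" "H > 0"
  shows "finite {t. 0 \<le> t \<and> t \<le> B \<and> (\<exists>m::int. c + b * t = H * of_int m)}"
proof -
  define K where "K = \<lceil>(\<bar>c\<bar> + \<bar>b\<bar> * \<bar>B\<bar>) / H\<rceil>"
  have "{t. 0 \<le> t \<and> t \<le> B \<and> (\<exists>m::int. c + b * t = H * of_int m)} \<subseteq>
      (\<lambda>m. (H * of_int m - c) / b) ` {-K..K}"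
  proof clarify
    fix t and m :: int assume t: "0 \<le> t" "t \<le> B" and m: "c + b * t = H * of_int m"
    have "\<bar>H * of_int m\<bar> \<le> \<bar>c\<bar> + \<bar>b * t\<bar>" unfolding m[symmetric] by (rule abs_triangle_ineq)
    also have "\<bar>b * t\<bar> \<le> \<bar>b\<bar> * \<bar>B\<bar>" using t by (simp add: abs_mult mult_left_mono)
    finally have "H * \<bar>real_of_int m\<bar> \<le> \<bar>c\<bar> + \<bar>b\<bar> * \<bar>B\<bar>" using assms(2) by (simp add: abs_mult)
    then have "\<bar>real_of_int m\<bar> \<le> (\<bar>c\<bar> + \<bar>b\<bar> * \<bar>B\<bar>) / H" using assms(2) by (simp add: field_simps)
    then have "\<bar>real_of_int m\<bar> \<le> real_of_int K" unfolding K_def by (meson le_of_int_ceiling order_trans)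
    then have "m \<in> {-K..K}" by (simp add: abs_le_iff)
    moreover have "t = (H * of_int m - c) / b" using m assms(1) by (simp add: field_simps)
    ultimately show "t \<in> (\<lambda>m. (H * of_int m - c) / b) ` {-K..K}" by blast
  qed
  then show ?thesis by (rule finite_subset) simp
qed

text \<open>A rotation by \<open>\<delta>\<close> of a circle of length \<open>H\<close> comes back
  near its starting point: Dirichlet's approximation theorem for \<open>\<delta> / H\<close>, with a
  denominator bound \<open>N\<close> of at least \<open>H / \<epsilon>\<close>.\<close>

lemma recurrence:
  fixes \<delta> H \<epsilon> :: real
  assumes "H > 0" "\<epsilon> > 0"
  obtains j :: nat and m :: int where "j > 0" "\<bar>real j * \<delta> - H * of_int m\<bar> < \<epsilon>"
proof -
  define N where "N = nat \<lceil>H / \<epsilon>\<rceil>"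
  have "\<lceil>H / \<epsilon>\<rceil> > 0" using assms by simp
  then have N: "N > 0" and HN: "H / \<epsilon> \<le> real N" unfolding N_def by auto
  obtain m k where k: "0 < k" "\<bar>of_int k * (\<delta> / H) - of_int m\<bar> < 1 / real N"
    using Dirichlet_approx[OF N] by metis
  have "\<bar>of_int k * \<delta> - H * of_int m\<bar> = H * \<bar>of_int k * (\<delta> / H) - of_int m\<bar>"
  proof -
    have "of_int k * \<delta> - H * of_int m = H * (of_int k * (\<delta> / H) - of_int m)"
      using assms(1) by (simp add: field_simps)
    then show ?thesis using assms(1) by (simp add: abs_mult)
  qed
  also have "\<dots> < H * (1 / real N)" using k(2) assms(1) by (intro mult_strict_left_mono)
  also have "\<dots> \<le> \<epsilon>" using HN N assms by (simp add: field_simps)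
  finally show ?thesis using that[of "nat k" m] k(1) by simp
qed

text \<open>Reflections in the multiples of \<open>H\<close> only produce maps of the form z -> +- z
  + 2 H m. A coordinate that is reflected there and nowhere else is therefore the image of an
  unreflected linear motion under such a map.\<close>

lemma unfold_reflections:
  fixes \<tau> x v :: "nat \<Rightarrow> real"
  assumes "\<tau> 0 = 0" and step: "\<And>i. x (Suc i) = x i + (\<tau> (Suc i) - \<tau> i) * v i"
    and reflect: "\<And>i. v (Suc i) = v i \<or> v (Suc i) = - v i \<and> (\<exists>m::int. x (Suc i) = H * of_int m)"
  shows "\<exists>\<sigma> m::int. \<bar>\<sigma>\<bar> = 1 \<and> v i = of_int \<sigma> * v 0 \<and>
    x i = of_int \<sigma> * (x 0 + v 0 * \<tau> i) + 2 * H * of_int m"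
proof (induction i)
  case 0
  show ?case using assms(1) by (intro exI[of _ 1] exI[of _ 0]) simp
next
  case (Suc i)
  then obtain \<sigma> m :: int where \<sigma>: "\<bar>\<sigma>\<bar> = 1" "v i = of_int \<sigma> * v 0"
    "x i = of_int \<sigma> * (x 0 + v 0 * \<tau> i) + 2 * H * of_int m" by blast
  have x: "x (Suc i) = of_int \<sigma> * (x 0 + v 0 * \<tau> (Suc i)) + 2 * H * of_int m"
    unfolding step \<sigma>(2,3) by (simp add: algebra_simps)
  from reflect[of i] show ?case
  proof
    assume "v (Suc i) = v i"
    then show ?thesis using \<sigma> x by (intro exI[of _ \<sigma>] exI[of _ m]) simp
  next
    assume "v (Suc i) = - v i \<and> (\<exists>m::int. x (Suc i) = H * of_int m)"
    then obtain c :: int where c: "v (Suc i) = - v i" "x (Suc i) = H * of_int c" by blast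
    have "of_int (- \<sigma>) * (x 0 + v 0 * \<tau> (Suc i)) + 2 * H * of_int (c - m) =
        2 * (H * of_int c) - (of_int \<sigma> * (x 0 + v 0 * \<tau> (Suc i)) + 2 * H * of_int m)"
      by (simp add: algebra_simps)
    also have "\<dots> = x (Suc i)" unfolding x[symmetric] c(2)[symmetric] by simp
    finally show ?thesis using \<sigma> c(1) by (intro exI[of _ "- \<sigma>"] exI[of _ "c - m"]) simp
  qed
qed

context strip_table
begin

lemma curved_state:
  assumes "regular W y" "curv_at W (fst y) \<noteq> 0"
  defines "q \<equiv> point_at W (fst y)"
  shows "0 < Re q" "Re q < 1" "curv_at W (fst y) = kf \<and> Im q < 0 \<or> curv_at W (fst y) = kd \<and> h < Im q"
proof -
  define i where "i = wall_index W (fst y)"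
  have nc: "non_corner W (fst y)" using assms by (simp add: regular_def)
  note r = non_corner_region[OF nc, folded i_def q_def]
  have k: "curv_at W (fst y) = curv (W ! i)" by (simp add: curv_at_def wall_at_def i_def)
  have s: "side (W ! i) q = 0"
    unfolding q_def point_at_def wall_at_def i_def[symmetric] by (rule side_wall_point_0[OF proper_table(1)[OF r(1)]])
  have "0 < Re q \<and> Re q < 1 \<and> (curv (W ! i) = kf \<and> Im q < 0 \<or> curv (W ! i) = kd \<and> h < Im q)"
  proof (rule table_cases[OF r(1)])
    assume n: "i = 0"
    have y: "Im q < 0" using r(2) unfolding n wall_region_iff .
    have "2 * cos (arcsin (kf / 2)) * Im q \<le> 0" using y cos_kf by (simp add: mult_nonneg_nonpos)
    then have "0 \<le> kf * (Re q - (Re q)\<^sup>2 - (Im q)\<^sup>2)"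
      using s unfolding n side_table focusing_side_def by linarith
    then have "0 \<le> Re q - (Re q)\<^sup>2 - (Im q)\<^sup>2" using kf by (simp add: zero_le_mult_iff)
    moreover have "0 < (Im q)\<^sup>2" using y by simp
    ultimately have "0 < Re q * (1 - Re q)" by (simp add: power2_eq_square algebra_simps)
    then have "0 < Re q \<and> Re q < 1" by (auto simp: zero_less_mult_iff)
    then show ?thesis using y unfolding n curv_table by simp
  qed (use r(2) assms(2) in \<open>simp_all only: k wall_region_iff curv_table, auto\<close>)
  then show "0 < Re q" "Re q < 1" "curv_at W (fst y) = kf \<and> Im q < 0 \<or> curv_at W (fst y) = kd \<and> h < Im q"
    by (simp_all add: k)
qed

lemma flat_normal:
  "wall_normal (W ! 1) t = \<i>" "wall_normal (W ! 2) t = - 1" "wall_normal (W ! 3) t = - \<i>"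
  "wall_normal (W ! 7) t = - \<i>" "wall_normal (W ! 8) t = 1" "wall_normal (W ! 9) t = \<i>"
proof -
  have "Complex (1 + l) 0 - Complex 1 0 = Complex l 0"
    "Complex (1 + l) h - Complex (1 + l) 0 = Complex 0 h" "Complex 1 h - Complex (1 + l) h = Complex (- l) 0"
    "Complex (- l) h - Complex 0 h = Complex (- l) 0"
    "Complex (- l) 0 - Complex (- l) h = Complex 0 (- h)" "Complex 0 0 - Complex (- l) 0 = Complex l 0"
    by (simp_all add: complex_eq_iff)
  note d = this
  show "wall_normal (W ! 1) t = \<i>" "wall_normal (W ! 2) t = - 1" "wall_normal (W ! 3) t = - \<i>"
    "wall_normal (W ! 7) t = - \<i>" "wall_normal (W ! 8) t = 1" "wall_normal (W ! 9) t = \<i>"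
    unfolding wall_normal_def wall_tangent_def half_turn_def nth_table wall.sel d
      sgn_Complex[OF l] sgn_Complex[OF h] by simp_all
qed

lemma flat_state:
  assumes "regular W y" "curv_at W (fst y) = 0"
  defines "q \<equiv> point_at W (fst y)" and "n \<equiv> normal_at W (fst y)"
  shows "(Im q = 0 \<and> n = \<i> \<or> Im q = h \<and> n = - \<i>) \<and>
      (- l < Re q \<and> Re q < 0 \<or> 1 < Re q \<and> Re q < 1 + l) \<or>
    (Re q = - l \<and> n = 1 \<or> Re q = 1 + l \<and> n = - 1) \<and> 0 < Im q \<and> Im q < h"
proof -
  define i where "i = wall_index W (fst y)"
  have nc: "non_corner W (fst y)" using assms by (simp add: regular_def)
  note r = non_corner_region[OF nc, folded i_def q_def]
  have k: "curv (W ! i) = 0" using assms(2) by (simp add: curv_at_def wall_at_def i_def)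
  have n: "n = wall_normal (W ! i) (fst y - offset W i)"
    by (simp add: n_def normal_at_def wall_at_def i_def)
  have kk: "kf \<noteq> 0" "kd \<noteq> 0" using kf kd by auto
  show ?thesis
    by (rule table_cases[OF r(1)];
      (insert r(2) k n; simp only: wall_region_iff curv_table flat_normal kk simp_thms); argo?)
qed

lemma collision_step:
  assumes "x \<in> collision_dom W"
  defines "y \<equiv> collision_map W x"
  shows "velocity W y = reflected (normal_at W (fst y)) (velocity W x)"
    "velocity W x \<bullet> normal_at W (fst y) < 0"
proof -
  have c: "next_collision W x y" unfolding y_def by (rule collision_map_in[OF assms(1)])
  then show "velocity W y = reflected (normal_at W (fst y)) (velocity W x)"
    by (simp add: next_collision_iff)
  have "0 < cos (snd y)" unfolding y_def by (intro cos_pos regular_collision_map assms)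
  then show "velocity W x \<bullet> normal_at W (fst y) < 0" using incoming_normal(1)[OF c] by simp
qed

lemma path_length_dist:
  assumes "m \<le> n"
  shows "dist (point_at W (fst ((collision_map W ^^ m) x))) (point_at W (fst ((collision_map W ^^ n) x)))
    \<le> path_length n x - path_length m x"
  using assms
proof (induction n rule: dec_induct)
  case (step n)
  let ?p = "\<lambda>i. point_at W (fst ((collision_map W ^^ i) x))"
  have "dist (?p m) (?p (Suc n)) \<le> dist (?p m) (?p n) + dist (?p n) (?p (Suc n))"
    by (rule dist_triangle)
  then show ?case using step.IH by (simp add: path_length_Suc flight_def)
qed simp

text \<open>Long horizontal walls preserve the horizontal velocity. If no vertical end were hit, the
  abscissa would be monotone from one point of (0, 1) to another, whereas the first straight wall
  lies outside. So an end is reached, and the ways there and back are each longer than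
  \<open>l\<close>.\<close>

lemma excursion_length:
  assumes fr: "first_return W n x y" and n: "0 < n"
  shows "2 * l < path_length (Suc n) x"
proof -
  let ?z = "\<lambda>i. (collision_map W ^^ i) x"
  define X where "X i = Re (point_at W (fst (?z i)))" for i
  note x = fr[unfolded first_return_iff]
  have reg: "regular W (?z i)" if "i \<le> Suc n" for i using x that by (intro regular_funpow) auto
  have flat: "curv_at W (fst (?z i)) = 0" if "i \<in> {1..n}" for i
    using x that regular_phase_space[OF reg, of i] by auto
  have ends: "0 < X 0" "X 0 < 1" "0 < X (Suc n)" "X (Suc n) < 1"
  proof -
    have "curv_at W (fst (?z 0)) \<noteq> 0" "curv_at W (fst (?z (Suc n))) \<noteq> 0"
      using x regular_phase_space[OF reg, of 0] regular_phase_space[OF reg, of "Suc n"] by auto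
    then show "0 < X 0" "X 0 < 1" "0 < X (Suc n)" "X (Suc n) < 1"
      unfolding X_def using curved_state reg by blast+
  qed
  have "\<exists>i\<in>{1..n}. X i = - l \<or> X i = 1 + l"
  proof (rule ccontr)
    assume not: "\<not> ?thesis"
    have H: "(normal_at W (fst (?z i)) = \<i> \<or> normal_at W (fst (?z i)) = - \<i>) \<and> (X i < 0 \<or> 1 < X i)"
      if "i \<in> {1..n}" for i
      using flat_state[OF reg flat[OF that]] not that unfolding X_def by fastforce
    have v: "Re (velocity W (?z i)) = Re (velocity W x)" if "i \<le> n" for i
      using that
    proof (induction i)
      case (Suc i)
      have "velocity W (?z (Suc i)) = reflected (normal_at W (fst (?z (Suc i)))) (velocity W (?z i))"
        using collision_step(1)[of "?z i"] x Suc by simp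
      then show ?case using H[of "Suc i"] Suc by (auto simp: reflected_def)
    qed simp
    have Xi: "X i = X 0 + path_length i x * Re (velocity W x)" if "i \<le> Suc n" for i
      using that
    proof (induction i)
      case (Suc i)
      have "X (Suc i) = X i + flight (?z i) * Re (velocity W (?z i))"
        using flight(2)[of "?z i"] x Suc by (simp add: X_def)
      then show ?case using v[of i] Suc by (simp add: path_length_Suc algebra_simps)
    qed (simp add: path_length_def)
    have pos: "0 \<le> path_length 1 x" "path_length 1 x \<le> path_length (Suc n) x"
      using path_length_dist[of 0 1 x] path_length_dist[of 1 "Suc n" x]
        order_trans[OF zero_le_dist] by (force simp: path_length_def)+
    define a where "a = Re (velocity W x)"
    have "X 1 = X 0 + path_length 1 x * a" "X (Suc n) = X 0 + path_length (Suc n) x * a"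
      using Xi[of 1] Xi[of "Suc n"] n by (simp_all add: a_def)
    moreover have "0 \<le> path_length 1 x * a \<and> path_length 1 x * a \<le> path_length (Suc n) x * a \<or>
      path_length 1 x * a \<le> 0 \<and> path_length (Suc n) x * a \<le> path_length 1 x * a"
      using pos by (cases "0 \<le> a") (auto intro: mult_right_mono mult_right_mono_neg simp: mult_nonneg_nonpos)
    ultimately have "0 < X 1 \<and> X 1 < 1" using ends by linarith
    then show False using H[of 1] n by auto
  qed
  then obtain i where i: "i \<in> {1..n}" "X i = - l \<or> X i = 1 + l" by blast
  have "\<bar>X j - X k\<bar> \<le> path_length k x - path_length j x" if "j \<le> k" for j k
    using path_length_dist[OF that, of x] abs_Re_le_cmod[of "point_at W (fst (?z j)) - point_at W (fst (?z k))"]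
    by (simp add: X_def dist_norm)
  from this[of 0 i] this[of i "Suc n"]
  have "\<bar>X 0 - X i\<bar> + \<bar>X i - X (Suc n)\<bar> \<le> path_length (Suc n) x"
    using i by (simp add: path_length_def)
  then show ?thesis using i(2) ends by linarith
qed

text \<open>
  A billiard trajectory in the rectangle spanned by the strips is an unfolded straight line modulo
  reflections. It enters through one of the openings and crosses the opening lines at equal time
  steps, so that by recurrence of the rotation it passes through an opening again.
\<close>

lemma return_exists:
  assumes x: "x \<in> phase_space W" and dom: "\<And>i. (collision_map W ^^ i) x \<in> collision_dom W"
  shows "\<exists>n y. first_return W n x y"
proof -
  let ?z = "\<lambda>i. (collision_map W ^^ i) x"
  have reg: "regular W (?z i)" for i using dom by (rule regular_collision_dom)
  have "\<exists>n. ?z (Suc n) \<in> phase_space W"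
  proof (rule ccontr)
    assume not: "\<not> ?thesis"
    have flat: "curv_at W (fst (?z i)) = 0" if "0 < i" for i
      using not that regular_phase_space[OF reg, of i] by (metis Suc_pred)
    define p where "p i = point_at W (fst (?z i))" for i
    define v where "v i = velocity W (?z i)" for i
    define \<nu> where "\<nu> i = normal_at W (fst (?z i))" for i
    define \<tau> where "\<tau> i = path_length i x" for i
    \<comment> \<open>Half the length of the rectangle: relative to its centre line at abscissa 1/2,
      the end sides are at +-\<open>H\<close>, and folding identifies abscissas modulo 2
      \<open>H\<close> up to sign.\<close>
    define H where "H = 1/2 + l"
    define a b \<xi> \<eta> where "a = Re (v 0)" and "b = Im (v 0)" and "\<xi> = Re (p 0) - 1/2" and "\<eta> = Im (p 0)"
    have H: "H > 1/2" using l by (simp add: H_def)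
    have ev: "p (Suc i) = p i + flight (?z i) *\<^sub>R v i" "0 < flight (?z i)" "\<tau> (Suc i) = \<tau> i + flight (?z i)"
      "v (Suc i) = reflected (\<nu> (Suc i)) (v i)" "v i \<bullet> \<nu> (Suc i) < 0" for i
      using flight[OF dom[of i]] collision_step[OF dom[of i]]
      by (simp_all add: p_def v_def \<nu>_def \<tau>_def path_length_Suc)
    have fs: "(Im (p i) = 0 \<and> \<nu> i = \<i> \<or> Im (p i) = h \<and> \<nu> i = - \<i>) \<and>
        (- l < Re (p i) \<and> Re (p i) < 0 \<or> 1 < Re (p i) \<and> Re (p i) < 1 + l) \<or>
      (Re (p i) = - l \<and> \<nu> i = 1 \<or> Re (p i) = 1 + l \<and> \<nu> i = - 1) \<and> 0 < Im (p i) \<and> Im (p i) < h"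
      if "0 < i" for i
      using flat_state[OF reg flat[OF that]] by (simp add: p_def \<nu>_def)
    have \<tau>0: "\<tau> 0 = 0" by (simp add: \<tau>_def path_length_def)
    have mono: "strict_mono \<tau>" using ev(2,3) by (simp add: strict_mono_Suc_iff)
    have unfoldX: "\<exists>\<sigma> m. \<bar>\<sigma>\<bar> = 1 \<and> Re (v i) = of_int \<sigma> * a \<and>
        Re (p i) - 1/2 = of_int \<sigma> * (\<xi> + a * \<tau> i) + 2 * H * of_int m" for i
      unfolding a_def \<xi>_def
    proof (rule unfold_reflections[of \<tau> "\<lambda>i. Re (p i) - 1/2" "\<lambda>i. Re (v i)"])
      fix i
      have "\<nu> (Suc i) = \<i> \<or> \<nu> (Suc i) = - \<i> \<or> (\<nu> (Suc i) = 1 \<or> \<nu> (Suc i) = - 1) \<and>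
          (Re (p (Suc i)) - 1/2 = H * of_int (- 1) \<or> Re (p (Suc i)) - 1/2 = H * of_int 1)"
        using fs[of "Suc i"] by (auto simp: H_def)
      then have "Re (v (Suc i)) = Re (v i) \<or> Re (v (Suc i)) = - Re (v i) \<and>
          (Re (p (Suc i)) - 1/2 = H * of_int (- 1) \<or> Re (p (Suc i)) - 1/2 = H * of_int 1)"
        unfolding ev(4) reflected_def by auto
      then show "Re (v (Suc i)) = Re (v i) \<or>
          Re (v (Suc i)) = - Re (v i) \<and> (\<exists>m. Re (p (Suc i)) - 1/2 = H * of_int m)"
        by blast
    qed (simp_all add: \<tau>0 ev(1,3))
    have unfoldY: "\<exists>\<sigma> m. \<bar>\<sigma>\<bar> = 1 \<and> Im (v i) = of_int \<sigma> * b \<and>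
        Im (p i) = of_int \<sigma> * (\<eta> + b * \<tau> i) + 2 * h * of_int m" for i
      unfolding b_def \<eta>_def
    proof (rule unfold_reflections[of \<tau> "\<lambda>i. Im (p i)" "\<lambda>i. Im (v i)"])
      fix i
      have "\<nu> (Suc i) = 1 \<or> \<nu> (Suc i) = - 1 \<or> (\<nu> (Suc i) = \<i> \<or> \<nu> (Suc i) = - \<i>) \<and>
          (Im (p (Suc i)) = h * of_int 0 \<or> Im (p (Suc i)) = h * of_int 1)"
        using fs[of "Suc i"] by auto
      then have "Im (v (Suc i)) = Im (v i) \<or> Im (v (Suc i)) = - Im (v i) \<and>
          (Im (p (Suc i)) = h * of_int 0 \<or> Im (p (Suc i)) = h * of_int 1)"
        unfolding ev(4) reflected_def by auto
      then show "Im (v (Suc i)) = Im (v i) \<or>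
          Im (v (Suc i)) = - Im (v i) \<and> (\<exists>m. Im (p (Suc i)) = h * of_int m)"
        by blast
    qed (simp_all add: \<tau>0 ev(1,3))
    have p0: "\<eta> < 0 \<or> h < \<eta>"
      using curved_state(3)[OF reg[of 0]] regular_phase_space[OF reg[of 0]] x by (auto simp: \<eta>_def p_def)
    have Y1: "0 \<le> Im (p i)" "Im (p i) \<le> h" if "0 < i" for i using fs[OF that] h by auto
    have p1: "Im (p 1) = \<eta> + b * \<tau> 1" "Re (p 1) - 1/2 = \<xi> + a * \<tau> 1"
      using ev(1,3)[of 0] by (simp_all add: \<tau>0 a_def b_def \<xi>_def \<eta>_def algebra_simps)
    have \<tau>1: "0 < \<tau> 1" using mono \<tau>0 strict_monoD[of \<tau> 0 1] by simp
    have b: "b \<noteq> 0" using p1 p0 Y1[of 1] by auto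
    \<comment> \<open>The height of the opening through which the particle enters the rectangle; it
      is crossed at time \<open>s0\<close>, before the first collision.\<close>
    define y0 where "y0 = (if \<eta> < 0 then 0 else h)"
    define s0 where "s0 = (y0 - \<eta>) / b"
    have s0: "\<eta> + b * s0 = y0" using b by (simp add: s0_def)
    have sb: "\<eta> < 0 \<and> 0 < b \<and> y0 = 0 \<or> h < \<eta> \<and> b < 0 \<and> y0 = h"
    proof -
      have "\<eta> < 0 \<Longrightarrow> 0 < b * \<tau> 1" "h < \<eta> \<Longrightarrow> b * \<tau> 1 < 0" using p1 Y1[of 1] by auto
      then show ?thesis using p0 \<tau>1 h by (auto simp: y0_def zero_less_mult_iff mult_less_0_iff)
    qed
    have s0pos: "0 < s0" using sb by (auto simp: s0_def zero_less_divide_iff)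
    have s0le: "s0 < \<tau> 1"
    proof (rule ccontr)
      assume "\<not> s0 < \<tau> 1"
      then have "b * \<tau> 1 \<le> b * s0 \<and> 0 < b \<or> b * s0 \<le> b * \<tau> 1 \<and> b < 0" using sb by auto
      then have "Im (p 1) = y0"
        using p1(1) s0 sb Y1[OF zero_less_one] by (elim disjE conjE) linarith+
      moreover have "v 0 \<bullet> \<nu> 1 < 0" using ev(5)[of 0] by simp
      ultimately show False using fs[of 1] sb h by (auto simp: b_def inner_complex_def)
    qed
    have in_opening: "\<bar>\<xi> + a * s0\<bar> < 1/2"
    proof -
      have "p 0 + s0 *\<^sub>R v 0 \<in> domain"
        using flight(3)[OF dom[of 0], of s0] s0pos s0le ev(3)[of 0] \<tau>0 by (simp add: p_def v_def)
      moreover have "Im (p 0 + s0 *\<^sub>R v 0) = y0" using s0 by (simp add: \<eta>_def b_def mult.commute)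
      ultimately have "0 < Re (p 0 + s0 *\<^sub>R v 0)" "Re (p 0 + s0 *\<^sub>R v 0) < 1"
        using sb h by (auto simp: domain_def upper_domain_def strip_domain_def lower_domain_def)
      moreover have "\<xi> + a * s0 = Re (p 0 + s0 *\<^sub>R v 0) - 1/2" by (simp add: \<xi>_def a_def)
      ultimately show ?thesis by linarith
    qed
    \<comment> \<open>The time in which the unfolded line crosses the height \<open>h\<close> of the
      rectangle. At the times \<open>s0\<close> + j \<open>\<delta>\<close> the unfolded height is a
      multiple of \<open>h\<close>, so the folded particle is at height 0 or
      \<open>h\<close>.\<close>
    define \<delta> where "\<delta> = h / \<bar>b\<bar>"
    have \<delta>: "0 < \<delta>" "b * \<delta> = h \<or> b * \<delta> = - h" using h b by (auto simp: \<delta>_def abs_if)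
    have \<delta>b: "0 < b \<Longrightarrow> b * \<delta> = h" "b < 0 \<Longrightarrow> b * \<delta> = - h" by (simp_all add: \<delta>_def)
    have H0: "2 * H > 0" and e0: "1/2 - \<bar>\<xi> + a * s0\<bar> > 0" using H in_opening by auto
    \<comment> \<open>The abscissa at time \<open>s0\<close> leaves exactly this margin to the ends
      of the opening, so a recurrence modulo 2 \<open>H\<close> within the margin falls into the
      opening again.\<close>
    obtain j :: nat and m0 :: int where j: "j > 0" "\<bar>real j * (a * \<delta>) - 2 * H * of_int m0\<bar> < 1/2 - \<bar>\<xi> + a * s0\<bar>"
      using recurrence[OF H0 e0] by metis
    define t where "t = s0 + real j * \<delta>"
    have t0: "0 < t" using s0pos \<delta> by (simp add: t_def add_pos_nonneg)
    have "\<exists>i. t < \<tau> i"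
    proof (rule ccontr)
      assume "\<not> ?thesis"
      then have le: "\<tau> i \<le> t" for i by (simp add: not_less)
      have nonneg: "0 \<le> \<tau> i" for i using strict_mono_less_eq[OF mono, of 0 i] \<tau>0 by simp
      \<comment> \<open>Collisions occur only when the unfolded line meets the grid of reflected
        walls. The sets \<open>A\<close> and \<open>B\<close> contain its meeting times with
        horizontal and vertical grid lines up to \<open>t\<close>; both are finite, while the
        collision times are infinitely many.\<close>
      define A where "A = {s. 0 \<le> s \<and> s \<le> t \<and> (\<exists>m::int. \<eta> + b * s = h * of_int m)}"
      define B where "B = {s. 0 \<le> s \<and> s \<le> t \<and> a \<noteq> 0 \<and> (\<exists>m::int. \<xi> + a * s = H * of_int m)}"
      have "finite A" unfolding A_def using b h by (rule finite_times)
      moreover have "finite B"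
        using finite_times[of a H t \<xi>] H by (cases "a = 0") (simp_all add: B_def)
      moreover have "\<tau> (Suc i) \<in> A \<union> B" for i
      proof -
        obtain \<sigma> m :: int where \<sigma>: "\<bar>\<sigma>\<bar> = 1" "Im (p (Suc i)) = of_int \<sigma> * (\<eta> + b * \<tau> (Suc i)) + 2 * h * of_int m"
          using unfoldY by blast
        obtain \<rho> k :: int where \<rho>: "\<bar>\<rho>\<bar> = 1" "Re (v (Suc i)) = of_int \<rho> * a"
            "Re (p (Suc i)) - 1/2 = of_int \<rho> * (\<xi> + a * \<tau> (Suc i)) + 2 * H * of_int k"
          using unfoldX by blast
        have sg: "\<sigma> = 1 \<or> \<sigma> = - 1" "\<rho> = 1 \<or> \<rho> = - 1" using \<sigma>(1) \<rho>(1) by linarith+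
        consider (h) c :: int where "Im (p (Suc i)) = h * of_int c"
          | (v) c :: int where "Re (p (Suc i)) - 1/2 = H * of_int c" "\<nu> (Suc i) = 1 \<or> \<nu> (Suc i) = - 1"
        proof -
          have "Im (p (Suc i)) = h * of_int 0 \<or> Im (p (Suc i)) = h * of_int 1 \<or>
            (Re (p (Suc i)) - 1/2 = H * of_int (- 1) \<or> Re (p (Suc i)) - 1/2 = H * of_int 1) \<and>
              (\<nu> (Suc i) = 1 \<or> \<nu> (Suc i) = - 1)"
            using fs[of "Suc i"] by (auto simp: H_def)
          then show thesis using that by blast
        qed
        then show ?thesis
        proof cases
          case h
          then have "\<eta> + b * \<tau> (Suc i) = h * of_int (\<sigma> * (c - 2 * m))"
            using \<sigma> sg by (auto simp: algebra_simps)
          then show ?thesis using le nonneg unfolding A_def by blast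
        next
          case v
          then have "\<xi> + a * \<tau> (Suc i) = H * of_int (\<rho> * (c - 2 * k))"
            using \<rho> sg by (auto simp: algebra_simps)
          moreover have "a \<noteq> 0" using ev(4,5)[of i] v(2) \<rho>(2) by (auto simp: reflected_def inner_complex_def)
          ultimately show ?thesis using le nonneg unfolding B_def by blast
        qed
      qed
      then have "range (\<lambda>i. \<tau> (Suc i)) \<subseteq> A \<union> B" by blast
      ultimately have "finite (range (\<lambda>i. \<tau> (Suc i)))" by (meson finite_UnI finite_subset)
      moreover have "inj (\<lambda>i. \<tau> (Suc i))"
        using strict_mono_eq[OF mono] by (simp add: inj_def)
      ultimately show False using finite_imageD by blast
    qed
    define i where "i = (LEAST i. t < \<tau> i)"
    have ti: "t < \<tau> i" using \<open>\<exists>i. t < \<tau> i\<close> unfolding i_def by (rule LeastI_ex)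
    have "i \<noteq> 0" using ti t0 \<tau>0 by (cases "i = 0") auto
    then obtain i' where i': "i = Suc i'" by (cases i) auto
    have ti': "\<tau> i' \<le> t" using not_less_Least[of i' "\<lambda>i. t < \<tau> i"] i' by (auto simp: i_def not_less)
    have Yt: "\<eta> + b * t = y0 + real j * (b * \<delta>)" using s0 by (simp add: t_def algebra_simps)
    have jh: "h \<le> real j * h" using j(1) h by simp
    \<comment> \<open>If \<open>t\<close> preceded the first collision, the particle would have run
      straight across the full height by then, and the first collision would lie outside the
      rectangle.\<close>
    have "i' \<noteq> 0"
    proof
      assume "i' = 0"
      then have lt: "t < \<tau> 1" using ti i' by simp
      from sb show False
      proof
        assume *: "\<eta> < 0 \<and> 0 < b \<and> y0 = 0"
        then have "b * t < b * \<tau> 1" using lt by simp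
        moreover have "\<eta> + b * t = real j * h" using Yt * \<delta>b(1) by simp
        ultimately show False using p1(1) Y1(2)[OF zero_less_one] jh by linarith
      next
        assume *: "h < \<eta> \<and> b < 0 \<and> y0 = h"
        then have "b * \<tau> 1 < b * t" using lt by simp
        moreover have "\<eta> + b * t = h - real j * h" using Yt * \<delta>b(2) by simp
        ultimately show False using p1(1) Y1(1)[OF zero_less_one] jh by linarith
      qed
    qed
    then have ip: "0 < i'" by simp
    obtain \<sigma> m :: int where \<sigma>: "\<bar>\<sigma>\<bar> = 1" "Im (v i') = of_int \<sigma> * b"
        "Im (p i') = of_int \<sigma> * (\<eta> + b * \<tau> i') + 2 * h * of_int m" using unfoldY by blast
    have sg: "\<sigma> = 1 \<or> \<sigma> = - 1" using \<sigma>(1) by linarith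
    define y where "y = Im (p i') + (t - \<tau> i') * Im (v i')"
    have y: "y = of_int \<sigma> * (\<eta> + b * t) + 2 * h * of_int m"
      unfolding y_def \<sigma>(2,3) by (simp add: algebra_simps)
    obtain c :: int where c: "y = h * of_int c"
    proof -
      have "\<exists>c::int. y0 = h * of_int c" using sb by (metis mult.right_neutral mult_zero_right of_int_0 of_int_1)
      then obtain c1 :: int where c1: "y0 = h * of_int c1" by blast
      have "\<exists>c::int. real j * (b * \<delta>) = h * of_int c"
        using \<delta>(2) by (metis mult.commute mult_minus_left of_int_minus of_int_of_nat_eq)
      then obtain c2 :: int where "real j * (b * \<delta>) = h * of_int c2" by blast
      then have "y = h * of_int (\<sigma> * (c1 + c2) + 2 * m)"
        unfolding y Yt c1 by (simp add: algebra_simps)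
      then show ?thesis by (rule that)
    qed
    have end_y: "Im (p i) = Im (p i') + (\<tau> i - \<tau> i') * Im (v i')"
      unfolding i' ev(1,3) by simp
    have vn0: "Im (v i') \<noteq> 0" using \<sigma>(2) b sg by auto
    \<comment> \<open>Strictly between two collisions the height lies strictly between 0 and
      \<open>h\<close>, but at time \<open>t\<close> it is a multiple of \<open>h\<close>.\<close>
    have "t = \<tau> i'"
    proof (rule ccontr)
      assume "t \<noteq> \<tau> i'"
      then have tt: "0 < t - \<tau> i'" "t - \<tau> i' < \<tau> i - \<tau> i'" using ti ti' by auto
      have "0 < y \<and> y < h"
      proof (cases "0 < Im (v i')")
        case True
        then have "0 < (t - \<tau> i') * Im (v i')" "(t - \<tau> i') * Im (v i') < (\<tau> i - \<tau> i') * Im (v i')"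
          using tt by (auto intro: mult_strict_right_mono)
        then show ?thesis using end_y Y1[OF ip] Y1[of i] i' by (simp add: y_def)
      next
        case False
        then have "Im (v i') < 0" using vn0 by simp
        then have "(t - \<tau> i') * Im (v i') < 0" "(\<tau> i - \<tau> i') * Im (v i') < (t - \<tau> i') * Im (v i')"
          using tt by (auto intro: mult_strict_right_mono_neg mult_pos_neg)
        then show ?thesis using end_y Y1[OF ip] Y1[of i] i' by (simp add: y_def)
      qed
      then have "0 < h * of_int c" "h * of_int c < h * 1" using c by simp_all
      then have "0 < (of_int c :: real)" "(of_int c :: real) < 1"
        using h by (simp_all add: zero_less_mult_iff)
      then have "0 < c" "c < 1" by simp_all
      then show False by linarith
    qed
    then have "Im (p i') = h * of_int c" using c by (simp add: y_def)
    then have "Im (p i') = 0 \<or> Im (p i') = h"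
    proof -
      assume e: "Im (p i') = h * of_int c"
      then have "0 \<le> h * of_int c" "h * of_int c \<le> h * 1" using Y1[OF ip] by simp_all
      then have "0 \<le> (of_int c :: real)" "(of_int c :: real) \<le> 1" using h by (simp_all add: zero_le_mult_iff)
      then have "0 \<le> c" "c \<le> 1" by simp_all
      then have "c = 0 \<or> c = 1" by linarith
      then show ?thesis using e by auto
    qed
    \<comment> \<open>A collision at height 0 or \<open>h\<close> is on a horizontal strip wall,
      hence outside the opening; the recurrence is about to place it inside.\<close>
    then have far: "1/2 < \<bar>Re (p i') - 1/2\<bar>" "\<bar>Re (p i') - 1/2\<bar> < H" using fs[OF ip] by (auto simp: H_def)
    obtain \<rho> k :: int where \<rho>: "\<bar>\<rho>\<bar> = 1"
        "Re (p i') - 1/2 = of_int \<rho> * (\<xi> + a * \<tau> i') + 2 * H * of_int k"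
      using unfoldX by blast
    have sg': "\<rho> = 1 \<or> \<rho> = - 1" using \<rho>(1) by linarith
    define e where "e = real j * (a * \<delta>) - 2 * H * of_int m0"
    have "Re (p i') - 1/2 = of_int \<rho> * (\<xi> + a * s0 + e) + 2 * H * of_int (k + \<rho> * m0)"
      unfolding \<rho>(2) \<open>t = \<tau> i'\<close>[symmetric] by (simp add: t_def e_def algebra_simps)
    moreover have small: "\<bar>of_int \<rho> * (\<xi> + a * s0 + e)\<bar> < 1/2"
    proof -
      have "\<bar>real_of_int \<rho>\<bar> = 1" using sg' by auto
      then have "\<bar>of_int \<rho> * (\<xi> + a * s0 + e)\<bar> = \<bar>\<xi> + a * s0 + e\<bar>" by (simp only: abs_mult mult_1)
      also have "\<dots> < 1/2" using j(2) unfolding e_def[symmetric] by linarith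
      finally show ?thesis .
    qed
    \<comment> \<open>The translation part is a multiple of 2 \<open>H\<close> but smaller than
      \<open>H\<close> + 1/2 < 2 \<open>H\<close>, so it vanishes.\<close>
    ultimately have "\<bar>2 * H * of_int (k + \<rho> * m0)\<bar> < H + 1/2" using far by linarith
    moreover have "\<bar>2 * H * of_int (k + \<rho> * m0)\<bar> = (2 * H) * \<bar>real_of_int (k + \<rho> * m0)\<bar>"
      using H by (simp only: abs_mult)
    ultimately have "(2 * H) * \<bar>real_of_int (k + \<rho> * m0)\<bar> < (2 * H) * 1" using H by linarith
    then have "\<bar>real_of_int (k + \<rho> * m0)\<bar> < 1" by (rule mult_left_less_imp_less) (use H in simp)
    then have "real_of_int \<bar>k + \<rho> * m0\<bar> < 1" by (simp only: of_int_abs)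
    then have "\<bar>k + \<rho> * m0\<bar> < 1" by (simp only: of_int_less_1_iff)
    then have "k + \<rho> * m0 = 0" by linarith
    then show False
      using \<open>Re (p i') - 1/2 = of_int \<rho> * (\<xi> + a * s0 + e) + 2 * H * of_int (k + \<rho> * m0)\<close> small far by simp
  qed
  then obtain n where n: "?z (Suc n) \<in> phase_space W" "\<And>i. i < n \<Longrightarrow> ?z (Suc i) \<notin> phase_space W"
    using exists_least_iff[of "\<lambda>n. ?z (Suc n) \<in> phase_space W"] by blast
  have "?z i \<notin> phase_space W" if "i \<in> {1..n}" for i
    using n(2)[of "i - 1"] that by (cases i) auto
  then show ?thesis using x dom n(1) by (intro exI[of _ n] exI[of _ "?z (Suc n)"]) (simp add: first_return_iff)
qed

end

section \<open>The chord condition\<close>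

locale chord_table = strip_table +
  assumes chords: "\<And>w' t' w'' t''.
      \<lbrakk>w' \<in> dispersing_walls (table kd h kf l); t' \<in> {0..wall_length w'};
       w'' \<in> focusing_walls (table kd h kf l); t'' \<in> {0..wall_length w''}\<rbrakk>
      \<Longrightarrow> chord w' t' w'' t'' \<subseteq> disc 4 w'' t''"
    and strips: "l \<ge> 1 / kf"
begin

text \<open>The disc \<open>disc (-2) w' t'\<close> has the segment from the boundary point to the
  centre of the dispersing arc as a diameter. By Thales the line of flight meets it in the foot of
  the perpendicular from this centre, at distance \<open>\<kappa>\<close> from the focusing point.
  The disc \<open>disc 4 w'' t''\<close> has diameter 1 / (2 kf), so its chord along the flight has
  length cos \<alpha> / (2 kf), which bounds \<open>\<kappa>\<close>.\<close>

lemma chord_bound: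
  assumes s': "non_corner W s'" "curv_at W s' = kd" and s'': "non_corner W s''" "curv_at W s'' = kf"
    and p: "point_at W s' = point_at W s'' + \<tau> *\<^sub>R v" and v: "norm v = 1"
    and n': "v \<bullet> normal_at W s' < 0" and \<tau>: "0 < \<tau>"
  shows "\<tau> + (v \<bullet> normal_at W s') / kd \<le> (v \<bullet> normal_at W s'') / (2 * kf)"
proof -
  define w' w'' t' t'' where "w' = wall_at W s'" and "w'' = wall_at W s''"
    and "t' = s' - offset W (wall_index W s')" and "t'' = s'' - offset W (wall_index W s'')"
  define p' p'' m' m'' where "p' = point_at W s'" and "p'' = point_at W s''"
    and "m' = normal_at W s'" and "m'' = normal_at W s''"
  have w: "p' = wall_point w' t'" "m' = wall_normal w' t'" "p'' = wall_point w'' t''" "m'' = wall_normal w'' t''"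
    by (simp_all add: p'_def p''_def m'_def m''_def point_at_def normal_at_def w'_def w''_def t'_def t''_def)
  have k: "curv w' = kd" "curv w'' = kf" using s' s'' by (simp_all add: curv_at_def w'_def w''_def)
  have nm: "norm m' = 1" "norm m'' = 1" using s' s'' by (simp_all add: m'_def m''_def)
  have "w' \<in> dispersing_walls W" "w'' \<in> focusing_walls W"
    using wall_at_in_set s' s'' k kd kf
    by (simp_all add: dispersing_walls_def focusing_walls_def w'_def w''_def)
  moreover have "t' \<in> {0..wall_length w'}" "t'' \<in> {0..wall_length w''}"
    using non_corner_region(3)[OF s'(1)] non_corner_region(3)[OF s''(1)]
    by (simp_all only: t'_def t''_def w'_def w''_def wall_at_def)
  ultimately have sub: "chord w' t' w'' t'' \<subseteq> disc 4 w'' t''" by (intro chords)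
  define g where "g = (v \<bullet> m') / kd"
  define \<kappa> where "\<kappa> = \<tau> + g"
  have g: "0 < g" using n' kd unfolding g_def m'_def by (rule_tac divide_neg_neg)
  define foot where "foot = p'' + \<kappa> *\<^sub>R v"
  have pp: "p' = p'' + \<tau> *\<^sub>R v" using p by (simp add: p'_def p''_def)
  have vv: "v \<bullet> v = 1" "m' \<bullet> m' = 1" "m'' \<bullet> m'' = 1" using v nm by (simp_all add: dot_square_norm)
  have "foot \<in> affine hull {p', p''}"
  proof -
    have "foot = (\<kappa> / \<tau>) *\<^sub>R p' + (1 - \<kappa> / \<tau>) *\<^sub>R p''"
      using \<tau> by (simp add: foot_def pp algebra_simps)
    then show ?thesis
      unfolding affine_hull_2 mem_Collect_eq
      by (intro exI[of _ "\<kappa> / \<tau>"] exI[of _ "1 - \<kappa> / \<tau>"]) simp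
  qed
  moreover have "foot \<in> disc (- 2) w' t'"
  proof -
    define r where "r = 1 / (2 * \<bar>kd\<bar>)"
    have r: "r > 0" using kd by (simp add: r_def)
    have gr: "g = - (2 * r * (v \<bullet> m'))" using kd by (simp add: g_def r_def abs_if)
    have e: "(p' - r *\<^sub>R m') - foot = - (g *\<^sub>R v + r *\<^sub>R m')" by (simp add: foot_def \<kappa>_def pp algebra_simps)
    have "(norm (g *\<^sub>R v + r *\<^sub>R m'))\<^sup>2 = g\<^sup>2 + 2 * g * r * (v \<bullet> m') + r\<^sup>2"
      unfolding dot_square_norm[symmetric]
      by (simp add: inner_add_left inner_add_right vv inner_commute[of m' v] power2_eq_square algebra_simps)
    also have "\<dots> = r\<^sup>2" by (simp add: gr power2_eq_square algebra_simps)
    finally have "norm (g *\<^sub>R v + r *\<^sub>R m') = r" using r by (simp add: power2_eq_iff_nonneg)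
    then have "norm ((p' - r *\<^sub>R m') - foot) = r" unfolding e norm_minus_cancel .
    moreover have cen: "p' + (1 / ((- 2) * \<bar>kd\<bar>)) *\<^sub>R m' = p' - r *\<^sub>R m'" and rad: "1 / \<bar>(- 2) * kd\<bar> = r"
      by (simp_all add: r_def abs_mult)
    ultimately show ?thesis unfolding disc_def k w[symmetric] mem_cball dist_norm cen rad by simp
  qed
  ultimately have "foot \<in> disc 4 w'' t''" using sub by (auto simp: chord_def w)
  define \<rho> where "\<rho> = 1 / (4 * kf)"
  have \<rho>: "\<rho> > 0" using kf by (simp add: \<rho>_def)
  have "norm ((p'' + \<rho> *\<^sub>R m'') - foot) \<le> \<rho>"
    using \<open>foot \<in> disc 4 w'' t''\<close> kf unfolding disc_def k w[symmetric] by (simp add: dist_norm \<rho>_def)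
  then have "(norm ((p'' + \<rho> *\<^sub>R m'') - foot))\<^sup>2 \<le> \<rho>\<^sup>2" by (intro power_mono) auto
  moreover have "(p'' + \<rho> *\<^sub>R m'') - foot = \<rho> *\<^sub>R m'' - \<kappa> *\<^sub>R v" by (simp add: foot_def)
  moreover have "(norm (\<rho> *\<^sub>R m'' - \<kappa> *\<^sub>R v))\<^sup>2 = \<rho>\<^sup>2 - 2 * \<rho> * \<kappa> * (v \<bullet> m'') + \<kappa>\<^sup>2"
    unfolding dot_square_norm[symmetric]
    by (simp add: inner_diff_left inner_diff_right vv inner_commute[of m'' v] power2_eq_square algebra_simps)
  ultimately have "\<kappa> * \<kappa> \<le> \<kappa> * (2 * \<rho> * (v \<bullet> m''))" by (simp add: power2_eq_square algebra_simps)
  moreover have "0 < \<kappa>" using g \<tau> by (simp add: \<kappa>_def)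
  ultimately have "\<kappa> \<le> 2 * \<rho> * (v \<bullet> m'')" by simp
  then show ?thesis by (simp add: \<kappa>_def g_def \<rho>_def m'_def m''_def)
qed

text \<open>
  Equality in the preceding bound means that the velocity is orthogonal to the vector
  from a point depending on \<open>s''\<close> only to the centre of the dispersing arc.
\<close>

definition centre :: "nat \<Rightarrow> complex" where
  "centre j = src (W ! j) + wall_normal (W ! j) 0 / of_real kd"

definition extremal_chord :: "nat \<Rightarrow> state \<Rightarrow> bool" where
  "extremal_chord j x \<longleftrightarrow> regular W x \<and> curv_at W (fst x) = kf \<and>
     (centre j - point_at W (fst x) - normal_at W (fst x) / of_real (2 * kf)) \<bullet> velocity W x = 0"

lemma curv_at_kf:
  assumes "non_corner W s" "curv_at W s = kf"
  shows "wall_index W s = 0"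
proof -
  have "curv (W ! wall_index W s) = kf" using assms by (simp add: curv_at_def wall_at_def)
  moreover have "kf \<noteq> 0" "kf \<noteq> kd" using kf kd by auto
  ultimately show ?thesis
    using table_cases[OF non_corner_region(1)[OF assms(1)]] curv_table by metis
qed

text \<open>On the focusing arc the point is an affine function of the normal, and the vector tested
  against the velocity is a constant plus the normal divided by 2 kf. It is therefore injective in
  the boundary coordinate and vanishes at most once, as \<open>negligible_velocity\<close>
  requires.\<close>

lemma negligible_extremal: "negligible {x. extremal_chord j x}"
proof -
  define S where "S = {offset W 0<..<offset W (Suc 0)}"
  define c where "c s = centre j - point_at W s - normal_at W s / of_real (2 * kf)" for s
  have S: "open S" "S \<subseteq> {s. non_corner W s}" 
    using length_table by (auto simp: S_def non_corner_def intro!: exI[of _ "0::nat"])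
  have idx: "wall_index W s = 0" if "s \<in> S" for s
    using wall_index_eq[of 0 s] that by (simp add: S_def length_table)
  have cont: "continuous_on S c"
    unfolding c_def using S(2) kf
    by (intro continuous_intros continuous_at_imp_continuous_on ballI isCont_at) auto
  have eq: "point_at W s = src (W ! 0) + (wall_normal (W ! 0) 0 - normal_at W s) / of_real kf" if "s \<in> S" for s
    using wall_normal_eq[of "W ! 0" "s - offset W 0"] kf
    by (simp add: point_at_def normal_at_def wall_at_def idx[OF that] curv_table field_simps)
  have "s = s'" if "s \<in> S" "c s = 0" "s' \<in> S" "c s' = 0" for s s'
  proof -
    have cn: "c s = centre j - src (W ! 0) - wall_normal (W ! 0) 0 / of_real kf + normal_at W s / of_real (2 * kf)"
      if "s \<in> S" for s
      unfolding c_def eq[OF that] using kf by (simp add: field_simps)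
    have "normal_at W s / of_real (2 * kf) = normal_at W s' / of_real (2 * kf)"
      using that(2,4) unfolding cn[OF that(1)] cn[OF that(3)] by (metis add_left_cancel)
    then have "normal_at W s = normal_at W s'" using kf by simp
    then have "point_at W s = point_at W s'" by (simp add: eq that)
    then show ?thesis using point_at_inj S(2) that by blast
  qed
  then have "\<exists>a. {s\<in>S. c s = 0} \<subseteq> {a}" by blast
  then have "countable {s\<in>S. c s = 0}" by (meson countable_empty countable_insert countable_subset)
  then have "negligible {x. fst x \<in> S \<and> \<bar>snd x\<bar> < pi/2 \<and> c (fst x) \<bullet> velocity W x = 0}"
    using negligible_velocity[OF S cont] by blast
  moreover have "{x. extremal_chord j x} \<subseteq> {x. fst x \<in> S \<and> \<bar>snd x\<bar> < pi/2 \<and> c (fst x) \<bullet> velocity W x = 0}"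
  proof
    fix x assume "x \<in> {x. extremal_chord j x}"
    then have x: "regular W x" "curv_at W (fst x) = kf" "c (fst x) \<bullet> velocity W x = 0"
      by (simp_all add: extremal_chord_def c_def)
    have nc: "non_corner W (fst x)" using x(1) by (simp add: regular_def)
    have "fst x \<in> S" using wall_index_less[OF nc] curv_at_kf[OF nc x(2)] by (simp add: S_def)
    then show "x \<in> {x. fst x \<in> S \<and> \<bar>snd x\<bar> < pi/2 \<and> c (fst x) \<bullet> velocity W x = 0}"
      using x by (simp add: regular_def)
  qed
  ultimately show ?thesis by (rule negligible_subset)
qed

text \<open>Both time directions are needed: a flight from a dispersing arc to the focusing arc is
  treated through its reversal, which starts at the reversed final state.\<close>

definition exceptional :: "state set" where
  "exceptional = (\<Union>j<10. {x. extremal_chord j x} \<union> time_reversal ` {x. extremal_chord j x})"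

lemma negligible_exceptional: "negligible exceptional"
proof -
  have "linear time_reversal" by (rule linearI) auto
  then have "negligible (time_reversal ` {x. extremal_chord j x})" for j
    by (intro negligible_differentiable_image_negligible negligible_extremal order_refl
      linear_imp_differentiable_on)
  then show ?thesis
    unfolding exceptional_def
    by (intro negligible_Union finite_imageI) (auto intro!: negligible_Un negligible_extremal)
qed

lemma chord_bound_strict:
  assumes s': "non_corner W s'" "curv_at W s' = kd" and x: "regular W x" "curv_at W (fst x) = kf"
    and p: "point_at W s' = point_at W (fst x) + \<tau> *\<^sub>R velocity W x"
    and n': "velocity W x \<bullet> normal_at W s' < 0" and \<tau>: "0 < \<tau>"
    and ex: "\<And>j. j < 10 \<Longrightarrow> \<not> extremal_chord j x"
  shows "\<tau> + (velocity W x \<bullet> normal_at W s') / kd < cos (snd x) / (2 * kf)"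
proof -
  let ?v = "velocity W x"
  have nc: "non_corner W (fst x)" using x by (simp add: regular_def)
  have vn: "?v \<bullet> normal_at W (fst x) = cos (snd x)" using velocity_normal[OF nc] .
  have le: "\<tau> + (?v \<bullet> normal_at W s') / kd \<le> cos (snd x) / (2 * kf)"
    using chord_bound[OF s' nc x(2) p norm_velocity[OF nc] n' \<tau>] vn by simp
  define j where "j = wall_index W s'"
  have j: "j < 10" using non_corner_region(1)[OF s'(1)] by (simp add: j_def length_table)
  have kd0: "kd \<noteq> 0" using kd by simp
  have k: "curv (W ! j) = kd" using s'(2) by (simp add: curv_at_def wall_at_def j_def)
  have cj: "centre j = point_at W s' + normal_at W s' / of_real kd"
    using wall_normal_eq[of "W ! j" "s' - offset W j"] kd0
    by (simp add: centre_def point_at_def normal_at_def wall_at_def j_def[symmetric] k field_simps)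
  have sc: "z / of_real r = (1 / r) *\<^sub>R z" for z :: complex and r
    by (simp add: scaleR_conv_of_real)
  have "(centre j - point_at W (fst x) - normal_at W (fst x) / of_real (2 * kf)) =
      \<tau> *\<^sub>R ?v + (1 / kd) *\<^sub>R normal_at W s' - (1 / (2 * kf)) *\<^sub>R normal_at W (fst x)"
    unfolding cj p sc by simp
  moreover have "?v \<bullet> ?v = 1" using norm_velocity[OF nc] by (simp add: dot_square_norm)
  ultimately have "(centre j - point_at W (fst x) - normal_at W (fst x) / of_real (2 * kf)) \<bullet> ?v =
      \<tau> + (?v \<bullet> normal_at W s') / kd - cos (snd x) / (2 * kf)"
    using vn by (subst inner_commute) (simp add: inner_diff_right inner_add_right)
  then have "\<tau> + (?v \<bullet> normal_at W s') / kd \<noteq> cos (snd x) / (2 * kf)"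
    using ex[OF j] x by (auto simp: extremal_chord_def)
  then show ?thesis using le by simp
qed

lemma not_exceptional:
  assumes "x \<notin> exceptional" "j < 10"
  shows "\<not> extremal_chord j x" "\<not> extremal_chord j (time_reversal x)"
proof -
  show "\<not> extremal_chord j x" using assms by (auto simp: exceptional_def)
  show "\<not> extremal_chord j (time_reversal x)"
  proof
    assume "extremal_chord j (time_reversal x)"
    then have "time_reversal (time_reversal x) \<in> exceptional"
      using assms(2) unfolding exceptional_def by blast
    then show False using assms(1) by simp
  qed
qed

section \<open>Consecutive collisions with the focusing arc\<close>

text \<open>A chord of the circle carrying the focusing arc has length 2 cos \<alpha> / kf, since
  the power vanishes at both ends. The rotation of the normal along it depends on the angle only,
  and the angle is the same at both ends.\<close>

lemma focusing_chord:
  assumes c: "x \<in> collision_dom W" and y: "y = collision_map W x"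
    and k: "curv_at W (fst x) = kf" "curv_at W (fst y) = kf"
  shows "flight x = 2 * cos (snd x) / kf" "snd y = snd x"
    "fst x \<noteq> fst y" "cis (kf * (fst y - fst x)) = - cis (- 2 * snd x)"
proof -
  let ?v = "velocity W x" and ?n = "normal_at W (fst x)" and ?t = "flight x"
  have rx: "regular W x" and ry: "regular W y"
    using regular_collision_dom[OF c] regular_collision_map[OF c] y by simp_all
  then have nx: "non_corner W (fst x)" and ny: "non_corner W (fst y)" by (simp_all add: regular_def)
  have ix: "wall_index W (fst x) = 0" and iy: "wall_index W (fst y) = 0"
    using curv_at_kf nx ny k by auto
  have px: "point_at W (fst x) = wall_point (W ! 0) (fst x)" "?n = wall_normal (W ! 0) (fst x)"
    and py: "point_at W (fst y) = wall_point (W ! 0) (fst y)" "normal_at W (fst y) = wall_normal (W ! 0) (fst y)"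
    by (simp_all add: point_at_def normal_at_def wall_at_def ix iy offset_def)
  have fl: "0 < ?t" "point_at W (fst y) = point_at W (fst x) + ?t *\<^sub>R ?v"
    using flight[OF c] y by simp_all
  have nd: "src (W ! 0) \<noteq> dst (W ! 0)" using proper_table(1)[of 0] by (simp add: length_table)
  have nv: "norm ?v = 1" using nx by simp
  have vn: "?v \<bullet> ?n = cos (snd x)" using velocity_normal[OF nx] .
  have "0 = side (W ! 0) (point_at W (fst y))" unfolding py side_wall_point_0[OF nd] ..
  also have "\<dots> = ?t * (2 * cos (snd x) - kf * ?t)"
    unfolding fl(2) px(1) side_along[OF nd nv] px(2)[symmetric] vn curv_table ..
  finally show t: "?t = 2 * cos (snd x) / kf" using fl(1) kf by (simp add: field_simps)
  have "normal_at W (fst y) = ?n - of_real kf * (point_at W (fst y) - point_at W (fst x))"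
    unfolding px py wall_normal_eq[of "W ! 0" "fst y"] wall_normal_eq[of "W ! 0" "fst x"] curv_table
    by (simp add: algebra_simps)
  then have n1: "normal_at W (fst y) = ?n - (2 * cos (snd x)) *\<^sub>R ?v"
    using kf by (simp add: fl(2) t scaleR_conv_of_real)
  have two: "1 - (2 * cos (snd x)) *\<^sub>R cis (- snd x) = - cis (- 2 * snd x)"
    by (simp add: complex_eq_iff sin_double cos_double_cos power2_eq_square)
  have n2: "normal_at W (fst y) = ?n * (- cis (- 2 * snd x))"
    unfolding n1 velocity_eq two[symmetric] by (simp add: scaleR_conv_of_real algebra_simps)
  have cc: "next_collision W x y" unfolding y by (rule collision_map_in[OF c])
  have "?v \<bullet> tangent_at W (fst y) = ?v \<bullet> tangent_at W (fst x)"
  proof -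
    have "tangent_at W (fst y) = - \<i> * normal_at W (fst y)" "tangent_at W (fst x) = - \<i> * ?n"
      by (simp_all add: normal_at_eq)
    then have "tangent_at W (fst y) = tangent_at W (fst x) + (2 * cos (snd x)) *\<^sub>R (\<i> * ?v)"
      by (simp add: n1 scaleR_conv_of_real algebra_simps)
    then show ?thesis by (simp add: inner_add_right inner_rotate)
  qed
  then have "sin (snd y) = sin (snd x)"
    using incoming_normal(2)[OF cc] velocity_tangent[OF nx] by simp
  then show "snd y = snd x"
    using rx ry by (intro sin_inj_pi[of "snd y" "snd x", rotated 4]) (unfold regular_def, linarith+)
  show "fst x \<noteq> fst y" using fl nv by auto
  have "wall_normal (W ! 0) (fst y) = wall_normal (W ! 0) (fst x) * cis (kf * (fst y - fst x))"
    unfolding wall_normal_def wall_tangent_cis[of _ "fst y"] wall_tangent_cis[of _ "fst x"] curv_table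
    by (simp add: cis_mult algebra_simps)
  then have "?n * cis (kf * (fst y - fst x)) = ?n * (- cis (- 2 * snd x))" using n2 by (simp add: px py)
  moreover have "?n \<noteq> 0" using norm_normal_at[OF nx] by auto
  ultimately show "cis (kf * (fst y - fst x)) = - cis (- 2 * snd x)" by (metis mult_left_cancel)
qed

text \<open>Along such collisions the angle is conserved, hence so is the step of arclength. A
  nonconstant arithmetic progression leaves the bounded arc.\<close>

lemma focusing_finite:
  assumes dom: "\<And>i. (collision_map W ^^ i) x \<in> collision_dom W"
  shows "\<exists>i. curv_at W (fst ((collision_map W ^^ i) x)) \<noteq> kf"
proof (rule ccontr)
  let ?z = "\<lambda>i. (collision_map W ^^ i) x"
  assume "\<not> ?thesis"
  then have k: "curv_at W (fst (?z i)) = kf" for i by blast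
  define s where "s i = fst (?z i)" for i
  define L where "L = offset W (Suc 0)"
  have nc: "non_corner W (s i)" for i
    using regular_collision_dom[OF dom[of i]] by (simp add: regular_def s_def)
  have sL: "0 < s i" "s i < L" for i
    using wall_index_less[OF nc[of i]] curv_at_kf[OF nc k[folded s_def]] by (simp_all add: L_def offset_def)
  have kL: "kf * L \<le> pi"
  proof -
    have "L = 2 * half_turn (W ! 0) / kf"
      using kf by (simp add: L_def offset_def wall_length_def curv_table)
    moreover have "half_turn (W ! 0) \<le> pi/2"
      using half_turn_arcsin(2)[OF proper_table, of 0] by (simp add: length_table)
    ultimately show ?thesis using kf by simp
  qed
  have step: "snd (?z (Suc i)) = snd (?z i)" "s i \<noteq> s (Suc i)"
      "cis (kf * (s (Suc i) - s i)) = - cis (- 2 * snd (?z i))" for i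
    using focusing_chord[OF dom[of i] refl] k[of i] k[of "Suc i"] by (simp_all add: s_def)
  have \<alpha>: "snd (?z i) = snd x" for i by (induction i) (use step(1) in simp_all)
  \<comment> \<open>A minor arc turns by at most pi, so a step between interior points turns by less
    than pi and is determined by its \<open>cis\<close>.\<close>
  have small: "- pi < kf * (s (Suc i) - s i)" "kf * (s (Suc i) - s i) < pi" for i
  proof -
    have "kf * (s (Suc i) - s i) < kf * L" "kf * (s i - s (Suc i)) < kf * L"
      using sL[of i] sL[of "Suc i"] kf by (auto intro!: mult_strict_left_mono)
    then show "- pi < kf * (s (Suc i) - s i)" "kf * (s (Suc i) - s i) < pi"
      using kL by (auto simp: algebra_simps)
  qed
  have const: "kf * (s (Suc i) - s i) = Arg (- cis (- 2 * snd x))" for i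
    using small[of i] step(3)[of i] \<alpha>[of i]
    by (intro cis_Arg_unique[symmetric]) (auto simp: sgn_minus norm_minus_cancel sgn_eq)
  define \<Delta> where "\<Delta> = s 1 - s 0"
  have d: "s (Suc i) - s i = \<Delta>" for i
  proof -
    have "kf * (s (Suc i) - s i) = kf * (s (Suc 0) - s 0)" unfolding const ..
    then show ?thesis using kf unfolding \<Delta>_def by (simp only: mult_cancel_left) simp
  qed
  have "\<Delta> \<noteq> 0" using step(2)[of 0] by (simp add: \<Delta>_def)
  have lin: "s i = s 0 + real i * \<Delta>" for i
    by (induction i) (use d in \<open>auto simp: algebra_simps\<close>)
  obtain n where n: "L < real n * \<bar>\<Delta>\<bar>" using reals_Archimedean3[of "\<bar>\<Delta>\<bar>"] \<open>\<Delta> \<noteq> 0\<close> by auto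
  have "\<bar>s n - s 0\<bar> = real n * \<bar>\<Delta>\<bar>" using lin[of n] by (simp add: abs_mult)
  moreover have "\<bar>s n - s 0\<bar> < L" using sL[of n] sL[of 0] by linarith
  ultimately show False using n by simp
qed

section \<open>Strict invariance of the cones\<close>

abbreviation good_states :: "state set" where
  "good_states \<equiv> good exceptional \<inter> phase_space W"

text \<open>The set \<open>K\<close> is independent of the bundle because intermediate steps of the
  argument use sets other than the cone of the state, such as a cone with one boundary ray
  removed.\<close>

definition strictly_mapped :: "state \<Rightarrow> (real \<times> real) set \<Rightarrow> bool" where
  "strictly_mapped x K \<longleftrightarrow> (\<exists>n\<ge>1. (\<forall>j<n. (return_map W ^^ j) x \<in> return_dom W) \<and>
     (\<exists>D. ((return_map W ^^ n) has_derivative D) (at x) \<and>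
       D ` (K - {0}) \<subseteq> interior (cone_bundle W ((return_map W ^^ n) x))))"

lemma good_state:
  assumes "x \<in> good_states"
  shows "regular W x" "curv_at W (fst x) = kf \<or> curv_at W (fst x) = kd" "x \<notin> exceptional"
    "(collision_map W ^^ i) x \<in> collision_dom W"
proof -
  show r: "regular W x" "(collision_map W ^^ i) x \<in> collision_dom W" for i
    using assms by (auto simp: good_def)
  show "curv_at W (fst x) = kf \<or> curv_at W (fst x) = kd"
    using curved_state(3)[OF r(1)] regular_phase_space[OF r(1)] assms by auto
  have "(collision_map W ^^ 0) x \<in> collision_dom W - exceptional" using assms unfolding good_def by blast
  then show "x \<notin> exceptional" by simp
qed

lemma good_return:
  assumes "x \<in> good_states"
  obtains n y where "first_return W n x y" "return_map W x = y" "x \<in> return_dom W" "y \<in> good_states"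
proof -
  obtain n y where fr: "first_return W n x y"
    using return_exists[of x] good_state(4)[OF assms] assms by blast
  then have "y \<in> good_states"
    using good_collision[of x exceptional "Suc n"] assms unfolding first_return_iff by auto
  then show ?thesis using that fr return_map_eq return_dom_in by blast
qed

lemma cone_bundle_return:
  assumes "first_return W n x y" "x \<in> good_states" "y \<in> good_states"
  shows "cone_bundle W y = (if curv_at W (fst y) = kd then {w. 0 \<le> form0 W y w}
    else if curv_at W (fst x) = kf then {w. 0 \<le> form2 W y w}
    else if n = 0 then {w. 0 \<le> form1 W y w} else {w. 0 \<le> form2 W y w})"
proof -
  have inv: "return_inv W y = x"
    using return_inv_return_map[of x] return_map_eq[OF assms(1)] return_dom_in[OF assms(1)] by simp
  have c: "0 < cos (snd y)" by (rule cos_pos[OF good_state(1)[OF assms(3)]])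
  have kk: "kd \<noteq> kf" using kd kf by simp
  show ?thesis
    using good_state(2)[OF assms(3)] good_state(2)[OF assms(2)] kd kf kk
    by (auto simp: cone_bundle_def inv flat_collisions_eq[OF assms(1)] cone0_eq[OF c] cone1_eq[OF c] cone2_eq[OF c])
qed

text \<open>The choice of cone at a focusing point refers to the preimage under the return map,
  which may fail to exist or to be good. Both possible cones are therefore carried along.\<close>

lemma cone_bundle_good:
  assumes "x \<in> good_states"
  shows "curv_at W (fst x) = kd \<and> cone_bundle W x = {w. 0 \<le> form0 W x w} \<or>
    curv_at W (fst x) = kf \<and> (cone_bundle W x = {w. 0 \<le> form1 W x w} \<or> cone_bundle W x = {w. 0 \<le> form2 W x w})"
proof -
  have c: "0 < cos (snd x)" by (rule cos_pos[OF good_state(1)[OF assms]])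
  show ?thesis
    using good_state(2)[OF assms] kd kf
    by (auto simp: cone_bundle_def cone0_eq[OF c] cone1_eq[OF c] cone2_eq[OF c])
qed

lemma interior_cone_bundle:
  assumes fr: "first_return W n x y" "x \<in> good_states" "y \<in> good_states"
    and "curv_at W (fst y) = kd \<Longrightarrow> 0 < form0 W y w"
    and "curv_at W (fst y) = kf \<Longrightarrow> curv_at W (fst x) = kf \<or> 0 < n \<Longrightarrow> 0 < form2 W y w"
    and "curv_at W (fst y) = kf \<Longrightarrow> curv_at W (fst x) = kd \<Longrightarrow> n = 0 \<Longrightarrow> 0 < form1 W y w"
  shows "w \<in> interior (cone_bundle W y)"
  unfolding cone_bundle_return[OF fr]
  using assms(4-6) good_state(2)[OF fr(2)] good_state(2)[OF fr(3)]
  by (auto intro!: form_interior continuous_forms)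

text \<open>Pulled back through the collision, the two factors of \<open>form2\<close> become the
  conditions of arriving parallel and of arriving with the last focus at distance
  \<open>c' / k'\<close>. The sign of the beam map enters squared.\<close>

lemma return_beam_forms:
  assumes fr: "first_return W n x y" and r: "regular W x" "regular W y"
  defines "J \<equiv> displacement x" and "J' \<equiv> rotation W x" and "\<tau> \<equiv> path_length (Suc n) x"
    and "c' \<equiv> cos (snd y)" and "k' \<equiv> curv_at W (fst y)"
  obtains D where "(return_map W has_derivative D) (at x)" "D 0 = 0" "\<And>v. v \<noteq> 0 \<Longrightarrow> D v \<noteq> 0"
    "\<And>v. form0 W y (D v) = (J v + \<tau> * J' v) * (c' * J' v - k' * (J v + \<tau> * J' v))"
    "\<And>v. form1 W y (D v) = (J v + \<tau> * J' v) * (J' v - 2 * k' * (J v + \<tau> * J' v) / c')"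
    "\<And>v. form2 W y (D v) = c' * J' v * (k' * (J v + \<tau> * J' v) - c' * J' v)"
    "\<And>v. c' * rotation W y (D v) + k' * displacement y (D v) = 0 \<longleftrightarrow> k' * (J v + \<tau> * J' v) - c' * J' v = 0"
proof -
  obtain D \<epsilon> where D: "(return_map W has_derivative D) (at x)" "\<bar>\<epsilon>\<bar> = 1"
    "\<And>v. displacement y (D v) = \<epsilon> * (J v + \<tau> * J' v)"
    "\<And>v. rotation W y (D v) = \<epsilon> * (J' v - 2 * k' * (J v + \<tau> * J' v) / c')"
    using return_map_beam[OF fr] unfolding J_def J'_def \<tau>_def c'_def k'_def by metis
  have c: "0 < c'" unfolding c'_def by (rule cos_pos[OF r(2)])
  have ee: "\<epsilon> * \<epsilon> = 1" using D(2) by (simp add: abs_if split: if_splits)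
  define A where "A v = J v + \<tau> * J' v" for v
  define B where "B v = J' v - 2 * k' * A v / c'" for v
  have cB: "c' * B v = c' * J' v - 2 * k' * A v" for v using c by (simp add: B_def field_simps)
  have dA: "displacement y (D v) = \<epsilon> * A v" "rotation W y (D v) = \<epsilon> * B v" for v
    by (simp_all add: D A_def B_def)
  have D0: "D 0 = 0" using has_derivative_bounded_linear[OF D(1)] linear_simps(3) by blast
  have inj: "D v \<noteq> 0" if "v \<noteq> 0" for v
  proof
    assume "D v = 0"
    then have "\<epsilon> * A v = 0" "\<epsilon> * B v = 0"
      using dA[of v] by (simp_all add: displacement_def rotation_def)
    then have "A v = 0" "B v = 0" using D(2) by auto
    then have "J' v = 0" "J v = 0" using c by (simp_all add: B_def A_def)
    then show False using beam_nonzero[OF cos_pos[OF r(1)] that, of W] by (simp add: J_def J'_def)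
  qed
  show ?thesis
  proof (rule that[OF D(1) D0 inj], unfold A_def[symmetric])
    fix v
    have "form0 W y (D v) = (\<epsilon> * \<epsilon>) * (A v * (c' * B v + k' * A v))"
      unfolding form0_def dA c'_def[symmetric] k'_def[symmetric] by (simp add: algebra_simps)
    then show "form0 W y (D v) = A v * (c' * J' v - k' * A v)" by (simp add: ee cB)
    have "form1 W y (D v) = (\<epsilon> * \<epsilon>) * (A v * B v)"
      unfolding form1_def dA by (simp add: algebra_simps)
    then show "form1 W y (D v) = A v * (J' v - 2 * k' * A v / c')" by (simp add: ee B_def)
    have "form2 W y (D v) = - ((\<epsilon> * \<epsilon>) * ((c' * B v + 2 * k' * A v) * (c' * B v + k' * A v)))"
      unfolding form2_def dA c'_def[symmetric] k'_def[symmetric] by (simp add: algebra_simps)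
    then show "form2 W y (D v) = c' * J' v * (k' * A v - c' * J' v)" by (simp add: ee cB algebra_simps)
    have "c' * (\<epsilon> * B v) + k' * (\<epsilon> * A v) = \<epsilon> * (c' * B v + k' * A v)" by (simp add: algebra_simps)
    then show "c' * rotation W y (D v) + k' * displacement y (D v) = 0 \<longleftrightarrow> k' * A v - c' * J' v = 0"
      using D(2) unfolding dA cB by auto
  qed
qed

lemma return_geometry:
  assumes fr: "first_return W n x y" and x: "x \<in> good_states" and y: "y \<in> good_states"
  defines "\<tau> \<equiv> path_length (Suc n) x"
  shows "0 < \<tau>" "0 < n \<Longrightarrow> 2 / kf < \<tau>"
    "\<lbrakk>n = 0; curv_at W (fst x) = kf; curv_at W (fst y) = kd\<rbrakk> \<Longrightarrow> \<tau> - cos (snd y) / kd < cos (snd x) / (2 * kf)"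
    "\<lbrakk>n = 0; curv_at W (fst x) = kd; curv_at W (fst y) = kf\<rbrakk> \<Longrightarrow> \<tau> - cos (snd x) / kd < cos (snd y) / (2 * kf)"
    "\<lbrakk>n = 0; curv_at W (fst x) = kf; curv_at W (fst y) = kf\<rbrakk> \<Longrightarrow>
       \<tau> = cos (snd x) / kf + cos (snd y) / kf \<and> cos (snd y) / kf < \<tau>"
proof -
  note gx = good_state[OF x] and gy = good_state[OF y]
  have nx: "non_corner W (fst x)" and ny: "non_corner W (fst y)" using gx(1) gy(1) by (simp_all add: regular_def)
  have d: "x \<in> collision_dom W" using gx(4)[of 0] by simp
  have "0 < path_length 1 x" using flight(1)[OF d] by (simp add: path_length_def)
  also have "path_length 1 x \<le> \<tau>"
    using order_trans[OF zero_le_dist path_length_dist[of 1 "Suc n" x]] by (simp add: \<tau>_def)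
  finally show "0 < \<tau>" .
  show "2 / kf < \<tau>" if "0 < n"
    using excursion_length[OF fr that] strips unfolding \<tau>_def by simp
  assume n: "n = 0"
  then have yT: "y = collision_map W x" and \<tau>: "\<tau> = flight x" using fr
    by (simp_all add: first_return_iff \<tau>_def path_length_def)
  have p: "point_at W (fst y) = point_at W (fst x) + flight x *\<^sub>R velocity W x" and f: "0 < flight x"
    using flight[OF d] yT by simp_all
  have cc: "next_collision W x y" unfolding yT by (rule collision_map_in[OF d])
  note inc = incoming_normal(1)[OF cc]
  have cx: "0 < cos (snd x)" and cy: "0 < cos (snd y)" using gx(1) gy(1) by (auto intro: cos_pos)
  { assume "curv_at W (fst x) = kf" "curv_at W (fst y) = kd"
    then show "\<tau> - cos (snd y) / kd < cos (snd x) / (2 * kf)"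
      using chord_bound_strict[OF ny _ gx(1) _ p _ f] inc cy not_exceptional(1)[OF gx(3)] \<tau> by simp }
  { assume k: "curv_at W (fst x) = kd" "curv_at W (fst y) = kf"
    \<comment> \<open>The chord bound concerns flights that start on the focusing arc, so the flight
      is reversed.\<close>
    let ?y = "time_reversal y"
    have vy: "velocity W ?y = - velocity W x"
      using velocity_reversal[OF ny] cc norm_normal_at[OF ny] by (simp add: next_collision_iff)
    have "point_at W (fst x) = point_at W (fst ?y) + flight x *\<^sub>R velocity W ?y" by (simp add: vy p)
    moreover have vx: "velocity W ?y \<bullet> normal_at W (fst x) = - cos (snd x)"
      using velocity_normal[OF nx] by (simp add: vy)
    ultimately show "\<tau> - cos (snd x) / kd < cos (snd y) / (2 * kf)"
      using chord_bound_strict[OF nx k(1), of ?y "flight x"] gy(1) k cx f not_exceptional(2)[OF gy(3)] \<tau>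
      by simp }
  { assume "curv_at W (fst x) = kf" "curv_at W (fst y) = kf"
    from focusing_chord(1,2)[OF d yT this] cx kf
    show "\<tau> = cos (snd x) / kf + cos (snd y) / kf \<and> cos (snd y) / kf < \<tau>"
      by (simp add: \<tau> divide_strict_right_mono) }
qed

text \<open>The clauses start from the three possible cones at \<open>x\<close>, since the bundle
  itself depends on the past. From \<open>form2\<close>, strictness is lost only on a direct flight
  within the focusing arc, and there only on the ray focusing at the midpoint of the chord. From
  \<open>form1\<close>, such a flight may leave the image on the boundary, but not on that
  ray.\<close>

lemma return_strict:
  assumes fr: "first_return W n x y" and x: "x \<in> good_states" and y: "y \<in> good_states"
  obtains D where "(return_map W has_derivative D) (at x)" "D 0 = 0" "\<And>v. v \<noteq> 0 \<Longrightarrow> D v \<noteq> 0"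
    "\<And>v. \<lbrakk>curv_at W (fst x) = kd; v \<noteq> 0; 0 \<le> form0 W x v\<rbrakk> \<Longrightarrow> D v \<in> interior (cone_bundle W y)"
    "\<And>v. \<lbrakk>curv_at W (fst x) = kf; curv_at W (fst y) = kd; v \<noteq> 0; 0 \<le> form1 W x v\<rbrakk>
      \<Longrightarrow> D v \<in> interior (cone_bundle W y)"
    "\<And>v. \<lbrakk>curv_at W (fst x) = kf; curv_at W (fst y) = kf; v \<noteq> 0; 0 \<le> form1 W x v\<rbrakk>
      \<Longrightarrow> 0 \<le> form2 W y (D v) \<and> cos (snd y) * rotation W y (D v) + kf * displacement y (D v) \<noteq> 0"
    "\<And>v. \<lbrakk>curv_at W (fst x) = kf; curv_at W (fst y) = kf; v \<noteq> 0; 0 \<le> form2 W x v\<rbrakk> \<Longrightarrow> 0 \<le> form2 W y (D v)"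
    "\<And>v. \<lbrakk>curv_at W (fst x) = kf; v \<noteq> 0; 0 \<le> form2 W x v;
       curv_at W (fst y) = kd \<or> 0 < n \<or> cos (snd x) * rotation W x v + kf * displacement x v \<noteq> 0\<rbrakk>
      \<Longrightarrow> D v \<in> interior (cone_bundle W y)"
proof -
  note gx = good_state[OF x] and gy = good_state[OF y]
  have cx: "0 < cos (snd x)" and cy: "0 < cos (snd y)" using gx(1) gy(1) by (auto intro: cos_pos)
  define \<tau> where "\<tau> = path_length (Suc n) x"
  note geo = return_geometry[OF fr x y, folded \<tau>_def]
  have kk: "kd \<noteq> kf" using kd kf by simp
  have le1: "cos (snd x) / kf \<le> 1 / kf" "cos (snd y) / kf \<le> 1 / kf"
    using kf by (simp_all add: divide_right_mono)
  \<comment> \<open>Half a chord of the focusing circle is at most 1 / kf long, so an excursion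
    longer than 2 / kf exceeds any two of them.\<close>
  have far: "cos (snd x) / kf + cos (snd y) / kf < \<tau>" "cos (snd x) / kf < \<tau>" "cos (snd y) / kf < \<tau>" if "0 < n"
  proof -
    have "0 < cos (snd x) / kf" "0 < cos (snd y) / kf" using cx cy kf by simp_all
    then show "cos (snd x) / kf + cos (snd y) / kf < \<tau>" "cos (snd x) / kf < \<tau>" "cos (snd y) / kf < \<tau>"
      using geo(2)[OF that] le1 by auto
  qed
  obtain D where D: "(return_map W has_derivative D) (at x)" "D 0 = 0" "\<And>v. v \<noteq> 0 \<Longrightarrow> D v \<noteq> 0"
    "\<And>v. form0 W y (D v) = (displacement x v + \<tau> * rotation W x v) * (cos (snd y) * rotation W x v -
        curv_at W (fst y) * (displacement x v + \<tau> * rotation W x v))"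
    "\<And>v. form1 W y (D v) = (displacement x v + \<tau> * rotation W x v) * (rotation W x v -
        2 * curv_at W (fst y) * (displacement x v + \<tau> * rotation W x v) / cos (snd y))"
    "\<And>v. form2 W y (D v) = cos (snd y) * rotation W x v *
        (curv_at W (fst y) * (displacement x v + \<tau> * rotation W x v) - cos (snd y) * rotation W x v)"
    "\<And>v. cos (snd y) * rotation W y (D v) + curv_at W (fst y) * displacement y (D v) = 0 \<longleftrightarrow>
        curv_at W (fst y) * (displacement x v + \<tau> * rotation W x v) - cos (snd y) * rotation W x v = 0"
    using return_beam_forms[OF fr gx(1) gy(1), folded \<tau>_def] by metis
  note nz = beam_nonzero[OF cx, of _ W]
  show ?thesis
  proof (rule that[OF D(1-3)])
    fix v :: "real \<times> real" assume v: "v \<noteq> 0"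
    { assume k: "curv_at W (fst x) = kd" and q: "0 \<le> form0 W x v"
      note q' = q[unfolded form0_def k]
      show "D v \<in> interior (cone_bundle W y)"
      proof (rule interior_cone_bundle[OF fr x y])
        assume k': "curv_at W (fst y) = kd"
        show "0 < form0 W y (D v)" unfolding D k'
          by (rule diverging_to_form0[OF form0_diverging[OF q' cx kd(2)] nz[OF v] geo(1) cy kd(2)])
      next
        assume k': "curv_at W (fst y) = kf" and "curv_at W (fst x) = kf \<or> 0 < n"
        then have "0 < n" using k kk by simp
        show "0 < form2 W y (D v)" unfolding D k'
          by (rule form0_to_form2[OF q' nz[OF v] cx kd(2) cy kf(1) far(3)[OF \<open>0 < n\<close>]])
      next
        assume k': "curv_at W (fst y) = kf" and "n = 0"
        show "0 < form1 W y (D v)" unfolding D k'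
          by (rule form0_to_form1[OF q' nz[OF v] cx kd(2) cy kf(1) geo(1) geo(4)[OF \<open>n = 0\<close> k k']])
      qed }
    { assume k: "curv_at W (fst x) = kf" and k': "curv_at W (fst y) = kd" and q: "0 \<le> form1 W x v"
      show "D v \<in> interior (cone_bundle W y)"
      proof (rule interior_cone_bundle[OF fr x y])
        show "0 < form0 W y (D v)" unfolding D k'
          by (rule diverging_to_form0[OF q[unfolded form1_def] nz[OF v] geo(1) cy kd(2)])
      qed (use k' kk in simp_all) }
    { assume k: "curv_at W (fst x) = kf" and k': "curv_at W (fst y) = kf"
      have t: "cos (snd y) / kf < \<tau>" using far(3) geo(5)[OF _ k k'] by (cases "n = 0") auto
      have t': "cos (snd x) / kf + cos (snd y) / kf \<le> \<tau>"
        using far(1) geo(5)[OF _ k k'] by (cases "n = 0") auto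
      { assume q: "0 \<le> form1 W x v"
        show "0 \<le> form2 W y (D v) \<and> cos (snd y) * rotation W y (D v) + kf * displacement y (D v) \<noteq> 0"
          using form1_to_form2[OF q[unfolded form1_def] nz[OF v] cy kf(1) t] D(6,7)[of v] unfolding k' by simp }
      { assume q: "0 \<le> form2 W x v"
        show "0 \<le> form2 W y (D v)"
          unfolding D k' using form2_to_form2(1)[OF q[unfolded form2_def k] nz[OF v] cx kf(1) cy kf(1) t'] . } }
    { assume k: "curv_at W (fst x) = kf" and q: "0 \<le> form2 W x v"
        and s: "curv_at W (fst y) = kd \<or> 0 < n \<or> cos (snd x) * rotation W x v + kf * displacement x v \<noteq> 0"
      note q' = q[unfolded form2_def k]
      show "D v \<in> interior (cone_bundle W y)"
      proof (rule interior_cone_bundle[OF fr x y])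
        assume k': "curv_at W (fst y) = kd"
        have "cos (snd x) / kf < \<tau> \<or> \<tau> - cos (snd y) / kd < cos (snd x) / (2 * kf)"
          using far(2) geo(3)[OF _ k k'] by (cases "n = 0") auto
        then show "0 < form0 W y (D v)" unfolding D k'
          by (rule form2_to_form0[OF q' nz[OF v] cx kf(1) cy kd(2)])
      next
        assume k': "curv_at W (fst y) = kf"
        have t': "cos (snd x) / kf + cos (snd y) / kf \<le> \<tau>"
          using far(1) geo(5)[OF _ k k'] by (cases "n = 0") auto
        have "cos (snd x) / kf + cos (snd y) / kf < \<tau> \<or> cos (snd x) * rotation W x v + kf * displacement x v \<noteq> 0"
          using s k' kk far(1) by auto
        then show "0 < form2 W y (D v)" unfolding D k'
          by (rule form2_to_form2(2)[OF q' nz[OF v] cx kf(1) cy kf(1) t'])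
      qed (use k kk in simp) }
  qed
qed

lemma cone_invariant:
  assumes x: "x \<in> good_states"
  shows "x \<in> return_dom W" "\<exists>D. (return_map W has_derivative D) (at x) \<and>
    D ` cone_bundle W x \<subseteq> cone_bundle W (return_map W x)"
proof -
  obtain n y where fr: "first_return W n x y" "return_map W x = y" "x \<in> return_dom W" and y: "y \<in> good_states"
    using good_return[OF x] .
  show "x \<in> return_dom W" by fact
  have kk: "kd \<noteq> kf" using kd kf by simp
  show "\<exists>D. (return_map W has_derivative D) (at x) \<and> D ` cone_bundle W x \<subseteq> cone_bundle W (return_map W x)"
  proof (rule return_strict[OF fr(1) x y])
    fix D
    assume D: "(return_map W has_derivative D) (at x)" "D 0 = 0"
      and D0: "\<And>v. \<lbrakk>curv_at W (fst x) = kd; v \<noteq> 0; 0 \<le> form0 W x v\<rbrakk> \<Longrightarrow> D v \<in> interior (cone_bundle W y)"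
      and D1: "\<And>v. \<lbrakk>curv_at W (fst x) = kf; curv_at W (fst y) = kd; v \<noteq> 0; 0 \<le> form1 W x v\<rbrakk>
        \<Longrightarrow> D v \<in> interior (cone_bundle W y)"
      and D2: "\<And>v. \<lbrakk>curv_at W (fst x) = kf; curv_at W (fst y) = kf; v \<noteq> 0; 0 \<le> form1 W x v\<rbrakk>
        \<Longrightarrow> 0 \<le> form2 W y (D v) \<and> cos (snd y) * rotation W y (D v) + kf * displacement y (D v) \<noteq> 0"
      and D3: "\<And>v. \<lbrakk>curv_at W (fst x) = kf; curv_at W (fst y) = kf; v \<noteq> 0; 0 \<le> form2 W x v\<rbrakk>
        \<Longrightarrow> 0 \<le> form2 W y (D v)"
      and D4: "\<And>v. \<lbrakk>curv_at W (fst x) = kf; v \<noteq> 0; 0 \<le> form2 W x v;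
         curv_at W (fst y) = kd \<or> 0 < n \<or> cos (snd x) * rotation W x v + kf * displacement x v \<noteq> 0\<rbrakk>
        \<Longrightarrow> D v \<in> interior (cone_bundle W y)"
    have "D v \<in> cone_bundle W y" if v: "v \<in> cone_bundle W x" for v
    proof (cases "v = 0")
      case True
      have "form0 W y 0 = 0" "form1 W y 0 = 0" "form2 W y 0 = 0"
        by (simp_all add: form0_def form1_def form2_def displacement_def rotation_def)
      then have "0 \<in> cone_bundle W y"
        using cone_bundle_good[OF y] by (elim disjE conjE) simp_all
      then show ?thesis by (simp only: True D(2))
    next
      case nz: False
      consider "curv_at W (fst x) = kd" "0 \<le> form0 W x v"
        | "curv_at W (fst x) = kf" "0 \<le> form1 W x v" | "curv_at W (fst x) = kf" "0 \<le> form2 W x v"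
        using cone_bundle_good[OF x] v by auto
      then show ?thesis
      proof cases
        case 1
        show ?thesis by (rule subsetD[OF interior_subset D0[OF 1(1) nz 1(2)]])
      next
        case 2
        from good_state(2)[OF y] show ?thesis
        proof
          assume ky: "curv_at W (fst y) = kf"
          then have "cone_bundle W y = {w. 0 \<le> form2 W y w}"
            using cone_bundle_return[OF fr(1) x y] 2(1) kk by simp
          then show ?thesis using D2[OF 2(1) ky nz 2(2)] by simp
        next
          assume "curv_at W (fst y) = kd"
          from D1[OF 2(1) this nz 2(2)] show ?thesis by (rule subsetD[OF interior_subset])
        qed
      next
        case 3
        from good_state(2)[OF y] show ?thesis
        proof
          assume ky: "curv_at W (fst y) = kf"
          then have "cone_bundle W y = {w. 0 \<le> form2 W y w}"
            using cone_bundle_return[OF fr(1) x y] 3(1) kk by simp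
          then show ?thesis using D3[OF 3(1) ky nz 3(2)] by simp
        next
          assume "curv_at W (fst y) = kd"
          from D4[OF 3(1) nz 3(2) disjI1[OF this]] show ?thesis by (rule subsetD[OF interior_subset])
        qed
      qed
    qed
    then show ?thesis using D(1) fr(2) by blast
  qed
qed

section \<open>Eventual strictness\<close>

lemma strictly_mapped_1:
  assumes "x \<in> return_dom W" "(return_map W has_derivative D) (at x)"
    "\<And>v. v \<in> K \<Longrightarrow> v \<noteq> 0 \<Longrightarrow> D v \<in> interior (cone_bundle W (return_map W x))"
  shows "strictly_mapped x K"
  unfolding strictly_mapped_def
proof (intro exI[of _ 1] conjI exI[of _ D])
  show "D ` (K - {0}) \<subseteq> interior (cone_bundle W ((return_map W ^^ 1) x))"
    using assms(3) unfolding funpow_simps_right id_def comp_def One_nat_def by blast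
qed (use assms(1,2) in simp_all)

lemma strictly_mapped_step:
  assumes x: "x \<in> return_dom W" "(return_map W has_derivative D) (at x)"
    and K: "\<And>v. v \<in> K \<Longrightarrow> v \<noteq> 0 \<Longrightarrow> D v \<in> K' \<and> D v \<noteq> 0" and y: "strictly_mapped (return_map W x) K'"
  shows "strictly_mapped x K"
proof -
  let ?F = "return_map W"
  obtain n E where n: "n \<ge> 1" "\<forall>j<n. (?F ^^ j) (?F x) \<in> return_dom W"
      "((?F ^^ n) has_derivative E) (at (?F x))" "E ` (K' - {0}) \<subseteq> interior (cone_bundle W ((?F ^^ n) (?F x)))"
    using y unfolding strictly_mapped_def by blast
  have eq: "(?F ^^ Suc j) z = (?F ^^ j) (?F z)" for j z by (simp add: funpow_swap1)
  show ?thesis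
    unfolding strictly_mapped_def
  proof (intro exI[of _ "Suc n"] conjI exI[of _ "\<lambda>v. E (D v)"] allI impI)
    fix j assume "j < Suc n"
    then show "(?F ^^ j) x \<in> return_dom W"
      using n(2) x(1) eq by (cases j) auto
  next
    show "((?F ^^ Suc n) has_derivative (\<lambda>v. E (D v))) (at x)"
    proof -
      have "?F ^^ Suc n = (\<lambda>z. (?F ^^ n) (?F z))" using eq by (rule ext)
      then show ?thesis using has_derivative_compose[OF x(2) n(3)] by simp
    qed
    show "(\<lambda>v. E (D v)) ` (K - {0}) \<subseteq> interior (cone_bundle W ((?F ^^ Suc n) x))"
      unfolding eq using n(4) K by blast
  qed simp
qed

text \<open>If the cone were never mapped strictly, every return would be a direct flight to the
  focusing arc, and the failure would pass to the next state. The returns would then be plain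
  collisions with that arc forever, contrary to \<open>focusing_finite\<close>.\<close>

lemma cone2_strictly_mapped:
  assumes x: "x \<in> good_states" "curv_at W (fst x) = kf"
  shows "strictly_mapped x {v. 0 \<le> form2 W x v}"
proof (rule ccontr)
  assume not: "\<not> ?thesis"
  let ?z = "\<lambda>i. (collision_map W ^^ i) x"
  have "?z i \<in> good_states \<and> curv_at W (fst (?z i)) = kf \<and> \<not> strictly_mapped (?z i) {v. 0 \<le> form2 W (?z i) v}" for i
  proof (induction i)
    case 0
    then show ?case using x not by simp
  next
    case (Suc i)
    then have z: "?z i \<in> good_states" and k: "curv_at W (fst (?z i)) = kf"
      and ns: "\<not> strictly_mapped (?z i) {v. 0 \<le> form2 W (?z i) v}" by blast+
    obtain n y where fr: "first_return W n (?z i) y" "return_map W (?z i) = y" "?z i \<in> return_dom W"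
      and y: "y \<in> good_states" using good_return[OF z] .
    show ?case
    proof (rule return_strict[OF fr(1) z y])
      fix D
      assume D: "(return_map W has_derivative D) (at (?z i))" "\<And>v. v \<noteq> 0 \<Longrightarrow> D v \<noteq> 0"
        and D3: "\<And>v. \<lbrakk>curv_at W (fst (?z i)) = kf; curv_at W (fst y) = kf; v \<noteq> 0; 0 \<le> form2 W (?z i) v\<rbrakk>
          \<Longrightarrow> 0 \<le> form2 W y (D v)"
        and D4: "\<And>v. \<lbrakk>curv_at W (fst (?z i)) = kf; v \<noteq> 0; 0 \<le> form2 W (?z i) v;
           curv_at W (fst y) = kd \<or> 0 < n \<or>
             cos (snd (?z i)) * rotation W (?z i) v + kf * displacement (?z i) v \<noteq> 0\<rbrakk>
          \<Longrightarrow> D v \<in> interior (cone_bundle W y)"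
      have "\<not> (curv_at W (fst y) = kd \<or> 0 < n)"
      proof
        assume "curv_at W (fst y) = kd \<or> 0 < n"
        then have "strictly_mapped (?z i) {v. 0 \<le> form2 W (?z i) v}"
          using D4[OF k] fr by (intro strictly_mapped_1[OF fr(3) D(1)]) auto
        then show False using ns by simp
      qed
      then have n: "n = 0" and ky: "curv_at W (fst y) = kf" using good_state(2)[OF y] by auto
      have yz: "y = ?z (Suc i)" using fr(1) n by (simp add: first_return_iff)
      have "\<not> strictly_mapped y {v. 0 \<le> form2 W y v}"
      proof
        assume "strictly_mapped y {v. 0 \<le> form2 W y v}"
        then have "strictly_mapped (?z i) {v. 0 \<le> form2 W (?z i) v}"
          using D3[OF k ky] D(2) fr(2) by (intro strictly_mapped_step[OF fr(3) D(1)]) auto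
        then show False using ns by simp
      qed
      then show ?thesis using y ky unfolding yz by blast
    qed
  qed
  then show False using focusing_finite[of x] good_state(4)[OF x(1)] by blast
qed

text \<open>A return to a dispersing arc is strict at once. After a return to the focusing arc the
  image lies in the cone of \<open>form2\<close> without the ray preserved by further collisions
  there, so the second return is strict.\<close>

lemma cone1_strictly_mapped:
  assumes x: "x \<in> good_states" "curv_at W (fst x) = kf"
  shows "strictly_mapped x {v. 0 \<le> form1 W x v}"
proof -
  obtain n y where fr: "first_return W n x y" "return_map W x = y" "x \<in> return_dom W"
    and y: "y \<in> good_states" using good_return[OF x(1)] .
  obtain m z where fr': "first_return W m y z" "return_map W y = z" "y \<in> return_dom W"
    and z: "z \<in> good_states" using good_return[OF y] .
  define K where "K = {v. 0 \<le> form2 W y v \<and> cos (snd y) * rotation W y v + kf * displacement y v \<noteq> 0}"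
  have K: "strictly_mapped y K" if ky: "curv_at W (fst y) = kf"
  proof (rule return_strict[OF fr'(1) y z])
    fix D
    assume D: "(return_map W has_derivative D) (at y)"
      and D4: "\<And>v. \<lbrakk>curv_at W (fst y) = kf; v \<noteq> 0; 0 \<le> form2 W y v;
         curv_at W (fst z) = kd \<or> 0 < m \<or> cos (snd y) * rotation W y v + kf * displacement y v \<noteq> 0\<rbrakk>
        \<Longrightarrow> D v \<in> interior (cone_bundle W z)"
    show ?thesis
      using D4[OF ky] fr'(2) by (intro strictly_mapped_1[OF fr'(3) D]) (auto simp: K_def)
  qed
  show ?thesis
  proof (rule return_strict[OF fr(1) x(1) y])
    fix D
    assume D: "(return_map W has_derivative D) (at x)" "\<And>v. v \<noteq> 0 \<Longrightarrow> D v \<noteq> 0"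
      and D1: "\<And>v. \<lbrakk>curv_at W (fst x) = kf; curv_at W (fst y) = kd; v \<noteq> 0; 0 \<le> form1 W x v\<rbrakk>
        \<Longrightarrow> D v \<in> interior (cone_bundle W y)"
      and D2: "\<And>v. \<lbrakk>curv_at W (fst x) = kf; curv_at W (fst y) = kf; v \<noteq> 0; 0 \<le> form1 W x v\<rbrakk>
        \<Longrightarrow> 0 \<le> form2 W y (D v) \<and> cos (snd y) * rotation W y (D v) + kf * displacement y (D v) \<noteq> 0"
    consider "curv_at W (fst y) = kd" | "curv_at W (fst y) = kf" using good_state(2)[OF y] by blast
    then show ?thesis
    proof cases
      case 1
      then show ?thesis using D1[OF x(2)] fr(2) by (intro strictly_mapped_1[OF fr(3) D(1)]) auto
    next
      case 2
      then show ?thesis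
        using D2[OF x(2)] D(2) K fr(2) by (intro strictly_mapped_step[OF fr(3) D(1), of _ K]) (auto simp: K_def)
    qed
  qed
qed

lemma cone_strictly_mapped:
  assumes x: "x \<in> good_states"
  shows "strictly_mapped x (cone_bundle W x)"
  using cone_bundle_good[OF x]
proof (elim disjE conjE)
  assume k: "curv_at W (fst x) = kd" and C: "cone_bundle W x = {w. 0 \<le> form0 W x w}"
  obtain n y where fr: "first_return W n x y" "return_map W x = y" "x \<in> return_dom W"
    and y: "y \<in> good_states" using good_return[OF x] .
  show ?thesis
  proof (rule return_strict[OF fr(1) x y])
    fix D
    assume D: "(return_map W has_derivative D) (at x)"
      and D0: "\<And>v. \<lbrakk>curv_at W (fst x) = kd; v \<noteq> 0; 0 \<le> form0 W x v\<rbrakk> \<Longrightarrow> D v \<in> interior (cone_bundle W y)"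
    show ?thesis using D0[OF k] fr(2) C by (intro strictly_mapped_1[OF fr(3) D]) auto
  qed
qed (use cone1_strictly_mapped[OF x] cone2_strictly_mapped[OF x] in simp_all)

text \<open>The density vanishes off the phase space, corners and grazing angles lie on finitely
  many lines, and the remaining bad states are null by \<open>negligible_not_good\<close>.\<close>

lemma AE_good: "AE x in invariant_measure W. x \<in> good_states"
proof -
  define I where "I = {i. i < length W \<and> curv (W ! i) \<noteq> 0}"
  define c where "c = 1 / (2 * (\<Sum>i\<in>I. wall_length (W ! i)))"
  have PS: "phase_space W \<in> sets borel"
  proof -
    have "closed ((\<Union>i\<in>I. {offset W i..offset W (Suc i)}) \<times> {- (pi/2)..pi/2})"
      by (intro closed_Times closed_UN) (auto simp: I_def)
    then show ?thesis unfolding phase_space_def I_def by (rule borel_closed)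
  qed
  define f where "f = (\<lambda>(s, \<alpha>). ennreal (c * cos \<alpha> * indicator (phase_space W) (s, \<alpha>)))"
  have f: "f \<in> borel_measurable lborel"
  proof -
    have "(\<lambda>z::state. c * cos (snd z)) \<in> borel_measurable borel"
      by (intro borel_measurable_continuous_onI continuous_intros)
    then have "(\<lambda>z. ennreal (c * cos (snd z) * indicator (phase_space W) z)) \<in> borel_measurable borel"
      using PS by measurable
    then show ?thesis by (simp add: f_def case_prod_beta')
  qed
  have "{x \<in> phase_space W. \<not> regular W x} \<subseteq>
      (\<Union>c\<in>offset W ` {..length W}. {x. fst x = c}) \<union> {x. snd x = pi/2} \<union> {x. snd x = - (pi/2)}" (is "_ \<subseteq> ?N")
  proof
    fix x assume x: "x \<in> {x \<in> phase_space W. \<not> regular W x}"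
    then obtain i where i: "i < length W" "offset W i \<le> fst x" "fst x \<le> offset W (Suc i)"
        "- (pi/2) \<le> snd x" "snd x \<le> pi/2"
      by (auto simp: phase_space_def)
    show "x \<in> ?N"
    proof (rule ccontr)
      assume n: "x \<notin> ?N"
      then have "fst x \<noteq> offset W i" "fst x \<noteq> offset W (Suc i)" using i(1) by auto
      then have "non_corner W (fst x)" using i by (auto simp: non_corner_def)
      moreover have "\<bar>snd x\<bar> < pi/2" using n i(4,5) by (auto simp: abs_less_iff)
      ultimately show False using x by (simp add: regular_def)
    qed
  qed
  moreover have "negligible ?N"
  proof -
    have neg: "negligible {x::state. fst x = a}" "negligible {x::state. snd x = a}" for a
      using negligible_hyperplane[of "(1::real, 0::real)" a] negligible_hyperplane[of "(0::real, 1::real)" a]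
      by (simp_all add: inner_prod_def zero_prod_def)
    then have "negligible (\<Union>c\<in>offset W ` {..length W}. {x::state. fst x = c})"
      by (intro negligible_Union finite_imageI) auto
    then show ?thesis by (intro negligible_Un neg)
  qed
  ultimately have "negligible ({x \<in> phase_space W. \<not> regular W x} \<union> {x. regular W x \<and> x \<notin> good exceptional})"
    (is "negligible ?M")
    using negligible_not_good[OF negligible_exceptional] by (meson negligible_Un negligible_subset)
  then have "?M \<in> null_sets (completion lborel)" by (simp add: negligible_iff_null_sets)
  then have "AE x in completion lborel. x \<notin> ?M" by (rule AE_not_in)
  then have "AE x in lborel. x \<notin> ?M" by (simp only: AE_completion_iff)
  then have "AE x in lborel. 0 < f x \<longrightarrow> x \<in> good_states"
  proof eventually_elim
    case (elim x)
    have "x \<in> phase_space W" if "0 < f x"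
      using that by (cases x; cases "x \<in> phase_space W") (simp_all add: f_def)
    then show ?case using elim by blast
  qed
  then have "AE x in density lborel f. x \<in> good_states" unfolding AE_density[OF f] .
  then show ?thesis
    by (simp only: invariant_measure_def Let_def f_def c_def I_def)
qed

end

theorem theorem4p2:
  fixes kd h kf l :: real
  defines "W \<equiv> table kd h kf l"
  defines "\<mu> \<equiv> invariant_measure W"
  defines "F \<equiv> return_map W"
  defines "C \<equiv> cone_bundle W"
  assumes kd: "- sqrt 2 < kd" "kd < 0"
    and h: "0 < h"
    and kf: "0 < kf" "kf \<le> 2"
    and l: "0 < l"
    and chords: "\<And>w' t' w'' t''.
      \<lbrakk>w' \<in> dispersing_walls W; t' \<in> {0..wall_length w'};
       w'' \<in> focusing_walls W; t'' \<in> {0..wall_length w''}\<rbrakk>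
      \<Longrightarrow> chord w' t' w'' t'' \<subseteq> disc 4 w'' t''"
    and strips: "l \<ge> 1 / kf"
  shows "(AE x in \<mu>. x \<in> return_dom W \<and>
            (\<exists>D. (F has_derivative D) (at x) \<and> D ` C x \<subseteq> C (F x))) \<and>
         (AE x in \<mu>. \<exists>n\<ge>1. (\<forall>j<n. (F ^^ j) x \<in> return_dom W) \<and>
            (\<exists>D. ((F ^^ n) has_derivative D) (at x) \<and>
                 D ` (C x - {0}) \<subseteq> interior (C ((F ^^ n) x))))"
proof -
  interpret chord_table kd h kf l
    using kd h kf l chords strips unfolding W_def by unfold_locales
  show ?thesis
    unfolding \<mu>_def F_def C_def W_def
  proof (intro conjI)
    show "AE x in invariant_measure (table kd h kf l). x \<in> return_dom (table kd h kf l) \<and>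
      (\<exists>D. (return_map (table kd h kf l) has_derivative D) (at x) \<and>
        D ` cone_bundle (table kd h kf l) x \<subseteq> cone_bundle (table kd h kf l) (return_map (table kd h kf l) x))"
      using AE_good by eventually_elim (use cone_invariant in blast)
    show "AE x in invariant_measure (table kd h kf l). \<exists>n\<ge>1.
      (\<forall>j<n. (return_map (table kd h kf l) ^^ j) x \<in> return_dom (table kd h kf l)) \<and>
      (\<exists>D. ((return_map (table kd h kf l) ^^ n) has_derivative D) (at x) \<and>
        D ` (cone_bundle (table kd h kf l) x - {0}) \<subseteq>
          interior (cone_bundle (table kd h kf l) ((return_map (table kd h kf l) ^^ n) x)))"
      using AE_good
    proof eventually_elim
      case (elim x)
      then show ?case using cone_strictly_mapped[OF elim] unfolding strictly_mapped_def by simp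
    qed
  qed
qed

end
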